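(* Let $g$ be a Riemannian metric on $Q$, $L(v)=\frac12 g(v,v)$, and $\mathcal{D}$ a distribution on $Q$. For a symmetric $(0,2)$-tensor field $\hat g$ with $\theta_i=\hat g_{ai}v^a$ (functions on $\mathcal{C}$), consider on $\mathcal{C}$ the equations $$(A)\quad \theta_kR^k_{ac}v^a=0\ \text{ for all } c,\qquad (B)\quad \Gamma_{(L,\mathcal{D})}(\theta_i)+\theta_kR^k_{ia}v^a+\lambda_i=0\ \text{ for all } i .$$ 1. If $\hat g$ is a Riemannian metric that is a $\mathcal{D}$-preserving modification of $g$ and a geodesic extension of $(L,\mathcal{D})$, then its restriction $\hat g|_{\mathcal{D}\times\mathcal{D}^g}=(\hat g_{ai})$ satisfies the algebraic conditions $(A)$ and the PDE conditions $(B)$. 2. If $\hat g$ is a $(0,2)$-tensor field that is a $\mathcal{D}$-preserving modification of $g$ and whose restriction $\hat g|_{\mathcal{D}\times\mathcal{D}^g}=(\hat g_{ai})$ satisfies the algebraic conditions $(A)$ and the PDE conditions $(B)$, then there exists a geodesic extension of $(L,\mathcal{D})$ by a Riemannian metric.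
   Context: All objects are smooth and repeated indices are summed. $Q$ is an $n$-dimensional manifold, $\mathcal{D}$ has rank $m$, $\mathcal{D}^g$ is the $g$-orthogonal complement of $\mathcal{D}$. A globally defined frame $\{X_\alpha\}=\{X_a,X_i\}$ on $Q$ is fixed, with $\{X_a\}$ ($a,b,c,\ldots\in\{1,\dots,m\}$) spanning $\mathcal{D}$ and $\{X_i\}$ ($i,k\in\{1,\dots,n-m\}$) spanning $\mathcal{D}^g$. $[X_\alpha,X_\beta]=R^\gamma_{\alpha\beta}X_\gamma$; $\hat g_{\alpha\beta}=\hat g(X_\alpha,X_\beta)$. Quasi-velocities $v^\alpha=(v^a,v^i)$ are the functions on $TQ$ with $v_q=v^\alpha X_\alpha(q)$; $\mathcal{C}=\{v^i=0\}$ is $\mathcal{D}$ viewed as a submanifold of $TQ$. $X^C$, $X^V$ denote the complete and vertical lifts to $TQ$ of a vector field $X$ on $Q$. The nonholonomic vector field $\Gamma_{(L,\mathcal{D})}$ is the unique vector field on $\mathcal{C}$ of the form $v^aX_a^C+f^aX_a^V$ satisfying $\Gamma_{(L,\mathcal{D})}(X^V(L))-X^C(L)=0$ on $\mathcal{C}$ for all $X\in\mathrm{Sec}(\mathcal{D})$. The multipliers are the functions $\lambda_i=\Gamma_{(L,\mathcal{D})}(X_i^V(L))-X_i^C(L)$ on $\mathcal{C}$. A symmetric $(0,2)$-tensor field $\hat g$ on $Q$ is a $\mathcal{D}$-preserving modification of $g$ if $\hat g|_{\mathcal{D}\times\mathcal{D}}=g|_{\mathcal{D}\times\mathcal{D}}$.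 A geodesic extension of $(L,\mathcal{D})$ is a Riemannian metric $\hat g$ on $Q$ whose geodesic spray $\Gamma_{\hat g}$ (a vector field on $TQ$) is a SODE extension of $\Gamma_{(L,\mathcal{D})}$, i.e. $\Gamma_{\hat g}|_{\mathcal{C}}=\Gamma_{(L,\mathcal{D})}$ (equivalently, every nonholonomic trajectory, i.e. base integral curve of $\Gamma_{(L,\mathcal{D})}$, is a geodesic of $\hat g$). *)

theory Defs
  imports "HOL-Analysis.Analysis"
begin

section \<open>Smooth maps between open subsets of Euclidean spaces\<close>

text \<open>Both predicates are meant for open \<open>S\<close>.\<close>

fun Ck_on :: "nat \<Rightarrow> ('a::euclidean_space \<Rightarrow> 'b::real_normed_vector) \<Rightarrow> 'a set \<Rightarrow> bool" where
  "Ck_on 0 f S \<longleftrightarrow> continuous_on S f"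
| "Ck_on (Suc k) f S \<longleftrightarrow> f differentiable_on S \<and>
     (\<forall>b\<in>Basis. Ck_on k (\<lambda>x. frechet_derivative f (at x) b) S)"

definition smooth_on :: "('a::euclidean_space \<Rightarrow> 'b::real_normed_vector) \<Rightarrow> 'a set \<Rightarrow> bool" where
  "smooth_on f S \<longleftrightarrow> (\<forall>k. Ck_on k f S)"

section \<open>Smooth manifolds\<close>

text \<open>A manifold is a set of points with an indexed atlas of charts into the model space \<open>'e\<close>,
  so its dimension is \<open>DIM('e)\<close>. The topology is the one induced by the atlas.\<close>

record ('p, 'c, 'e) mfd =
  points :: "'p set"
  charts :: "'c set"
  chart_dom :: "'c \<Rightarrow> 'p set"
  coords :: "'c \<Rightarrow> 'p \<Rightarrow> 'e"

definition inv_coords :: "('p, 'c, 'e) mfd \<Rightarrow> 'c \<Rightarrow> 'e \<Rightarrow> 'p" where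
  "inv_coords M c = inv_into (chart_dom M c) (coords M c)"

definition charts_at :: "('p, 'c, 'e) mfd \<Rightarrow> 'p \<Rightarrow> 'c set" where
  "charts_at M p = {c \<in> charts M. p \<in> chart_dom M c}"

definition transition :: "('p, 'c, 'e) mfd \<Rightarrow> 'c \<Rightarrow> 'c \<Rightarrow> 'e \<Rightarrow> 'e" where
  "transition M c d = (\<lambda>x. coords M d (inv_coords M c x))"

definition mfd_topology :: "('p, 'c, 'e::euclidean_space) mfd \<Rightarrow> 'p topology" where
  "mfd_topology M = topology (\<lambda>W. W \<subseteq> points M \<and>
     (\<forall>c\<in>charts M. open (coords M c ` (W \<inter> chart_dom M c))))"

definition smooth_manifold :: "('p, 'c, 'e::euclidean_space) mfd \<Rightarrow> bool" where
  "smooth_manifold M \<longleftrightarrow>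
     points M = (\<Union>c\<in>charts M. chart_dom M c) \<and>
     (\<forall>c\<in>charts M. inj_on (coords M c) (chart_dom M c)) \<and>
     (\<forall>c\<in>charts M. \<forall>d\<in>charts M.
        open (coords M c ` (chart_dom M c \<inter> chart_dom M d)) \<and>
        smooth_on (transition M c d) (coords M c ` (chart_dom M c \<inter> chart_dom M d))) \<and>
     Hausdorff_space (mfd_topology M) \<and> second_countable (mfd_topology M)"

definition smooth_fun :: "('p, 'c, 'e::euclidean_space) mfd \<Rightarrow> ('p \<Rightarrow> real) \<Rightarrow> bool" where
  "smooth_fun M f \<longleftrightarrow>
     (\<forall>c\<in>charts M. smooth_on (\<lambda>x. f (inv_coords M c x)) (coords M c ` chart_dom M c))"

section \<open>Tangent vectors and vector fields\<close>

text \<open>A tangent vector at \<open>p\<close> is the family of its coordinate vectors in the charts around \<open>p\<close>,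
  related by the Jacobians of the transition maps (and \<open>0\<close> at the indices of the other charts,
  so that equal tangent vectors are equal functions). Linear operations are pointwise.\<close>

definition tspace :: "('p, 'c, 'e::euclidean_space) mfd \<Rightarrow> 'p \<Rightarrow> ('c \<Rightarrow> 'e) set" where
  "tspace M p = {v. (\<forall>c. c \<notin> charts_at M p \<longrightarrow> v c = 0) \<and>
     (\<forall>c\<in>charts_at M p. \<forall>d\<in>charts_at M p.
        v d = frechet_derivative (transition M c d) (at (coords M c p)) (v c))}"

text \<open>The tangent vector at \<open>p\<close> whose coordinate vector in the chart \<open>c\<close> is \<open>e\<close>.\<close>

definition coord_vec :: "('p, 'c, 'e::euclidean_space) mfd \<Rightarrow> 'c \<Rightarrow> 'p \<Rightarrow> 'e \<Rightarrow> ('c \<Rightarrow> 'e)" where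
  "coord_vec M c p e = (\<lambda>d. if d \<in> charts_at M p
     then frechet_derivative (transition M c d) (at (coords M c p)) e else 0)"

definition lincomb :: "'i set \<Rightarrow> ('i \<Rightarrow> real) \<Rightarrow> ('i \<Rightarrow> 'c \<Rightarrow> 'e::real_vector) \<Rightarrow> ('c \<Rightarrow> 'e)" where
  "lincomb I t V = (\<lambda>c. \<Sum>i\<in>I. t i *\<^sub>R V i c)"

text \<open>The derivative of a smooth function along a tangent vector \<open>w\<close> at \<open>p\<close>;
  it does not depend on the chart.\<close>

definition tderiv :: "('p, 'c, 'e::euclidean_space) mfd \<Rightarrow> 'p \<Rightarrow> ('c \<Rightarrow> 'e) \<Rightarrow> ('p \<Rightarrow> real) \<Rightarrow> real" where
  "tderiv M p w f = (let c = (SOME c. c \<in> charts_at M p)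
     in frechet_derivative (\<lambda>x. f (inv_coords M c x)) (at (coords M c p)) (w c))"

definition local_rep :: "('p, 'c, 'e) mfd \<Rightarrow> 'c \<Rightarrow> ('p \<Rightarrow> 'c \<Rightarrow> 'e) \<Rightarrow> 'e \<Rightarrow> 'e" where
  "local_rep M c X = (\<lambda>x. X (inv_coords M c x) c)"

definition vector_field_on ::
    "('p, 'c, 'e::euclidean_space) mfd \<Rightarrow> 'p set \<Rightarrow> ('p \<Rightarrow> 'c \<Rightarrow> 'e) \<Rightarrow> bool" where
  "vector_field_on M W X \<longleftrightarrow> (\<forall>p\<in>W. X p \<in> tspace M p) \<and>
     (\<forall>c\<in>charts M. smooth_on (local_rep M c X) (coords M c ` (W \<inter> chart_dom M c)))"

abbreviation vector_field :: "('p, 'c, 'e::euclidean_space) mfd \<Rightarrow> ('p \<Rightarrow> 'c \<Rightarrow> 'e) \<Rightarrow> bool" where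
  "vector_field M X \<equiv> vector_field_on M (points M) X"

definition lie_bracket ::
    "('p, 'c, 'e::euclidean_space) mfd \<Rightarrow> ('p \<Rightarrow> 'c \<Rightarrow> 'e) \<Rightarrow> ('p \<Rightarrow> 'c \<Rightarrow> 'e) \<Rightarrow> 'p \<Rightarrow> 'c \<Rightarrow> 'e" where
  "lie_bracket M X Y = (\<lambda>p c. if c \<in> charts_at M p
     then frechet_derivative (local_rep M c Y) (at (coords M c p)) (X p c)
        - frechet_derivative (local_rep M c X) (at (coords M c p)) (Y p c)
     else 0)"

text \<open>A frame on \<open>W\<close>, indexed by the finite set \<open>I\<close>, of the family \<open>E\<close> of subspaces of the
  tangent spaces.\<close>

definition frame_of :: "('p, 'c, 'e::euclidean_space) mfd \<Rightarrow> 'p set \<Rightarrow> nat set \<Rightarrow>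
    (nat \<Rightarrow> 'p \<Rightarrow> 'c \<Rightarrow> 'e) \<Rightarrow> ('p \<Rightarrow> ('c \<Rightarrow> 'e) set) \<Rightarrow> bool" where
  "frame_of M W I X E \<longleftrightarrow>
     (\<forall>\<alpha>\<in>I. vector_field_on M W (X \<alpha>)) \<and>
     (\<forall>p\<in>W. (\<forall>t. lincomb I t (\<lambda>\<alpha>. X \<alpha> p) = (\<lambda>_. 0) \<longrightarrow> (\<forall>\<alpha>\<in>I. t \<alpha> = 0)) \<and>
             E p = range (\<lambda>t. lincomb I t (\<lambda>\<alpha>. X \<alpha> p)))"

definition distribution ::
    "('p, 'c, 'e::euclidean_space) mfd \<Rightarrow> nat \<Rightarrow> ('p \<Rightarrow> ('c \<Rightarrow> 'e) set) \<Rightarrow> bool" where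
  "distribution M m D \<longleftrightarrow> (\<forall>p\<in>points M. \<exists>W Y. openin (mfd_topology M) W \<and> p \<in> W \<and>
     frame_of M W {1..m} Y D)"

definition sections ::
    "('p, 'c, 'e::euclidean_space) mfd \<Rightarrow> ('p \<Rightarrow> ('c \<Rightarrow> 'e) set) \<Rightarrow> ('p \<Rightarrow> 'c \<Rightarrow> 'e) set" where
  "sections M D = {X. vector_field M X \<and> (\<forall>p\<in>points M. X p \<in> D p)}"

section \<open>Closed submanifolds\<close>

text \<open>For a closed embedded submanifold \<open>S\<close> of \<open>M\<close>, the smooth functions on \<open>S\<close> are the
  restrictions of those on \<open>M\<close>, the tangent vectors of \<open>S\<close> are those annihilating the functions
  vanishing on \<open>S\<close>, and the derivative of a function on \<open>S\<close> along a vector tangent to \<open>S\<close> is that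
  of any extension.\<close>

definition smooth_fun_sub ::
    "('p, 'c, 'e::euclidean_space) mfd \<Rightarrow> 'p set \<Rightarrow> ('p \<Rightarrow> real) \<Rightarrow> bool" where
  "smooth_fun_sub M S f \<longleftrightarrow> (\<exists>F. smooth_fun M F \<and> (\<forall>p\<in>S. F p = f p))"

definition tspace_sub ::
    "('p, 'c, 'e::euclidean_space) mfd \<Rightarrow> 'p set \<Rightarrow> 'p \<Rightarrow> ('c \<Rightarrow> 'e) set" where
  "tspace_sub M S p = {w \<in> tspace M p.
     \<forall>F. smooth_fun M F \<and> (\<forall>s\<in>S. F s = 0) \<longrightarrow> tderiv M p w F = 0}"

definition vector_field_sub ::
    "('p, 'c, 'e::euclidean_space) mfd \<Rightarrow> 'p set \<Rightarrow> ('p \<Rightarrow> 'c \<Rightarrow> 'e) \<Rightarrow> bool" where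
  "vector_field_sub M S Z \<longleftrightarrow> (\<forall>p\<in>S. Z p \<in> tspace_sub M S p) \<and>
     (\<forall>F. smooth_fun M F \<longrightarrow> smooth_fun_sub M S (\<lambda>p. tderiv M p (Z p) F))"

definition tderiv_sub ::
    "('p, 'c, 'e::euclidean_space) mfd \<Rightarrow> 'p set \<Rightarrow> 'p \<Rightarrow> ('c \<Rightarrow> 'e) \<Rightarrow> ('p \<Rightarrow> real) \<Rightarrow> real" where
  "tderiv_sub M S p w f =
     (THE r. \<exists>F. smooth_fun M F \<and> (\<forall>s\<in>S. F s = f s) \<and> r = tderiv M p w F)"

section \<open>The tangent bundle\<close>

text \<open>The tangent bundle carries the charts \<open>(q, v) \<mapsto> (x, u)\<close> induced by the charts of the base,
  with the same index set.\<close>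

definition tangent_bundle ::
    "('q, 'c, 'e::euclidean_space) mfd \<Rightarrow> ('q \<times> ('c \<Rightarrow> 'e), 'c, 'e \<times> 'e) mfd" where
  "tangent_bundle Q = \<lparr>
     points = {(q, v). q \<in> points Q \<and> v \<in> tspace Q q},
     charts = charts Q,
     chart_dom = (\<lambda>c. {(q, v). q \<in> chart_dom Q c \<and> v \<in> tspace Q q}),
     coords = (\<lambda>c (q, v). (coords Q c q, v c))\<rparr>"

text \<open>In induced coordinates, with \<open>X = X\<^sup>i \<partial>/\<partial>x\<^sup>i\<close>: the vertical lift is \<open>X\<^sup>i \<partial>/\<partial>u\<^sup>i\<close> and the complete
  lift is \<open>X\<^sup>i \<partial>/\<partial>x\<^sup>i + u\<^sup>j (\<partial>X\<^sup>i/\<partial>x\<^sup>j) \<partial>/\<partial>u\<^sup>i\<close>.\<close>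

definition vertical_lift :: "('q, 'c, 'e::euclidean_space) mfd \<Rightarrow> ('q \<Rightarrow> 'c \<Rightarrow> 'e) \<Rightarrow>
    'q \<times> ('c \<Rightarrow> 'e) \<Rightarrow> 'c \<Rightarrow> 'e \<times> 'e" where
  "vertical_lift Q X = (\<lambda>(q, v) c. if c \<in> charts_at Q q then (0, X q c) else 0)"

definition complete_lift :: "('q, 'c, 'e::euclidean_space) mfd \<Rightarrow> ('q \<Rightarrow> 'c \<Rightarrow> 'e) \<Rightarrow>
    'q \<times> ('c \<Rightarrow> 'e) \<Rightarrow> 'c \<Rightarrow> 'e \<times> 'e" where
  "complete_lift Q X = (\<lambda>(q, v) c. if c \<in> charts_at Q q
     then (X q c, frechet_derivative (local_rep Q c X) (at (coords Q c q)) (v c)) else 0)"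

section \<open>Tensor fields of type (0,2) and metrics\<close>

type_synonym ('q, 'c, 'e) tensor2 = "'q \<Rightarrow> ('c \<Rightarrow> 'e) \<Rightarrow> ('c \<Rightarrow> 'e) \<Rightarrow> real"

definition local_tensor :: "('q, 'c, 'e::euclidean_space) mfd \<Rightarrow> 'c \<Rightarrow> ('q, 'c, 'e) tensor2 \<Rightarrow>
    'e \<Rightarrow> 'e \<Rightarrow> 'e \<Rightarrow> real" where
  "local_tensor Q c g x a b = g (inv_coords Q c x)
     (coord_vec Q c (inv_coords Q c x) a) (coord_vec Q c (inv_coords Q c x) b)"

definition symmetric_tensor_field ::
    "('q, 'c, 'e::euclidean_space) mfd \<Rightarrow> ('q, 'c, 'e) tensor2 \<Rightarrow> bool" where
  "symmetric_tensor_field Q g \<longleftrightarrow>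
     (\<forall>q\<in>points Q. \<forall>u\<in>tspace Q q. \<forall>v\<in>tspace Q q. \<forall>w\<in>tspace Q q. \<forall>r s.
        g q (\<lambda>c. r *\<^sub>R u c + s *\<^sub>R v c) w = r * g q u w + s * g q v w \<and>
        g q u v = g q v u) \<and>
     (\<forall>c\<in>charts Q. \<forall>a\<in>Basis. \<forall>b\<in>Basis.
        smooth_on (\<lambda>x. local_tensor Q c g x a b) (coords Q c ` chart_dom Q c))"

definition riemannian_metric ::
    "('q, 'c, 'e::euclidean_space) mfd \<Rightarrow> ('q, 'c, 'e) tensor2 \<Rightarrow> bool" where
  "riemannian_metric Q g \<longleftrightarrow> symmetric_tensor_field Q g \<and>
     (\<forall>q\<in>points Q. \<forall>v\<in>tspace Q q. v \<noteq> (\<lambda>_. 0) \<longrightarrow> g q v v > 0)"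

definition orthogonal_distribution :: "('q, 'c, 'e::euclidean_space) mfd \<Rightarrow>
    ('q, 'c, 'e) tensor2 \<Rightarrow> ('q \<Rightarrow> ('c \<Rightarrow> 'e) set) \<Rightarrow> 'q \<Rightarrow> ('c \<Rightarrow> 'e) set" where
  "orthogonal_distribution Q g D = (\<lambda>q. {w \<in> tspace Q q. \<forall>v\<in>D q. g q v w = 0})"

definition kinetic_lagrangian :: "('q, 'c, 'e) tensor2 \<Rightarrow> 'q \<times> ('c \<Rightarrow> 'e) \<Rightarrow> real" where
  "kinetic_lagrangian g = (\<lambda>(q, v). g q v v / 2)"

text \<open>\<open>christoffel Q c g x a b\<close> is the vector \<open>\<Gamma>\<^sup>i\<^sub>j\<^sub>k a\<^sup>j b\<^sup>k\<close> formed with the Christoffel symbols of the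
  second kind of \<open>g\<close> in the chart \<open>c\<close>.\<close>

definition christoffel :: "('q, 'c, 'e::euclidean_space) mfd \<Rightarrow> 'c \<Rightarrow> ('q, 'c, 'e) tensor2 \<Rightarrow>
    'e \<Rightarrow> 'e \<Rightarrow> 'e \<Rightarrow> 'e" where
  "christoffel Q c g x a b = (THE z. \<forall>w. local_tensor Q c g x z w =
     (frechet_derivative (\<lambda>y. local_tensor Q c g y b w) (at x) a
    + frechet_derivative (\<lambda>y. local_tensor Q c g y a w) (at x) b
    - frechet_derivative (\<lambda>y. local_tensor Q c g y a b) (at x) w) / 2)"

definition geodesic_spray :: "('q, 'c, 'e::euclidean_space) mfd \<Rightarrow> ('q, 'c, 'e) tensor2 \<Rightarrow>
    'q \<times> ('c \<Rightarrow> 'e) \<Rightarrow> 'c \<Rightarrow> 'e \<times> 'e" where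
  "geodesic_spray Q g = (\<lambda>(q, v) c. if c \<in> charts_at Q q
     then (v c, - christoffel Q c g (coords Q c q) (v c) (v c)) else 0)"

section \<open>Adapted frames and quasi-velocities\<close>

text \<open>With \<open>n = DIM('e)\<close>, the fields \<open>X\<^sub>a\<close> are indexed by \<open>{1..m}\<close> and the fields \<open>X\<^sub>i\<close> by
  \<open>{m+1..n}\<close>.\<close>

definition adapted_frame :: "('q, 'c, 'e::euclidean_space) mfd \<Rightarrow> ('q, 'c, 'e) tensor2 \<Rightarrow>
    nat \<Rightarrow> ('q \<Rightarrow> ('c \<Rightarrow> 'e) set) \<Rightarrow> (nat \<Rightarrow> 'q \<Rightarrow> 'c \<Rightarrow> 'e) \<Rightarrow> bool" where
  "adapted_frame Q g m D X \<longleftrightarrow> m \<le> DIM('e) \<and>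
     frame_of Q (points Q) {1..DIM('e)} X (tspace Q) \<and>
     frame_of Q (points Q) {1..m} X D \<and>
     frame_of Q (points Q) {m+1..DIM('e)} X (orthogonal_distribution Q g D)"

definition frame_coeff ::
    "(nat \<Rightarrow> 'q \<Rightarrow> 'c \<Rightarrow> 'e::euclidean_space) \<Rightarrow> 'q \<Rightarrow> ('c \<Rightarrow> 'e) \<Rightarrow> nat \<Rightarrow> real" where
  "frame_coeff X q v = (THE t. (\<forall>\<alpha>. \<alpha> \<notin> {1..DIM('e)} \<longrightarrow> t \<alpha> = 0) \<and>
     v = lincomb {1..DIM('e)} t (\<lambda>\<alpha>. X \<alpha> q))"

definition quasi_velocity ::
    "(nat \<Rightarrow> 'q \<Rightarrow> 'c \<Rightarrow> 'e::euclidean_space) \<Rightarrow> nat \<Rightarrow> 'q \<times> ('c \<Rightarrow> 'e) \<Rightarrow> real" where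
  "quasi_velocity X \<alpha> = (\<lambda>(q, v). frame_coeff X q v \<alpha>)"

text \<open>\<open>structure_fun Q X \<alpha> \<beta> \<gamma>\<close> is \<open>R\<^sup>\<gamma>\<^sub>\<alpha>\<^sub>\<beta>\<close>, with the upper index last.\<close>

definition structure_fun :: "('q, 'c, 'e::euclidean_space) mfd \<Rightarrow> (nat \<Rightarrow> 'q \<Rightarrow> 'c \<Rightarrow> 'e) \<Rightarrow>
    nat \<Rightarrow> nat \<Rightarrow> nat \<Rightarrow> 'q \<Rightarrow> real" where
  "structure_fun Q X \<alpha> \<beta> \<gamma> q = frame_coeff X q (lie_bracket Q (X \<alpha>) (X \<beta>) q) \<gamma>"

definition constraint_mfd :: "('q, 'c, 'e::euclidean_space) mfd \<Rightarrow> nat \<Rightarrow>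
    (nat \<Rightarrow> 'q \<Rightarrow> 'c \<Rightarrow> 'e) \<Rightarrow> ('q \<times> ('c \<Rightarrow> 'e)) set" where
  "constraint_mfd Q m X = {p \<in> points (tangent_bundle Q).
     \<forall>i\<in>{m+1..DIM('e)}. quasi_velocity X i p = 0}"

section \<open>The nonholonomic vector field and geodesic extensions\<close>

text \<open>The expression \<open>Z(X\<^sup>V(L)) - X\<^sup>C(L)\<close> at \<open>p\<close>.\<close>

definition lagrange_defect :: "('q, 'c, 'e::euclidean_space) mfd \<Rightarrow>
    ('q \<times> ('c \<Rightarrow> 'e) \<Rightarrow> real) \<Rightarrow> ('q \<times> ('c \<Rightarrow> 'e) \<Rightarrow> 'c \<Rightarrow> 'e \<times> 'e) \<Rightarrow>
    ('q \<Rightarrow> 'c \<Rightarrow> 'e) \<Rightarrow> 'q \<times> ('c \<Rightarrow> 'e) \<Rightarrow> real" where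
  "lagrange_defect Q L Z X p =
     tderiv (tangent_bundle Q) p (Z p)
       (\<lambda>s. tderiv (tangent_bundle Q) s (vertical_lift Q X s) L)
     - tderiv (tangent_bundle Q) p (complete_lift Q X p) L"

definition nonholonomic_field :: "('q, 'c, 'e::euclidean_space) mfd \<Rightarrow>
    ('q \<times> ('c \<Rightarrow> 'e) \<Rightarrow> real) \<Rightarrow> nat \<Rightarrow> ('q \<Rightarrow> ('c \<Rightarrow> 'e) set) \<Rightarrow> (nat \<Rightarrow> 'q \<Rightarrow> 'c \<Rightarrow> 'e) \<Rightarrow>
    'q \<times> ('c \<Rightarrow> 'e) \<Rightarrow> 'c \<Rightarrow> 'e \<times> 'e" where
  "nonholonomic_field Q L m D X = (THE Z.
     (\<forall>p. p \<notin> constraint_mfd Q m X \<longrightarrow> Z p = (\<lambda>_. 0)) \<and>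
     vector_field_sub (tangent_bundle Q) (constraint_mfd Q m X) Z \<and>
     (\<exists>f. (\<forall>a\<in>{1..m}. smooth_fun_sub (tangent_bundle Q) (constraint_mfd Q m X) (f a)) \<and>
        (\<forall>p\<in>constraint_mfd Q m X. Z p = (\<lambda>c.
           (\<Sum>a=1..m. quasi_velocity X a p *\<^sub>R complete_lift Q (X a) p c
                    + f a p *\<^sub>R vertical_lift Q (X a) p c)))) \<and>
     (\<forall>Y\<in>sections Q D. \<forall>p\<in>constraint_mfd Q m X. lagrange_defect Q L Z Y p = 0))"

definition multiplier :: "('q, 'c, 'e::euclidean_space) mfd \<Rightarrow>
    ('q \<times> ('c \<Rightarrow> 'e) \<Rightarrow> real) \<Rightarrow> nat \<Rightarrow> ('q \<Rightarrow> ('c \<Rightarrow> 'e) set) \<Rightarrow> (nat \<Rightarrow> 'q \<Rightarrow> 'c \<Rightarrow> 'e) \<Rightarrow>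
    nat \<Rightarrow> 'q \<times> ('c \<Rightarrow> 'e) \<Rightarrow> real" where
  "multiplier Q L m D X i p = lagrange_defect Q L (nonholonomic_field Q L m D X) (X i) p"

definition preserving_modification :: "('q, 'c, 'e::euclidean_space) mfd \<Rightarrow>
    ('q \<Rightarrow> ('c \<Rightarrow> 'e) set) \<Rightarrow> ('q, 'c, 'e) tensor2 \<Rightarrow> ('q, 'c, 'e) tensor2 \<Rightarrow> bool" where
  "preserving_modification Q D g gh \<longleftrightarrow> symmetric_tensor_field Q gh \<and>
     (\<forall>q\<in>points Q. \<forall>v\<in>D q. \<forall>w\<in>D q. gh q v w = g q v w)"

definition geodesic_extension :: "('q, 'c, 'e::euclidean_space) mfd \<Rightarrow>
    ('q \<times> ('c \<Rightarrow> 'e) \<Rightarrow> real) \<Rightarrow> nat \<Rightarrow> ('q \<Rightarrow> ('c \<Rightarrow> 'e) set) \<Rightarrow> (nat \<Rightarrow> 'q \<Rightarrow> 'c \<Rightarrow> 'e) \<Rightarrow>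
    ('q, 'c, 'e) tensor2 \<Rightarrow> bool" where
  "geodesic_extension Q L m D X gh \<longleftrightarrow> riemannian_metric Q gh \<and>
     (\<forall>p\<in>constraint_mfd Q m X. geodesic_spray Q gh p = nonholonomic_field Q L m D X p)"

section \<open>The algebraic and the PDE conditions\<close>

definition theta :: "nat \<Rightarrow> (nat \<Rightarrow> 'q \<Rightarrow> 'c \<Rightarrow> 'e::euclidean_space) \<Rightarrow> ('q, 'c, 'e) tensor2 \<Rightarrow>
    nat \<Rightarrow> 'q \<times> ('c \<Rightarrow> 'e) \<Rightarrow> real" where
  "theta m X gh i p = (\<Sum>a=1..m. gh (fst p) (X a (fst p)) (X i (fst p)) * quasi_velocity X a p)"

definition algebraic_conditions :: "('q, 'c, 'e::euclidean_space) mfd \<Rightarrow> nat \<Rightarrow>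
    (nat \<Rightarrow> 'q \<Rightarrow> 'c \<Rightarrow> 'e) \<Rightarrow> ('q, 'c, 'e) tensor2 \<Rightarrow> bool" where
  "algebraic_conditions Q m X gh \<longleftrightarrow>
     (\<forall>p\<in>constraint_mfd Q m X. \<forall>c\<in>{1..m}.
        (\<Sum>k=m+1..DIM('e). \<Sum>a=1..m.
           theta m X gh k p * structure_fun Q X a c k (fst p) * quasi_velocity X a p) = 0)"

definition pde_conditions :: "('q, 'c, 'e::euclidean_space) mfd \<Rightarrow>
    ('q \<times> ('c \<Rightarrow> 'e) \<Rightarrow> real) \<Rightarrow> nat \<Rightarrow> ('q \<Rightarrow> ('c \<Rightarrow> 'e) set) \<Rightarrow> (nat \<Rightarrow> 'q \<Rightarrow> 'c \<Rightarrow> 'e) \<Rightarrow>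
    ('q, 'c, 'e) tensor2 \<Rightarrow> bool" where
  "pde_conditions Q L m D X gh \<longleftrightarrow>
     (\<forall>p\<in>constraint_mfd Q m X. \<forall>i\<in>{m+1..DIM('e)}.
        tderiv_sub (tangent_bundle Q) (constraint_mfd Q m X) p
          (nonholonomic_field Q L m D X p) (theta m X gh i)
        + (\<Sum>k=m+1..DIM('e). \<Sum>a=1..m.
             theta m X gh k p * structure_fun Q X i a k (fst p) * quasi_velocity X a p)
        + multiplier Q L m D X i p = 0)"

end

theory Submission
  imports Defs
begin

text \<open>
  For a symmetric tensor \<open>h\<close> let \<open>L\<^sub>h(v) = h(v, v)/2\<close> and let \<open>E\<^sub>h(Z, Y) = Z(Y\<^sup>V(L\<^sub>h)) - Y\<^sup>C(L\<^sub>h)\<close>,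
  where \<open>Y\<^sup>V(L\<^sub>h)\<close> is the momentum \<open>h(v, Y)\<close>. For a second-order field \<open>Z\<close> the value of \<open>E\<^sub>h(Z, Y)\<close>
  at a point depends only on the value of \<open>Y\<close> there, and linearly so; in a chart it is \<open>h\<close> applied to
  \<open>Y\<close> and the acceleration of \<open>Z\<close> plus the Christoffel term. Hence the nonholonomic field \<open>\<Gamma>\<close> is the
  restriction of the spray of a metric \<open>h\<close> if and only if \<open>E\<^sub>h(\<Gamma>, X\<^sub>\<alpha>) = 0\<close> on \<open>C\<close> for every member
  of the frame (\<open>geodesic_extension_iff\<close>).

  Let \<open>h\<close> agree with \<open>g\<close> on \<open>D\<close> and put \<open>t = h - g\<close>. At \<open>v = v\<^sup>a X\<^sub>a\<close> in \<open>C\<close> extend \<open>v\<close> to the field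
  \<open>U = v\<^sup>a X\<^sub>a\<close> with constant coefficients. Since \<open>t(U, U)\<close> vanishes identically, its derivative along
  \<open>X\<^sub>\<alpha>\<close> vanishes too, and this gives \<open>X\<^sub>\<alpha>\<^sup>C(L\<^sub>t) = - v\<^sup>a t(v, [X\<^sub>\<alpha>, X\<^sub>a]) = - \<theta>\<^sub>k R\<^sup>k\<^sub>\<alpha>\<^sub>a v\<^sup>a\<close>. On the other
  hand the momentum \<open>t(v, X\<^sub>\<alpha>)\<close> is \<open>0\<close> on \<open>C\<close> if \<open>X\<^sub>\<alpha>\<close> lies in \<open>D\<close>, and \<open>\<theta>\<^sub>i\<close> if \<open>\<alpha> = i\<close> is transverse.
  As \<open>\<Gamma>\<close> is tangent to \<open>C\<close>, only these restrictions matter. Therefore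
  \<open>E\<^sub>h(\<Gamma>, X\<^sub>c) = \<theta>\<^sub>k R\<^sup>k\<^sub>c\<^sub>a v\<^sup>a\<close> and \<open>E\<^sub>h(\<Gamma>, X\<^sub>i) = \<lambda>\<^sub>i + \<Gamma>(\<theta>\<^sub>i) + \<theta>\<^sub>k R\<^sup>k\<^sub>i\<^sub>a v\<^sup>a\<close>: as
  \<open>R\<^sup>k\<^sub>c\<^sub>a = - R\<^sup>k\<^sub>a\<^sub>c\<close>, the two groups of conditions say precisely that all these expressions vanish
  (\<open>conditions_iff\<close>). The first part of the
  theorem is the conjunction of the two equivalences.

  For the second part the tensor \<open>h\<close> need not be positive definite. But the conditions involve only
  the mixed components \<open>h(X\<^sub>a, X\<^sub>i)\<close>, and the components \<open>h(X\<^sub>i, X\<^sub>k)\<close> are free. Completing the square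
  yields a positive definite tensor with the same mixed components (\<open>riemannian_modification_exists\<close>),
  to which the two equivalences apply.

  Two ingredients are used throughout. Brackets and complete lifts are well defined tangent
  vectors because second derivatives of transition maps are symmetric
  (\<open>second_derivative_symmetric\<close>). Quasi-velocities, the coefficients of \<open>\<Gamma>\<close> and the
  vectors that complete the square are smooth because they solve linear systems with a smooth
  positive definite matrix
  (\<open>smooth_positive_system_solution\<close>).
\<close>

section \<open>Calculus of smooth maps\<close>

abbreviation fderiv :: "('a::real_normed_vector \<Rightarrow> 'b::real_normed_vector) \<Rightarrow> 'a \<Rightarrow> 'a \<Rightarrow> 'b" where
  "fderiv f x \<equiv> frechet_derivative f (at x)"

lemma fderiv_cong:
  assumes "open S" "x \<in> S" "\<And>y. y \<in> S \<Longrightarrow> f y = g y"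
  shows "fderiv f x = fderiv g x"
proof -
  have "(f has_derivative f') (at x) \<longleftrightarrow> (g has_derivative f') (at x)" for f'
    by (rule iffI; erule has_derivative_transform_within_open[OF _ assms(1,2)])
       (simp_all add: assms(3))
  then show ?thesis by (simp add: frechet_derivative_def)
qed

lemma has_fderiv: "f differentiable at x \<Longrightarrow> (f has_derivative fderiv f x) (at x)"
  by (simp add: frechet_derivative_works)

lemma fderiv_eqI: "(f has_derivative f') (at x) \<Longrightarrow> fderiv f x = f'"
  by (rule frechet_derivative_at[symmetric])

lemma differentiable_at_cong:
  assumes "open S" "x \<in> S" "\<And>y. y \<in> S \<Longrightarrow> f y = g y" "f differentiable at x"
  shows "g differentiable at x"
proof -
  obtain f' where "(f has_derivative f') (at x)" using assms(4) unfolding differentiable_def ..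
  then have "(g has_derivative f') (at x)"
    by (rule has_derivative_transform_within_open[OF _ assms(1-3)])
  then show ?thesis unfolding differentiable_def by blast
qed

lemma Ck_on_Suc_open:
  "open S \<Longrightarrow> Ck_on (Suc k) f S \<longleftrightarrow>
    (\<forall>x\<in>S. f differentiable at x) \<and> (\<forall>b\<in>Basis. Ck_on k (\<lambda>x. fderiv f x b) S)"
  unfolding Ck_on.simps(2) differentiable_on_def by (metis at_within_open)

lemma Ck_on_cong:
  assumes "open S" "\<And>x. x \<in> S \<Longrightarrow> f x = g x" "Ck_on k f S"
  shows "Ck_on k g S"
  using assms(2,3)
proof (induction k arbitrary: f g)
  case 0
  then show ?case by (simp cong: continuous_on_cong)
next
  case (Suc k)
  have f: "f differentiable at x" if "x \<in> S" for x
    using Suc.prems(2) that unfolding Ck_on_Suc_open[OF assms(1)] by blast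
  have "g differentiable at x" if "x \<in> S" for x
    by (rule differentiable_at_cong[OF assms(1) that Suc.prems(1) f[OF that]])
  moreover have "Ck_on k (\<lambda>x. fderiv g x b) S" if "b \<in> Basis" for b
  proof (rule Suc.IH)
    show "Ck_on k (\<lambda>x. fderiv f x b) S"
      using Suc.prems(2) that unfolding Ck_on_Suc_open[OF assms(1)] by blast
    show "fderiv f x b = fderiv g x b" if "x \<in> S" for x
      by (subst fderiv_cong[OF assms(1) that Suc.prems(1)]) simp_all
  qed
  ultimately show ?case unfolding Ck_on_Suc_open[OF assms(1)] by blast
qed

lemma Ck_on_SucD:
  assumes "open S" "Ck_on (Suc k) f S" shows "Ck_on k f S"
  using assms(2)
proof (induction k arbitrary: f)
  case 0
  then have "f differentiable_on S" by simp
  then show ?case using differentiable_imp_continuous_on by simp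
next
  case (Suc k)
  from Suc.prems have "f differentiable_on S" "\<forall>b\<in>Basis. Ck_on (Suc k) (\<lambda>x. fderiv f x b) S"
    unfolding Ck_on.simps(2)[of "Suc k"] by (rule conjunct1, rule conjunct2)
  then show ?case unfolding Ck_on.simps(2)[of k f] by (intro conjI ballI Suc.IH) (assumption, erule (1) bspec)
qed

text \<open>The induction step behind the closure properties of \<open>C\<^sup>k\<close> maps: every differentiation rule supplies
  a derivative whose partial derivatives are built from maps of class \<open>C\<^sup>k\<close>.\<close>

lemma Ck_on_SucI:
  assumes S: "open S" and d: "\<And>x. x \<in> S \<Longrightarrow> (f has_derivative f' x) (at x)"
    and c: "\<And>b. b \<in> Basis \<Longrightarrow> Ck_on k (\<lambda>x. f' x b) S"
  shows "Ck_on (Suc k) f S"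
  unfolding Ck_on_Suc_open[OF S]
proof (intro conjI ballI)
  show "f differentiable at x" if "x \<in> S" for x
    using d[OF that] unfolding differentiable_def by blast
  show "Ck_on k (\<lambda>x. fderiv f x b) S" if "b \<in> Basis" for b
    by (rule Ck_on_cong[OF S _ c[OF that]]) (simp add: fderiv_eqI[OF d])
qed

lemma Ck_on_Suc_has_derivative:
  "open S \<Longrightarrow> Ck_on (Suc k) f S \<Longrightarrow> x \<in> S \<Longrightarrow> (f has_derivative fderiv f x) (at x)"
  unfolding Ck_on_Suc_open by (blast intro: has_fderiv)

lemma Ck_on_Suc_partial: "Ck_on (Suc k) f S \<Longrightarrow> b \<in> Basis \<Longrightarrow> Ck_on k (\<lambda>x. fderiv f x b) S"
  unfolding Ck_on.simps(2) by blast

lemma Ck_on_const: "open S \<Longrightarrow> Ck_on k (\<lambda>x. c) S"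
proof (induction k arbitrary: c)
  case (Suc k)
  show ?case by (rule Ck_on_SucI[OF Suc.prems has_derivative_const Suc.IH[OF Suc.prems]])
qed simp

lemma Ck_on_add:
  assumes S: "open S" and "Ck_on k f S" "Ck_on k g S"
  shows "Ck_on k (\<lambda>x. f x + g x) S"
  using assms(2,3)
proof (induction k arbitrary: f g)
  case 0
  then show ?case by (simp add: continuous_on_add)
next
  case (Suc k)
  show ?case
    by (rule Ck_on_SucI[OF S has_derivative_add Suc.IH])
       (fact Ck_on_Suc_has_derivative[OF S Suc.prems(1)] Ck_on_Suc_has_derivative[OF S Suc.prems(2)]
          Ck_on_Suc_partial[OF Suc.prems(1)] Ck_on_Suc_partial[OF Suc.prems(2)])+
qed

lemma Ck_on_bilinear:
  assumes h: "bounded_bilinear h" and S: "open S" and "Ck_on k f S" "Ck_on k g S"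
  shows "Ck_on k (\<lambda>x. h (f x) (g x)) S"
  using assms(3,4)
proof (induction k arbitrary: f g)
  case 0
  then show ?case using bounded_bilinear.continuous_on[OF h] by simp
next
  case (Suc k)
  show ?case
  proof (rule Ck_on_SucI[OF S bounded_bilinear.FDERIV[OF h]])
    show "Ck_on k (\<lambda>x. h (f x) (fderiv g x b) + h (fderiv f x b) (g x)) S" if "b \<in> Basis" for b
      by (intro Ck_on_add[OF S] Suc.IH)
         (fact Ck_on_SucD[OF S Suc.prems(1)] Ck_on_SucD[OF S Suc.prems(2)]
            Ck_on_Suc_partial[OF Suc.prems(1) that] Ck_on_Suc_partial[OF Suc.prems(2) that])+
  qed (fact Ck_on_Suc_has_derivative[OF S Suc.prems(1)] Ck_on_Suc_has_derivative[OF S Suc.prems(2)])+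
qed

lemma Ck_on_sum:
  assumes "open S" "\<And>i. i \<in> I \<Longrightarrow> Ck_on k (f i) S"
  shows "Ck_on k (\<lambda>x. \<Sum>i\<in>I. f i x) S"
  using assms(2)
  by (induction I rule: infinite_finite_induct) (auto intro!: Ck_on_add Ck_on_const assms(1))

lemma Ck_on_linear_comp:
  assumes h: "bounded_linear h" and S: "open S" and "Ck_on k f S"
  shows "Ck_on k (\<lambda>x. h (f x)) S"
  using assms(3)
proof (induction k arbitrary: f)
  case 0
  then show ?case using bounded_linear.continuous_on[OF h] by simp
next
  case (Suc k)
  show ?case
    by (rule Ck_on_SucI[OF S bounded_linear.has_derivative[OF h] Suc.IH])
       (fact Ck_on_Suc_has_derivative[OF S Suc.prems] Ck_on_Suc_partial[OF Suc.prems])+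
qed

lemma Ck_on_bounded_linear:
  assumes h: "bounded_linear h" and S: "open S"
  shows "Ck_on k h S"
proof (cases k)
  case 0
  then show ?thesis using h by (simp add: linear_continuous_on)
next
  case (Suc j)
  show ?thesis unfolding Suc
    by (rule Ck_on_SucI[OF S bounded_linear_imp_has_derivative[OF h] Ck_on_const[OF S]])
qed

lemma fderiv_basis_expansion:
  assumes "f differentiable at x"
  shows "fderiv f x (a::'a::euclidean_space) = (\<Sum>i\<in>Basis. (a \<bullet> i) *\<^sub>R fderiv f x i)"
proof -
  have l: "linear (fderiv f x)" by (rule linear_frechet_derivative[OF assms])
  have "fderiv f x a = fderiv f x (\<Sum>i\<in>Basis. (a \<bullet> i) *\<^sub>R i)" by (simp add: euclidean_representation)
  also have "\<dots> = (\<Sum>i\<in>Basis. (a \<bullet> i) *\<^sub>R fderiv f x i)"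
    by (simp add: linear_sum[OF l] linear_cmul[OF l])
  finally show ?thesis .
qed

text \<open>The derivative of \<open>f \<circ> A\<close> along \<open>b\<close> is that of \<open>f\<close> along the fixed vector \<open>A' b\<close>, so the induction
  stays among the partial derivatives of \<open>f\<close>. The maps \<open>A\<close> that occur are the identity, the
  projection of a trivial bundle and its constant sections.\<close>

lemma Ck_on_compose_affine:
  fixes A :: "'a::euclidean_space \<Rightarrow> 'b::euclidean_space"
  assumes A: "\<And>x. (A has_derivative A') (at x)" and S: "open S" and T: "open T" and sub: "A ` T \<subseteq> S"
    and "Ck_on k f S"
  shows "Ck_on k (\<lambda>x. f (A x)) T"
  using assms(5)
proof (induction k arbitrary: f)
  case 0
  have "continuous_on T A"
    by (rule has_derivative_continuous_on) (rule has_derivative_at_withinI[OF A])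
  then show ?case using 0 sub by (auto intro: continuous_on_compose2)
next
  case (Suc k)
  have AS: "A x \<in> S" if "x \<in> T" for x using that sub by blast
  show ?case
  proof (rule Ck_on_SucI[OF T])
    fix x assume x: "x \<in> T"
    have d: "(f has_derivative fderiv f (A x)) (at (A x))"
      by (rule Ck_on_Suc_has_derivative[OF S Suc.prems AS[OF x]])
    have "(\<lambda>b. fderiv f (A x) (A' b)) = (\<lambda>b. \<Sum>i\<in>Basis. (A' b \<bullet> i) *\<^sub>R fderiv f (A x) i)"
      using fderiv_basis_expansion d unfolding differentiable_def by blast
    then show "((\<lambda>x. f (A x)) has_derivative (\<lambda>b. \<Sum>i\<in>Basis. (A' b \<bullet> i) *\<^sub>R fderiv f (A x) i)) (at x)"
      by (rule has_derivative_eq_rhs[OF has_derivative_compose[OF A d]])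
  next
    show "Ck_on k (\<lambda>x. \<Sum>i\<in>Basis. (A' b \<bullet> i) *\<^sub>R fderiv f (A x) i) T" for b
      by (intro Ck_on_sum T Ck_on_linear_comp[OF bounded_linear_scaleR_right] Suc.IH
            Ck_on_Suc_partial[OF Suc.prems])
  qed
qed

lemma Ck_on_inverse:
  fixes f :: "'a::euclidean_space \<Rightarrow> real"
  assumes S: "open S" and nz: "\<And>x. x \<in> S \<Longrightarrow> f x \<noteq> 0" and "Ck_on k f S"
  shows "Ck_on k (\<lambda>x. inverse (f x)) S"
  using assms(3)
proof (induction k)
  case 0
  then show ?case using nz by (simp add: continuous_on_inverse)
next
  case (Suc k)
  note i = Suc.IH[OF Ck_on_SucD[OF S Suc.prems]]
  show ?case
  proof (rule Ck_on_SucI[OF S Deriv.has_derivative_inverse[OF nz Ck_on_Suc_has_derivative[OF S Suc.prems]]])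
    show "Ck_on k (\<lambda>x. - (inverse (f x) * fderiv f x b * inverse (f x))) S" if "b \<in> Basis" for b
      by (intro Ck_on_linear_comp[OF bounded_linear_minus[OF bounded_linear_ident]]
            Ck_on_bilinear[OF bounded_bilinear_mult] S i Ck_on_Suc_partial[OF Suc.prems that])
  qed
qed

lemma smooth_on_cong:
  assumes "open S" "\<And>x. x \<in> S \<Longrightarrow> f x = g x" "smooth_on f S" shows "smooth_on g S"
  using assms Ck_on_cong unfolding smooth_on_def by blast

lemma smooth_on_const: "open S \<Longrightarrow> smooth_on (\<lambda>x. c) S"
  by (simp add: smooth_on_def Ck_on_const)

lemma smooth_on_add: "open S \<Longrightarrow> smooth_on f S \<Longrightarrow> smooth_on g S \<Longrightarrow> smooth_on (\<lambda>x. f x + g x) S"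
  by (simp add: smooth_on_def Ck_on_add)

lemma smooth_on_bilinear:
  "bounded_bilinear h \<Longrightarrow> open S \<Longrightarrow> smooth_on f S \<Longrightarrow> smooth_on g S \<Longrightarrow> smooth_on (\<lambda>x. h (f x) (g x)) S"
  by (simp add: smooth_on_def Ck_on_bilinear)

lemmas smooth_on_mult = smooth_on_bilinear[OF bounded_bilinear_mult]
lemmas smooth_on_scaleR = smooth_on_bilinear[OF bounded_bilinear_scaleR]
lemmas smooth_on_inner = smooth_on_bilinear[OF bounded_bilinear_inner]

lemma smooth_on_sum:
  "open S \<Longrightarrow> (\<And>i. i \<in> I \<Longrightarrow> smooth_on (f i) S) \<Longrightarrow> smooth_on (\<lambda>x. \<Sum>i\<in>I. f i x) S"
  by (simp add: smooth_on_def Ck_on_sum)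

lemma smooth_on_linear_comp:
  "bounded_linear h \<Longrightarrow> open S \<Longrightarrow> smooth_on f S \<Longrightarrow> smooth_on (\<lambda>x. h (f x)) S"
  by (simp add: smooth_on_def Ck_on_linear_comp)

lemma smooth_on_bounded_linear: "bounded_linear h \<Longrightarrow> open S \<Longrightarrow> smooth_on h S"
  by (simp add: smooth_on_def Ck_on_bounded_linear)

lemma smooth_on_compose_affine:
  fixes A :: "'a::euclidean_space \<Rightarrow> 'b::euclidean_space"
  assumes "\<And>x. (A has_derivative A') (at x)" "open S" "open T" "A ` T \<subseteq> S" "smooth_on f S"
  shows "smooth_on (\<lambda>x. f (A x)) T"
  using assms(5) unfolding smooth_on_def by (blast intro: Ck_on_compose_affine[OF assms(1-4)])

lemma smooth_on_compose_linear:
  fixes A :: "'a::euclidean_space \<Rightarrow> 'b::euclidean_space"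
  assumes "bounded_linear A" "open S" "open T" "A ` T \<subseteq> S" "smooth_on f S"
  shows "smooth_on (\<lambda>x. f (A x)) T"
  using smooth_on_compose_affine[OF bounded_linear_imp_has_derivative[OF assms(1)] assms(2-5)] .

lemma smooth_on_inverse:
  fixes f :: "'a::euclidean_space \<Rightarrow> real"
  shows "open S \<Longrightarrow> (\<And>x. x \<in> S \<Longrightarrow> f x \<noteq> 0) \<Longrightarrow> smooth_on f S \<Longrightarrow> smooth_on (\<lambda>x. inverse (f x)) S"
  by (simp add: smooth_on_def Ck_on_inverse)

lemma smooth_on_Pair:
  assumes S: "open S" "smooth_on f S" "smooth_on g S"
  shows "smooth_on (\<lambda>x. (f x, g x)) S"
proof -
  have "smooth_on (\<lambda>x. (f x, 0) + (0, g x)) S"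
    by (intro smooth_on_add S smooth_on_linear_comp[of "\<lambda>x. (x, 0)"] smooth_on_linear_comp[of "\<lambda>x. (0, x)"]
        bounded_linear_Pair bounded_linear_ident bounded_linear_zero)
  then show ?thesis by simp
qed

lemma smooth_on_differentiable: "smooth_on f S \<Longrightarrow> open S \<Longrightarrow> x \<in> S \<Longrightarrow> f differentiable at x"
  unfolding smooth_on_def using Ck_on_Suc_open by blast

lemma smooth_on_fderiv_Basis:
  assumes "smooth_on f S" "b \<in> Basis" shows "smooth_on (\<lambda>x. fderiv f x b) S"
  using assms unfolding smooth_on_def by (metis Ck_on.simps(2))

lemma smooth_on_fderiv_field:
  assumes "open S" "smooth_on f S" "smooth_on Y S"
  shows "smooth_on (\<lambda>x. fderiv f x (Y x)) S"
proof (rule smooth_on_cong[OF assms(1)])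
  show "smooth_on (\<lambda>x. \<Sum>i\<in>Basis. (Y x \<bullet> i) *\<^sub>R fderiv f x i) S"
    by (intro smooth_on_sum assms smooth_on_scaleR smooth_on_inner smooth_on_const smooth_on_fderiv_Basis)
qed (metis assms(1,2) smooth_on_differentiable fderiv_basis_expansion)

lemma smooth_on_fderiv: "open S \<Longrightarrow> smooth_on f S \<Longrightarrow> smooth_on (\<lambda>x. fderiv f x a) S"
  by (intro smooth_on_fderiv_field smooth_on_const)

lemma smooth_on_continuous: "smooth_on f S \<Longrightarrow> continuous_on S f"
  unfolding smooth_on_def by (metis Ck_on.simps(1))

text \<open>The mean value theorem is applied twice: first along \<open>a\<close> to the difference of \<open>f\<close> across the
  displacement \<open>s b\<close>, then along \<open>b\<close> to the derivative of \<open>f\<close> along \<open>a\<close>.\<close>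

lemma second_difference_mean_value:
  fixes f :: "'a::euclidean_space \<Rightarrow> real"
  assumes S: "open S" and f: "smooth_on f S" and "0 < s"
    and sub: "\<And>p q. p \<in> {0..s} \<Longrightarrow> q \<in> {0..s} \<Longrightarrow> x + p *\<^sub>R a + q *\<^sub>R b \<in> S"
  obtains p q where "p \<in> {0..s}" "q \<in> {0..s}"
    "f (x + s *\<^sub>R a + s *\<^sub>R b) - f (x + s *\<^sub>R a) - f (x + s *\<^sub>R b) + f x
      = s * s * fderiv (\<lambda>y. fderiv f y a) (x + p *\<^sub>R a + q *\<^sub>R b) b"
proof -
  define \<phi> where "\<phi> = (\<lambda>p. f (x + p *\<^sub>R a + s *\<^sub>R b) - f (x + p *\<^sub>R a + 0 *\<^sub>R b))"
  have fd: "f differentiable at y" if "y \<in> S" for y using smooth_on_differentiable[OF f S that] .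
  have d1: "((\<lambda>p. f (x + p *\<^sub>R a + q *\<^sub>R b)) has_derivative (\<lambda>h. fderiv f (x + p *\<^sub>R a + q *\<^sub>R b) (h *\<^sub>R a))) (at p)"
    if "p \<in> {0..s}" "q \<in> {0..s}" for p q
    by (rule has_derivative_compose[where f = "\<lambda>p. x + p *\<^sub>R a + q *\<^sub>R b" and g = f,
          OF _ has_fderiv[OF fd[OF sub[OF that]]]])
       (auto intro!: derivative_eq_intros)
  have \<phi>': "(\<phi> has_derivative (\<lambda>h. fderiv f (x + p *\<^sub>R a + s *\<^sub>R b) (h *\<^sub>R a) - fderiv f (x + p *\<^sub>R a + 0 *\<^sub>R b) (h *\<^sub>R a)))
     (at p)" if "p \<in> {0..s}" for p
    unfolding \<phi>_def using \<open>0 < s\<close> by (intro has_derivative_diff d1[OF that]) simp_all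
  have "\<exists>p\<in>{0<..<s}. \<phi> s - \<phi> 0 = fderiv f (x + p *\<^sub>R a + s *\<^sub>R b) ((s - 0) *\<^sub>R a) - fderiv f (x + p *\<^sub>R a + 0 *\<^sub>R b) ((s - 0) *\<^sub>R a)"
  proof (rule mvt_simple[OF \<open>0 < s\<close>, where f = \<phi> and f' = "\<lambda>p h. fderiv f (x + p *\<^sub>R a + s *\<^sub>R b) (h *\<^sub>R a) - fderiv f (x + p *\<^sub>R a + 0 *\<^sub>R b) (h *\<^sub>R a)"])
    fix r :: real assume "0 \<le> r" "r \<le> s"
    then have "r \<in> {0..s}" by simp
    from has_derivative_at_withinI[OF \<phi>'[OF this]]
    show "(\<phi> has_derivative (\<lambda>p h. fderiv f (x + p *\<^sub>R a + s *\<^sub>R b) (h *\<^sub>R a) - fderiv f (x + p *\<^sub>R a + 0 *\<^sub>R b) (h *\<^sub>R a)) r) (at r within {0..s})" .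
  qed
  then obtain p where p: "p \<in> {0..s}"
    and e: "\<phi> s - \<phi> 0 = fderiv f (x + p *\<^sub>R a + s *\<^sub>R b) (s *\<^sub>R a) - fderiv f (x + p *\<^sub>R a + 0 *\<^sub>R b) (s *\<^sub>R a)"
    by (metis (no_types, lifting) diff_zero greaterThanLessThan_iff atLeastAtMost_iff less_imp_le)
  have lin: "fderiv f y (s *\<^sub>R a) = s * fderiv f y a" if "y \<in> S" for y
    using linear_cmul[OF linear_frechet_derivative[OF fd[OF that]]] by simp
  define \<psi> where "\<psi> = (\<lambda>q. fderiv f (x + p *\<^sub>R a + q *\<^sub>R b) a)"
  have e2: "\<phi> s - \<phi> 0 = s * (\<psi> s - \<psi> 0)"
    unfolding e \<psi>_def using p \<open>0 < s\<close> by (simp add: lin sub[of p 0, simplified] sub right_diff_distrib)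
  have gd: "(\<lambda>y. fderiv f y a) differentiable at y" if "y \<in> S" for y
    using smooth_on_differentiable[OF smooth_on_fderiv[OF S f] S that] .
  have \<psi>': "(\<psi> has_derivative (\<lambda>h. fderiv (\<lambda>y. fderiv f y a) (x + p *\<^sub>R a + q *\<^sub>R b) (h *\<^sub>R b))) (at q)"
    if "q \<in> {0..s}" for q
    unfolding \<psi>_def
    by (rule has_derivative_compose[where f = "\<lambda>q. x + p *\<^sub>R a + q *\<^sub>R b"
          and g = "\<lambda>y. fderiv f y a", OF _ has_fderiv[OF gd[OF sub[OF p that]]]])
       (auto intro!: derivative_eq_intros)
  have "\<exists>q\<in>{0<..<s}. \<psi> s - \<psi> 0 = fderiv (\<lambda>y. fderiv f y a) (x + p *\<^sub>R a + q *\<^sub>R b) ((s - 0) *\<^sub>R b)"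
  proof (rule mvt_simple[OF \<open>0 < s\<close>, where f = \<psi> and f' = "\<lambda>q h. fderiv (\<lambda>y. fderiv f y a) (x + p *\<^sub>R a + q *\<^sub>R b) (h *\<^sub>R b)"])
    fix r :: real assume "0 \<le> r" "r \<le> s"
    then have "r \<in> {0..s}" by simp
    from has_derivative_at_withinI[OF \<psi>'[OF this]]
    show "(\<psi> has_derivative (\<lambda>q h. fderiv (\<lambda>y. fderiv f y a) (x + p *\<^sub>R a + q *\<^sub>R b) (h *\<^sub>R b)) r) (at r within {0..s})" .
  qed
  then obtain q where q: "q \<in> {0..s}"
    and e3: "\<psi> s - \<psi> 0 = fderiv (\<lambda>y. fderiv f y a) (x + p *\<^sub>R a + q *\<^sub>R b) (s *\<^sub>R b)"
    by (metis (no_types, lifting) diff_zero greaterThanLessThan_iff atLeastAtMost_iff less_imp_le)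
  have "\<psi> s - \<psi> 0 = s * fderiv (\<lambda>y. fderiv f y a) (x + p *\<^sub>R a + q *\<^sub>R b) b"
    unfolding e3 using linear_cmul[OF linear_frechet_derivative[OF gd[OF sub[OF p q]]]] by simp
  then have "\<phi> s - \<phi> 0 = s * s * fderiv (\<lambda>y. fderiv f y a) (x + p *\<^sub>R a + q *\<^sub>R b) b"
    using e2 by simp
  then show ?thesis using p q that unfolding \<phi>_def by (simp add: algebra_simps)
qed

text \<open>The second difference does not change when \<open>a\<close> and \<open>b\<close> are exchanged, so both iterated derivatives
  take a common value at points arbitrarily close to \<open>x\<close>; both are continuous.\<close>

lemma second_derivative_symmetric_real:
  fixes f :: "'a::euclidean_space \<Rightarrow> real"
  assumes S: "open S" and f: "smooth_on f S" and x: "x \<in> S"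
  shows "fderiv (\<lambda>y. fderiv f y a) x b = fderiv (\<lambda>y. fderiv f y b) x a"
proof -
  let ?A = "\<lambda>y. fderiv (\<lambda>y. fderiv f y a) y b" and ?B = "\<lambda>y. fderiv (\<lambda>y. fderiv f y b) y a"
  have le: "dist (?A x) (?B x) \<le> e" if "e > 0" for e
  proof -
    have "isCont ?A x" "isCont ?B x"
      using S x f smooth_on_continuous smooth_on_fderiv continuous_on_eq_continuous_at by metis+
    then obtain d1 d2 where d: "d1 > 0" "\<And>y. dist y x < d1 \<Longrightarrow> dist (?A y) (?A x) < e/2"
      "d2 > 0" "\<And>y. dist y x < d2 \<Longrightarrow> dist (?B y) (?B x) < e/2"
      using \<open>e > 0\<close> unfolding continuous_at_eps_delta by (metis half_gt_zero)
    obtain d3 where d3: "d3 > 0" "ball x d3 \<subseteq> S" using S x open_contains_ball by blast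
    define r where "r = min d1 (min d2 d3)"
    define s where "s = r / (2 * (norm a + norm b + 1))"
    \<comment> \<open>\<open>s\<close> is so small that the parallelogram spanned by \<open>s a\<close> and \<open>s b\<close> stays in the ball of radius \<open>r\<close>\<close>
    have r: "r > 0" using d d3 by (simp add: r_def)
    have pos: "norm a + norm b + 1 > 0" by (simp add: add_nonneg_pos)
    have s: "s > 0" using r pos by (simp add: s_def)
    have n: "dist (x + p *\<^sub>R a + q *\<^sub>R b) x < r" if "p \<in> {0..s}" "q \<in> {0..s}" for p q
    proof -
      have "dist (x + p *\<^sub>R a + q *\<^sub>R b) x = norm (p *\<^sub>R a + q *\<^sub>R b)" by (simp add: dist_norm)
      also have "\<dots> \<le> p * norm a + q * norm b" using that norm_triangle_ineq[of "p *\<^sub>R a" "q *\<^sub>R b"] by auto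
      also have "\<dots> \<le> s * norm a + s * norm b" using that by (intro add_mono mult_right_mono) auto
      also have "\<dots> < s * (norm a + norm b + 1) * 2" using s pos
        by (smt (verit, best) distrib_left mult_pos_pos mult.right_neutral norm_ge_zero zero_le_mult_iff)
      also have "\<dots> = r" using pos unfolding s_def by (simp only: times_divide_eq_left nonzero_divide_eq_eq) (simp add: field_simps)
      finally show ?thesis .
    qed
    have n': "dist (x + p *\<^sub>R b + q *\<^sub>R a) x < r" if "p \<in> {0..s}" "q \<in> {0..s}" for p q
      using n[OF that(2,1)] by (simp add: algebra_simps)
    have i: "x + p *\<^sub>R a + q *\<^sub>R b \<in> S" "x + p *\<^sub>R b + q *\<^sub>R a \<in> S"
      if "p \<in> {0..s}" "q \<in> {0..s}" for p q
      using n[OF that] n'[OF that] d3 by (auto simp: r_def dist_commute subset_iff)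
    obtain p q where pq: "p \<in> {0..s}" "q \<in> {0..s}"
      "f (x + s *\<^sub>R a + s *\<^sub>R b) - f (x + s *\<^sub>R a) - f (x + s *\<^sub>R b) + f x
      = s * s * ?A (x + p *\<^sub>R a + q *\<^sub>R b)"
      by (rule second_difference_mean_value[OF S f s i(1)]) auto
    obtain p' q' where pq': "p' \<in> {0..s}" "q' \<in> {0..s}"
      "f (x + s *\<^sub>R b + s *\<^sub>R a) - f (x + s *\<^sub>R b) - f (x + s *\<^sub>R a) + f x
      = s * s * ?B (x + p' *\<^sub>R b + q' *\<^sub>R a)"
      by (rule second_difference_mean_value[OF S f s i(2)]) auto
    have "s * s * ?A (x + p *\<^sub>R a + q *\<^sub>R b) = s * s * ?B (x + p' *\<^sub>R b + q' *\<^sub>R a)"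
      unfolding pq(3)[symmetric] pq'(3)[symmetric] by (simp add: algebra_simps)
    then have eq: "?A (x + p *\<^sub>R a + q *\<^sub>R b) = ?B (x + p' *\<^sub>R b + q' *\<^sub>R a)" using s by simp
    have "dist (?A (x + p *\<^sub>R a + q *\<^sub>R b)) (?A x) < e/2" "dist (?B (x + p' *\<^sub>R b + q' *\<^sub>R a)) (?B x) < e/2"
      using n[OF pq(1,2)] n'[OF pq'(1,2)] d by (auto simp: r_def)
    then show ?thesis using eq dist_triangle_half_r by (metis less_imp_le)
  qed
  have "dist (?A x) (?B x) \<le> 0"
    by (rule field_le_epsilon) (simp only: add_0 le)
  then show ?thesis by simp
qed

lemma second_derivative_symmetric:
  fixes f :: "'a::euclidean_space \<Rightarrow> 'b::euclidean_space"
  assumes S: "open S" and f: "smooth_on f S" and x: "x \<in> S"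
  shows "fderiv (\<lambda>y. fderiv f y a) x b = fderiv (\<lambda>y. fderiv f y b) x a"
proof (rule euclidean_eqI)
  fix i :: 'b
  have *: "fderiv (\<lambda>y. fderiv f y a) x b \<bullet> i = fderiv (\<lambda>y. fderiv (\<lambda>z. f z \<bullet> i) y a) x b" for a b
  proof -
    have "fderiv (\<lambda>z. f z \<bullet> i) y a = fderiv f y a \<bullet> i" if "y \<in> S" for y
      using fderiv_eqI[OF bounded_linear.has_derivative[OF bounded_linear_inner_left
            has_fderiv[OF smooth_on_differentiable[OF f S that]]]] by metis
    then have "fderiv (\<lambda>y. fderiv (\<lambda>z. f z \<bullet> i) y a) x = fderiv (\<lambda>y. fderiv f y a \<bullet> i) x"
      by (intro fderiv_cong[OF S x])
    also have "\<dots> = (\<lambda>b. fderiv (\<lambda>y. fderiv f y a) x b \<bullet> i)"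
      by (rule fderiv_eqI[OF bounded_linear.has_derivative[OF bounded_linear_inner_left
            has_fderiv[OF smooth_on_differentiable[OF smooth_on_fderiv[OF S f] S x]]]])
    finally show ?thesis by simp
  qed
  have "smooth_on (\<lambda>z. f z \<bullet> i) S" by (intro smooth_on_inner S f smooth_on_const)
  then show "fderiv (\<lambda>y. fderiv f y a) x b \<bullet> i = fderiv (\<lambda>y. fderiv f y b) x a \<bullet> i"
    unfolding * by (rule second_derivative_symmetric_real[OF S _ x])
qed

text \<open>Expanding \<open>u\<close> in the basis turns \<open>(x, u) \<mapsto> Df(x) u\<close> into a finite sum of products of coordinates
  with partial derivatives. This map is the fibre part of a transition map of the tangent bundle.\<close>

lemma has_derivative_fderiv_pair:
  fixes f :: "'a::euclidean_space \<Rightarrow> 'b::real_normed_vector"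
  assumes S: "open S" and f: "smooth_on f S" and x: "x \<in> S"
  shows "((\<lambda>z. fderiv f (fst z) (snd z)) has_derivative
    (\<lambda>a. fderiv (\<lambda>y. fderiv f y u) x (fst a) + fderiv f x (snd a))) (at (x, u))"
proof -
  let ?D = "\<lambda>i a. fderiv (\<lambda>y. fderiv f y i) x a"
  have e: "(\<Sum>i\<in>Basis. (w \<bullet> i) *\<^sub>R fderiv f y i) = fderiv f y w" if "y \<in> S" for y w
    by (rule fderiv_basis_expansion[OF smooth_on_differentiable[OF f S that], symmetric])
  have part: "((\<lambda>y. fderiv f y i) has_derivative ?D i) (at x)" for i
    by (rule has_fderiv[OF smooth_on_differentiable[OF smooth_on_fderiv[OF S f] S x]])
  have part': "((\<lambda>z. fderiv f (fst z) i) has_derivative (\<lambda>a. ?D i (fst a))) (at (x, u))" for i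
    by (rule has_derivative_compose[OF bounded_linear_imp_has_derivative[OF bounded_linear_fst]])
       (simp only: fst_conv part)
  have gen: "((\<lambda>z. \<Sum>i\<in>Basis. (snd z \<bullet> i) *\<^sub>R fderiv f (fst z) i) has_derivative
     (\<lambda>a. \<Sum>i\<in>Basis. (snd (x, u) \<bullet> i) *\<^sub>R ?D i (fst a) + (snd a \<bullet> i) *\<^sub>R fderiv f (fst (x, u)) i)) (at (x, u))"
    by (intro has_derivative_sum has_derivative_scaleR has_derivative_inner_left has_derivative_snd
          has_derivative_ident part')
  have "((\<lambda>y. \<Sum>i\<in>Basis. (u \<bullet> i) *\<^sub>R fderiv f y i) has_derivative
     (\<lambda>a. \<Sum>i\<in>Basis. (u \<bullet> i) *\<^sub>R ?D i a)) (at x)"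
    by (intro has_derivative_sum has_derivative_scaleR_right part)
  then have "((\<lambda>y. fderiv f y u) has_derivative (\<lambda>a. \<Sum>i\<in>Basis. (u \<bullet> i) *\<^sub>R ?D i a)) (at x)"
    by (rule has_derivative_transform_within_open[OF _ S x]) (rule e)
  note c = fderiv_eqI[OF this]
  show ?thesis
  proof (rule has_derivative_transform_within_open[OF _ open_Times[OF S open_UNIV]])
    show "((\<lambda>z. \<Sum>i\<in>Basis. (snd z \<bullet> i) *\<^sub>R fderiv f (fst z) i) has_derivative
       (\<lambda>a. fderiv (\<lambda>y. fderiv f y u) x (fst a) + fderiv f x (snd a))) (at (x, u))"
      by (rule has_derivative_eq_rhs[OF gen]) (simp add: c sum.distrib e[OF x])
    show "(\<Sum>i\<in>Basis. (snd z \<bullet> i) *\<^sub>R fderiv f (fst z) i) = fderiv f (fst z) (snd z)"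
      if "z \<in> S \<times> UNIV" for z
      using that by (intro e) auto
  qed (use x in simp)
qed

lemma has_derivative_fderiv_field:
  fixes f :: "'a::euclidean_space \<Rightarrow> 'b::real_normed_vector"
  assumes S: "open S" and f: "smooth_on f S" and x: "x \<in> S" and Y: "(Y has_derivative Y') (at x)"
  shows "((\<lambda>y. fderiv f y (Y y)) has_derivative
    (\<lambda>a. fderiv (\<lambda>y. fderiv f y (Y x)) x a + fderiv f x (Y' a))) (at x)"
  using has_derivative_compose[OF has_derivative_Pair[OF has_derivative_ident Y]
      has_derivative_fderiv_pair[OF S f x]] by simp

lemma bilinear_Basis_expansion:
  fixes B :: "'a::euclidean_space \<Rightarrow> 'a \<Rightarrow> real"
  assumes "bilinear B"
  shows "B u w = (\<Sum>i\<in>Basis. \<Sum>j\<in>Basis. (u \<bullet> i) * (w \<bullet> j) * B i j)"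
proof -
  have "B u w = B (\<Sum>i\<in>Basis. (u \<bullet> i) *\<^sub>R i) (\<Sum>j\<in>Basis. (w \<bullet> j) *\<^sub>R j)"
    by (simp add: euclidean_representation)
  also have "\<dots> = (\<Sum>i\<in>Basis. \<Sum>j\<in>Basis. (u \<bullet> i) * (w \<bullet> j) * B i j)"
    by (simp add: bilinear_sum[OF assms] sum.cartesian_product[symmetric]
        bilinear_lmul[OF assms] bilinear_rmul[OF assms] mult_ac)
  finally show ?thesis .
qed

text \<open>The Leibniz rule for \<open>h\<^sub>x(u, w)\<close> when the form, given by its matrix entries, varies with \<open>x\<close> as well.\<close>

lemma has_derivative_bilinear_family:
  fixes G :: "'a::euclidean_space \<Rightarrow> 'b::euclidean_space \<Rightarrow> 'b \<Rightarrow> real"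
  assumes S: "open S" and x: "x \<in> S"
    and G: "\<And>i j. i \<in> Basis \<Longrightarrow> j \<in> Basis \<Longrightarrow> (\<lambda>y. G y i j) differentiable at x"
    and bl: "\<And>y. y \<in> S \<Longrightarrow> bilinear (G y)"
  shows "((\<lambda>z. G (fst z) (fst (snd z)) (snd (snd z))) has_derivative
    (\<lambda>a. fderiv (\<lambda>y. G y u w) x (fst a) + G x (fst (snd a)) w + G x u (snd (snd a)))) (at (x, u, w))"
proof -
  let ?D = "\<lambda>i j a. fderiv (\<lambda>y. G y i j) x a"
  let ?G = "\<lambda>y u w. \<Sum>i\<in>Basis. \<Sum>j\<in>Basis. (u \<bullet> i) * (w \<bullet> j) * G y i j"
  have e: "?G y u w = G y u w" if "y \<in> S" for y u w
    by (rule bilinear_Basis_expansion[OF bl[OF that], symmetric])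
  have part: "((\<lambda>y. G y i j) has_derivative ?D i j) (at x)" if "i \<in> Basis" "j \<in> Basis" for i j
    by (rule has_fderiv[OF G[OF that]])
  have part': "((\<lambda>z. G (fst z) i j) has_derivative (\<lambda>a. ?D i j (fst a))) (at (x, u, w))"
    if "i \<in> Basis" "j \<in> Basis" for i j
    by (rule has_derivative_compose[OF bounded_linear_imp_has_derivative[OF bounded_linear_fst]])
       (simp only: fst_conv part[OF that])
  have "((\<lambda>y. ?G y u w) has_derivative (\<lambda>a. \<Sum>i\<in>Basis. \<Sum>j\<in>Basis. (u \<bullet> i) * (w \<bullet> j) * ?D i j a)) (at x)"
    by (intro has_derivative_sum has_derivative_mult_right part)
  then have "((\<lambda>y. G y u w) has_derivative (\<lambda>a. \<Sum>i\<in>Basis. \<Sum>j\<in>Basis. (u \<bullet> i) * (w \<bullet> j) * ?D i j a)) (at x)"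
    by (rule has_derivative_transform_within_open[OF _ S x]) (rule e)
  note c = fderiv_eqI[OF this]
  have gen: "((\<lambda>z. ?G (fst z) (fst (snd z)) (snd (snd z))) has_derivative
     (\<lambda>a. \<Sum>i\<in>Basis. \<Sum>j\<in>Basis.
       ((fst (snd p) \<bullet> i) * (snd (snd p) \<bullet> j)) * ?D i j (fst a)
       + ((fst (snd p) \<bullet> i) * (snd (snd a) \<bullet> j) + (fst (snd a) \<bullet> i) * (snd (snd p) \<bullet> j)) * G (fst p) i j)) (at p)"
    if p: "p = (x, u, w)" for p
    by (intro has_derivative_sum has_derivative_mult has_derivative_inner_left
          has_derivative_snd has_derivative_fst has_derivative_ident part'[folded p])
  show ?thesis
  proof (rule has_derivative_transform_within_open[OF _ open_Times[OF S open_UNIV]])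
    show "((\<lambda>z. ?G (fst z) (fst (snd z)) (snd (snd z))) has_derivative
       (\<lambda>a. fderiv (\<lambda>y. G y u w) x (fst a) + G x (fst (snd a)) w + G x u (snd (snd a)))) (at (x, u, w))"
    proof (rule has_derivative_eq_rhs[OF gen[OF refl]], rule ext, goal_cases)
      case (1 a)
      show ?case
        unfolding c e[OF x, of "fst (snd a)" w, symmetric] e[OF x, of u "snd (snd a)", symmetric]
        by (simp add: sum.distrib algebra_simps)
    qed
    show "?G (fst z) (fst (snd z)) (snd (snd z)) = G (fst z) (fst (snd z)) (snd (snd z))"
      if "z \<in> S \<times> UNIV" for z
      using that by (intro e) auto
  qed (use x in simp)
qed

section \<open>Atlases, tangent vectors and brackets\<close>

text \<open>The conditions on charts in the definition of a smooth manifold. The tangent bundle inherits them,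
  so that derivations and smooth functions on a manifold and on its tangent bundle are treated alike.\<close>

locale smooth_atlas =
  fixes M :: "('p, 'c, 'e::euclidean_space) mfd"
  assumes points_eq: "points M = (\<Union>c\<in>charts M. chart_dom M c)"
    and inj_coords: "c \<in> charts M \<Longrightarrow> inj_on (coords M c) (chart_dom M c)"
    and open_overlap: "c \<in> charts M \<Longrightarrow> d \<in> charts M \<Longrightarrow>
      open (coords M c ` (chart_dom M c \<inter> chart_dom M d))"
    and smooth_transition: "c \<in> charts M \<Longrightarrow> d \<in> charts M \<Longrightarrow>
      smooth_on (transition M c d) (coords M c ` (chart_dom M c \<inter> chart_dom M d))"

lemma smooth_manifold_imp_atlas: "smooth_manifold M \<Longrightarrow> smooth_atlas M"
  unfolding smooth_manifold_def smooth_atlas_def by blast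

context smooth_atlas
begin

lemma charts_at_iff: "c \<in> charts_at M p \<longleftrightarrow> c \<in> charts M \<and> p \<in> chart_dom M c"
  by (simp add: charts_at_def)

lemma charts_atD: "c \<in> charts_at M p \<Longrightarrow> c \<in> charts M"
  by (simp add: charts_at_iff)

lemma charts_at_ex: "p \<in> points M \<Longrightarrow> \<exists>c. c \<in> charts_at M p"
  by (auto simp: points_eq charts_at_iff)

lemma charts_at_points: "c \<in> charts_at M p \<Longrightarrow> p \<in> points M"
  by (auto simp: points_eq charts_at_iff)

lemma open_image: "c \<in> charts M \<Longrightarrow> open (coords M c ` chart_dom M c)"
  using open_overlap[of c c] by simp

lemma inv_coords_coords:
  "c \<in> charts M \<Longrightarrow> p \<in> chart_dom M c \<Longrightarrow> inv_coords M c (coords M c p) = p"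
  unfolding inv_coords_def by (rule inv_into_f_f[OF inj_coords])

lemma inv_coords_at: "c \<in> charts_at M p \<Longrightarrow> inv_coords M c (coords M c p) = p"
  unfolding charts_at_iff by (blast intro: inv_coords_coords)

lemma coords_inv_coords:
  "x \<in> coords M c ` chart_dom M c \<Longrightarrow> coords M c (inv_coords M c x) = x"
  unfolding inv_coords_def by (rule f_inv_into_f)

lemma inv_coords_charts_at:
  assumes "c \<in> charts M" "d \<in> charts M" "x \<in> coords M c ` (chart_dom M c \<inter> chart_dom M d)"
  shows "c \<in> charts_at M (inv_coords M c x)" "d \<in> charts_at M (inv_coords M c x)"
    "coords M c (inv_coords M c x) = x"
  using assms inv_coords_coords by (auto simp: charts_at_iff)

lemma inv_coords_charts_at_self:
  assumes "c \<in> charts M" "x \<in> coords M c ` chart_dom M c"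
  shows "c \<in> charts_at M (inv_coords M c x)" "coords M c (inv_coords M c x) = x"
  using inv_coords_charts_at[of c c x] assms by auto

lemma coords_in_overlap:
  "c \<in> charts_at M p \<Longrightarrow> d \<in> charts_at M p \<Longrightarrow>
    coords M c p \<in> coords M c ` (chart_dom M c \<inter> chart_dom M d)"
  by (simp add: charts_at_iff)

lemma coords_in_image: "c \<in> charts_at M p \<Longrightarrow> coords M c p \<in> coords M c ` chart_dom M c"
  by (simp add: charts_at_iff)

lemma transition_coords: "c \<in> charts_at M p \<Longrightarrow> transition M c d (coords M c p) = coords M d p"
  by (simp add: transition_def inv_coords_at)

lemma transition_differentiable:
  assumes "c \<in> charts_at M p" "d \<in> charts_at M p"
  shows "transition M c d differentiable at (coords M c p)"
proof (rule smooth_on_differentiable)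
  show "smooth_on (transition M c d) (coords M c ` (chart_dom M c \<inter> chart_dom M d))"
    and "open (coords M c ` (chart_dom M c \<inter> chart_dom M d))"
    using assms by (simp_all add: charts_at_iff smooth_transition open_overlap)
qed (rule coords_in_overlap[OF assms])

lemma linear_transition:
  "c \<in> charts_at M p \<Longrightarrow> d \<in> charts_at M p \<Longrightarrow> linear (fderiv (transition M c d) (coords M c p))"
  by (rule linear_frechet_derivative[OF transition_differentiable])

lemma has_derivative_change_chart:
  assumes "c \<in> charts_at M p" "d \<in> charts_at M p" "h differentiable at (coords M d p)"
  shows "((\<lambda>x. h (transition M c d x)) has_derivative
    (\<lambda>a. fderiv h (coords M d p) (fderiv (transition M c d) (coords M c p) a))) (at (coords M c p))"
  using has_derivative_compose[OF has_fderiv[OF transition_differentiable[OF assms(1,2)]], of h]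
    has_fderiv[OF assms(3)] transition_coords[OF assms(1)] by metis

lemma transition_self:
  assumes "c \<in> charts_at M p"
  shows "fderiv (transition M c c) (coords M c p) = (\<lambda>a. a)"
proof -
  have c: "c \<in> charts M" using assms by (simp add: charts_at_iff)
  have "fderiv (transition M c c) (coords M c p) = fderiv (\<lambda>x. x) (coords M c p)"
    by (rule fderiv_cong[OF open_image[OF c] coords_in_image[OF assms]])
       (simp add: transition_def coords_inv_coords)
  then show ?thesis by simp
qed

lemma transition_cocycle:
  assumes c: "c \<in> charts_at M p" and d: "d \<in> charts_at M p" and e: "e \<in> charts_at M p"
  shows "fderiv (transition M d e) (coords M d p) (fderiv (transition M c d) (coords M c p) a)
    = fderiv (transition M c e) (coords M c p) a"
proof -
  note cd = charts_atD[OF c] charts_atD[OF d]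
  have "fderiv (\<lambda>x. transition M d e (transition M c d x)) (coords M c p)
    = fderiv (transition M c e) (coords M c p)"
  proof (rule fderiv_cong[OF open_overlap[OF cd] coords_in_overlap[OF c d]])
    fix y assume "y \<in> coords M c ` (chart_dom M c \<inter> chart_dom M d)"
    then show "transition M d e (transition M c d y) = transition M c e y"
      using inv_coords_charts_at[OF cd] transition_coords by (metis transition_def)
  qed
  then show ?thesis
    using fderiv_eqI[OF has_derivative_change_chart[OF c d transition_differentiable[OF d e]]]
    by (simp add: fun_eq_iff)
qed

lemma tspace_change:
  "v \<in> tspace M p \<Longrightarrow> c \<in> charts_at M p \<Longrightarrow> d \<in> charts_at M p \<Longrightarrow>
    v d = fderiv (transition M c d) (coords M c p) (v c)"
  unfolding tspace_def by blast

lemma tspace_outside: "v \<in> tspace M p \<Longrightarrow> c \<notin> charts_at M p \<Longrightarrow> v c = 0"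
  unfolding tspace_def by blast

lemma tspaceI:
  assumes "\<And>c. c \<notin> charts_at M p \<Longrightarrow> v c = 0"
    "\<And>c d. c \<in> charts_at M p \<Longrightarrow> d \<in> charts_at M p \<Longrightarrow>
      v d = fderiv (transition M c d) (coords M c p) (v c)"
  shows "v \<in> tspace M p"
  unfolding tspace_def using assms by blast

lemma tspace_eqI:
  assumes "u \<in> tspace M p" "v \<in> tspace M p" "c \<in> charts_at M p" "u c = v c"
  shows "u = v"
  using assms tspace_change tspace_outside by (metis ext)

lemma coord_vec_tspace: "c \<in> charts_at M p \<Longrightarrow> coord_vec M c p a \<in> tspace M p"
  by (rule tspaceI) (simp_all add: coord_vec_def transition_cocycle)

lemma coord_vec_self: "c \<in> charts_at M p \<Longrightarrow> coord_vec M c p a c = a"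
  by (simp add: coord_vec_def transition_self)

lemma coord_vec_tvec: "v \<in> tspace M p \<Longrightarrow> c \<in> charts_at M p \<Longrightarrow> coord_vec M c p (v c) = v"
  by (rule tspace_eqI[OF coord_vec_tspace _ _ coord_vec_self])

lemma tspace_zero: "(\<lambda>_. 0) \<in> tspace M p"
  by (rule tspaceI) (simp_all add: linear_0[OF linear_transition])

lemma tspace_add: "u \<in> tspace M p \<Longrightarrow> v \<in> tspace M p \<Longrightarrow> (\<lambda>c. u c + v c) \<in> tspace M p"
  by (rule tspaceI)
     (simp_all add: tspace_outside linear_add[OF linear_transition] tspace_change[symmetric])

lemma tspace_scale: "u \<in> tspace M p \<Longrightarrow> (\<lambda>c. r *\<^sub>R u c) \<in> tspace M p"
  by (rule tspaceI)
     (simp_all add: tspace_outside linear_cmul[OF linear_transition] tspace_change[symmetric])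

lemma tspace_sum:
  "(\<And>i. i \<in> I \<Longrightarrow> V i \<in> tspace M p) \<Longrightarrow> (\<lambda>c. \<Sum>i\<in>I. V i c) \<in> tspace M p"
  by (induction I rule: infinite_finite_induct) (auto intro: tspace_zero tspace_add)

lemma lincomb_tspace:
  "(\<And>i. i \<in> I \<Longrightarrow> V i \<in> tspace M p) \<Longrightarrow> lincomb I t V \<in> tspace M p"
  unfolding lincomb_def by (intro tspace_sum tspace_scale)

lemma smooth_fun_chart_differentiable:
  assumes "smooth_fun M f" "c \<in> charts_at M p"
  shows "(\<lambda>x. f (inv_coords M c x)) differentiable at (coords M c p)"
  using assms unfolding smooth_fun_def charts_at_iff
  by (intro smooth_on_differentiable[of _ "coords M c ` chart_dom M c"]) (auto intro: open_image)

lemma linear_chart_derivative: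
  "smooth_fun M f \<Longrightarrow> c \<in> charts_at M p \<Longrightarrow>
    linear (fderiv (\<lambda>x. f (inv_coords M c x)) (coords M c p))"
  by (rule linear_frechet_derivative[OF smooth_fun_chart_differentiable])

text \<open>A derivation is computed in one chosen chart; passing to another chart multiplies the coordinate
  vector by the Jacobian of the transition map and composes the function with its inverse.\<close>

lemma tderiv_chart:
  assumes f: "smooth_fun M f" and w: "w \<in> tspace M p" and c: "c \<in> charts_at M p"
  shows "tderiv M p w f = fderiv (\<lambda>x. f (inv_coords M c x)) (coords M c p) (w c)"
proof -
  define d where "d = (SOME c. c \<in> charts_at M p)"
  have d: "d \<in> charts_at M p" unfolding d_def by (rule someI[of _ c]) (rule c)
  note cd = charts_atD[OF c] charts_atD[OF d]
  have "fderiv (\<lambda>x. f (inv_coords M d (transition M c d x))) (coords M c p)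
    = fderiv (\<lambda>x. f (inv_coords M c x)) (coords M c p)"
  proof (rule fderiv_cong[OF open_overlap[OF cd] coords_in_overlap[OF c d]])
    fix y assume "y \<in> coords M c ` (chart_dom M c \<inter> chart_dom M d)"
    then show "f (inv_coords M d (transition M c d y)) = f (inv_coords M c y)"
      using inv_coords_charts_at[OF cd] inv_coords_at by (metis transition_def)
  qed
  then have "fderiv (\<lambda>x. f (inv_coords M c x)) (coords M c p) (w c)
    = fderiv (\<lambda>x. f (inv_coords M d x)) (coords M d p) (w d)"
    using fderiv_eqI[OF has_derivative_change_chart[OF c d smooth_fun_chart_differentiable[OF f d]]]
      tspace_change[OF w c d] by (simp add: fun_eq_iff)
  then show ?thesis by (simp add: tderiv_def d_def Let_def)
qed

lemma smooth_fun_cong: 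
  assumes "\<And>p. p \<in> points M \<Longrightarrow> f p = f' p" "smooth_fun M f"
  shows "smooth_fun M f'"
  unfolding smooth_fun_def
proof
  fix c assume c: "c \<in> charts M"
  show "smooth_on (\<lambda>x. f' (inv_coords M c x)) (coords M c ` chart_dom M c)"
  proof (rule smooth_on_cong[OF open_image[OF c]])
    show "smooth_on (\<lambda>x. f (inv_coords M c x)) (coords M c ` chart_dom M c)"
      using assms(2) c unfolding smooth_fun_def by blast
    show "f (inv_coords M c x) = f' (inv_coords M c x)" if "x \<in> coords M c ` chart_dom M c" for x
      using assms(1) inv_coords_charts_at_self[OF c that] charts_at_points by blast
  qed
qed

lemma smooth_fun_const: "smooth_fun M (\<lambda>_. r)"
  unfolding smooth_fun_def by (intro ballI smooth_on_const open_image)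

lemma smooth_fun_add: "smooth_fun M f \<Longrightarrow> smooth_fun M h \<Longrightarrow> smooth_fun M (\<lambda>p. f p + h p)"
  unfolding smooth_fun_def by (intro ballI smooth_on_add open_image) auto

lemma smooth_fun_mult: "smooth_fun M f \<Longrightarrow> smooth_fun M h \<Longrightarrow> smooth_fun M (\<lambda>p. f p * h p)"
  unfolding smooth_fun_def by (intro ballI smooth_on_mult open_image) auto

lemma smooth_fun_uminus: "smooth_fun M f \<Longrightarrow> smooth_fun M (\<lambda>p. - f p)"
  using smooth_fun_mult[OF smooth_fun_const[of "-1"]] by simp

lemma smooth_fun_diff: "smooth_fun M f \<Longrightarrow> smooth_fun M h \<Longrightarrow> smooth_fun M (\<lambda>p. f p - h p)"
  using smooth_fun_add[OF _ smooth_fun_uminus] by simp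

lemma smooth_fun_sum:
  "(\<And>i. i \<in> I \<Longrightarrow> smooth_fun M (f i)) \<Longrightarrow> smooth_fun M (\<lambda>p. \<Sum>i\<in>I. f i p)"
  by (induction I rule: infinite_finite_induct) (auto intro: smooth_fun_const smooth_fun_add)

lemma smooth_fun_inverse:
  assumes "smooth_fun M f" "\<And>p. p \<in> points M \<Longrightarrow> f p \<noteq> 0"
  shows "smooth_fun M (\<lambda>p. inverse (f p))"
  unfolding smooth_fun_def
proof
  fix c assume c: "c \<in> charts M"
  show "smooth_on (\<lambda>x. inverse (f (inv_coords M c x))) (coords M c ` chart_dom M c)"
    using assms c inv_coords_charts_at_self[OF c] charts_at_points unfolding smooth_fun_def
    by (intro smooth_on_inverse open_image) blast+
qed

lemma tderiv_diff:
  assumes "smooth_fun M f" "smooth_fun M h" and w: "w \<in> tspace M p" and "p \<in> points M"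
  shows "tderiv M p w (\<lambda>s. f s - h s) = tderiv M p w f - tderiv M p w h"
proof -
  obtain c where c: "c \<in> charts_at M p" using charts_at_ex[OF assms(4)] by blast
  have "fderiv (\<lambda>x. f (inv_coords M c x) - h (inv_coords M c x)) (coords M c p)
     = (\<lambda>a. fderiv (\<lambda>x. f (inv_coords M c x)) (coords M c p) a
       - fderiv (\<lambda>x. h (inv_coords M c x)) (coords M c p) a)"
    by (intro fderiv_eqI has_derivative_diff has_fderiv smooth_fun_chart_differentiable assms c)
  then show ?thesis using assms by (simp add: tderiv_chart[OF _ w c] smooth_fun_diff)
qed

lemma tderiv_add:
  assumes F: "smooth_fun M f" and p: "p \<in> points M" and "v \<in> tspace M p" "w \<in> tspace M p"
  shows "tderiv M p (\<lambda>c. v c + w c) f = tderiv M p v f + tderiv M p w f"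
proof -
  obtain c where c: "c \<in> charts_at M p" using charts_at_ex[OF p] by blast
  note l = linear_chart_derivative[OF F c]
  show ?thesis using assms by (simp add: tderiv_chart[OF _ _ c] tspace_add linear_add[OF l])
qed

lemma tderiv_scale:
  assumes F: "smooth_fun M f" and p: "p \<in> points M" and "v \<in> tspace M p"
  shows "tderiv M p (\<lambda>c. r *\<^sub>R v c) f = r * tderiv M p v f"
proof -
  obtain c where c: "c \<in> charts_at M p" using charts_at_ex[OF p] by blast
  note l = linear_chart_derivative[OF F c]
  show ?thesis using assms by (simp add: tderiv_chart[OF _ _ c] tspace_scale linear_cmul[OF l])
qed

lemma local_rep_smooth:
  "vector_field M X \<Longrightarrow> c \<in> charts M \<Longrightarrow> smooth_on (local_rep M c X) (coords M c ` chart_dom M c)"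
proof -
  assume X: "vector_field M X" and c: "c \<in> charts M"
  have "points M \<inter> chart_dom M c = chart_dom M c" using c by (auto simp: points_eq)
  then show ?thesis using X c unfolding vector_field_on_def by metis
qed

lemma vector_field_tspace: "vector_field M X \<Longrightarrow> p \<in> points M \<Longrightarrow> X p \<in> tspace M p"
  unfolding vector_field_on_def by blast

lemma local_rep_at: "c \<in> charts_at M p \<Longrightarrow> local_rep M c X (coords M c p) = X p c"
  by (simp add: local_rep_def inv_coords_at)

lemma local_rep_has_derivative:
  assumes "vector_field M X" "c \<in> charts_at M p"
  shows "(local_rep M c X has_derivative fderiv (local_rep M c X) (coords M c p)) (at (coords M c p))"
proof -
  have c: "c \<in> charts M" using assms by (simp add: charts_at_iff)
  show ?thesis
    by (rule has_fderiv[OF smooth_on_differentiable[OF local_rep_smooth[OF assms(1) c] open_image[OF c]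
        coords_in_image[OF assms(2)]]])
qed

text \<open>Obtained by differentiating \<open>X\<^sub>d(\<tau>(x)) = \<tau>'(x) X\<^sub>c(x)\<close>, where \<open>\<tau>\<close> is the transition map. The
  inhomogeneous term is the second derivative of \<open>\<tau>\<close>. It is symmetric, so it drops out of brackets,
  and it is exactly the term by which the fibre part of a vector tangent to the tangent bundle
  changes.\<close>

lemma local_rep_derivative_change:
  assumes X: "vector_field M X" and c: "c \<in> charts_at M p" and d: "d \<in> charts_at M p"
  shows "fderiv (local_rep M d X) (coords M d p) (fderiv (transition M c d) (coords M c p) a)
    = fderiv (\<lambda>y. fderiv (transition M c d) y (X p c)) (coords M c p) a
      + fderiv (transition M c d) (coords M c p) (fderiv (local_rep M c X) (coords M c p) a)"
proof -
  note cd = charts_atD[OF c] charts_atD[OF d]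
  note S = open_overlap[OF cd] and x = coords_in_overlap[OF c d]
  have "local_rep M d X differentiable at (coords M d p)"
    using local_rep_has_derivative[OF X d] unfolding differentiable_def by blast
  note 1 = fderiv_eqI[OF has_derivative_change_chart[OF c d this]]
  have "fderiv (\<lambda>x. local_rep M d X (transition M c d x)) (coords M c p)
    = fderiv (\<lambda>x. fderiv (transition M c d) x (local_rep M c X x)) (coords M c p)"
  proof (rule fderiv_cong[OF S x])
    fix y assume "y \<in> coords M c ` (chart_dom M c \<inter> chart_dom M d)"
    note y = inv_coords_charts_at[OF cd this]
    show "local_rep M d X (transition M c d y) = fderiv (transition M c d) y (local_rep M c X y)"
      using tspace_change[OF vector_field_tspace[OF X charts_at_points[OF y(1)]] y(1,2)]
        local_rep_at[OF y(1), of X] local_rep_at[OF y(2), of X] transition_coords[OF y(1)]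
      unfolding y(3) by simp
  qed
  moreover have "fderiv (\<lambda>x. fderiv (transition M c d) x (local_rep M c X x)) (coords M c p)
    = (\<lambda>a. fderiv (\<lambda>y. fderiv (transition M c d) y (X p c)) (coords M c p) a
      + fderiv (transition M c d) (coords M c p) (fderiv (local_rep M c X) (coords M c p) a))"
    using fderiv_eqI[OF has_derivative_fderiv_field[OF S smooth_transition[OF cd] x
          local_rep_has_derivative[OF X c]]]
    unfolding local_rep_at[OF c] .
  ultimately show ?thesis unfolding 1 by metis
qed

lemma transition_second_derivative_symmetric:
  assumes "c \<in> charts_at M p" "d \<in> charts_at M p"
  shows "fderiv (\<lambda>y. fderiv (transition M c d) y a) (coords M c p) b
    = fderiv (\<lambda>y. fderiv (transition M c d) y b) (coords M c p) a"
  using assms coords_in_overlap[OF assms]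
  by (intro second_derivative_symmetric[OF open_overlap smooth_transition]) (auto simp: charts_at_iff)

lemma lie_bracket_tspace:
  assumes X: "vector_field M X" and Y: "vector_field M Y" and p: "p \<in> points M"
  shows "lie_bracket M X Y p \<in> tspace M p"
proof (rule tspaceI)
  fix c d assume c: "c \<in> charts_at M p" and d: "d \<in> charts_at M p"
  note Xp = tspace_change[OF vector_field_tspace[OF X p] c d]
  note Yp = tspace_change[OF vector_field_tspace[OF Y p] c d]
  show "lie_bracket M X Y p d = fderiv (transition M c d) (coords M c p) (lie_bracket M X Y p c)"
    using c d unfolding lie_bracket_def
    by (simp add: Xp Yp local_rep_derivative_change[OF X c d] local_rep_derivative_change[OF Y c d]
        linear_diff[OF linear_transition[OF c d]]
        transition_second_derivative_symmetric[OF c d, of "X p c"])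
qed (simp add: lie_bracket_def)

end

section \<open>The tangent bundle\<close>

lemma tangent_bundle_simps:
  "charts (tangent_bundle M) = charts M"
  "points (tangent_bundle M) = {(q, v). q \<in> points M \<and> v \<in> tspace M q}"
  "chart_dom (tangent_bundle M) c = {(q, v). q \<in> chart_dom M c \<and> v \<in> tspace M q}"
  "coords (tangent_bundle M) c (q, v) = (coords M c q, v c)"
  by (simp_all add: tangent_bundle_def)

context smooth_atlas
begin

abbreviation "TB \<equiv> tangent_bundle M"

lemma tb_pointsD: "p \<in> points TB \<Longrightarrow> fst p \<in> points M \<and> snd p \<in> tspace M (fst p)"
  by (auto simp: tangent_bundle_simps)

lemma tb_points_iff: "(q, v) \<in> points TB \<longleftrightarrow> q \<in> points M \<and> v \<in> tspace M q"
  by (auto simp: tangent_bundle_simps)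

lemma tb_charts_at: "v \<in> tspace M q \<Longrightarrow> charts_at TB (q, v) = charts_at M q"
  by (auto simp: charts_at_def tangent_bundle_simps)

lemma tb_charts_at_iff: "c \<in> charts_at TB (q, v) \<longleftrightarrow> c \<in> charts_at M q \<and> v \<in> tspace M q"
  by (auto simp: charts_at_def tangent_bundle_simps)

lemma tb_overlap_image:
  assumes c: "c \<in> charts M" and d: "d \<in> charts M"
  shows "coords TB c ` (chart_dom TB c \<inter> chart_dom TB d)
    = coords M c ` (chart_dom M c \<inter> chart_dom M d) \<times> UNIV" (is "?L = ?R")
proof
  show "?L \<subseteq> ?R" by (auto simp: tangent_bundle_simps)
  show "?R \<subseteq> ?L"
  proof
    fix z assume "z \<in> ?R"
    then obtain q u where z: "z = (coords M c q, u)" and q: "q \<in> chart_dom M c" "q \<in> chart_dom M d" by auto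
    have at: "c \<in> charts_at M q" using c q by (simp add: charts_at_iff)
    have "z = coords TB c (q, coord_vec M c q u)"
      by (simp add: z tangent_bundle_simps coord_vec_self[OF at])
    moreover have "(q, coord_vec M c q u) \<in> chart_dom TB c \<inter> chart_dom TB d"
      using q coord_vec_tspace[OF at] by (simp add: tangent_bundle_simps)
    ultimately show "z \<in> ?L" by blast
  qed
qed

lemma tb_image: "c \<in> charts M \<Longrightarrow> coords TB c ` chart_dom TB c = coords M c ` chart_dom M c \<times> UNIV"
  using tb_overlap_image[of c c] by simp

lemma tb_inj: 
  assumes c: "c \<in> charts M" shows "inj_on (coords TB c) (chart_dom TB c)"
proof (rule inj_onI)
  fix s t assume s: "s \<in> chart_dom TB c" and t: "t \<in> chart_dom TB c" and e: "coords TB c s = coords TB c t"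
  obtain q v q' v' where st: "s = (q, v)" "t = (q', v')" by fastforce
  have q: "q \<in> chart_dom M c" "q' \<in> chart_dom M c" "v \<in> tspace M q" "v' \<in> tspace M q'"
    "coords M c q = coords M c q'" "v c = v' c"
    using s t e by (auto simp: st tangent_bundle_simps)
  have "q = q'" using inj_onD[OF inj_coords[OF c] q(5) q(1,2)] .
  moreover have "v = v'"
    by (rule tspace_eqI[OF q(3)]) (use q c \<open>q = q'\<close> in \<open>auto simp: charts_at_iff\<close>)
  ultimately show "s = t" by (simp add: st)
qed

lemma tb_inv_coords:
  assumes c: "c \<in> charts M" and x: "x \<in> coords M c ` chart_dom M c"
  shows "inv_coords TB c (x, u) = (inv_coords M c x, coord_vec M c (inv_coords M c x) u)"
  unfolding inv_coords_def[of TB]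
proof (rule inv_into_f_eq[OF tb_inj[OF c]])
  note i = inv_coords_charts_at_self[OF c x]
  show "(inv_coords M c x, coord_vec M c (inv_coords M c x) u) \<in> chart_dom TB c"
    using i(1) coord_vec_tspace[OF i(1)] by (simp add: tangent_bundle_simps charts_at_iff)
  show "coords TB c (inv_coords M c x, coord_vec M c (inv_coords M c x) u) = (x, u)"
    by (simp add: tangent_bundle_simps i(2) coord_vec_self[OF i(1)])
qed

lemma tb_transition:
  assumes c: "c \<in> charts M" and d: "d \<in> charts M"
    and x: "x \<in> coords M c ` (chart_dom M c \<inter> chart_dom M d)"
  shows "transition TB c d (x, u) = (transition M c d x, fderiv (transition M c d) x u)"
proof -
  note i = inv_coords_charts_at[OF c d x]
  have "x \<in> coords M c ` chart_dom M c" using x by blast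
  then show ?thesis using i
    by (simp add: transition_def[of TB] tb_inv_coords[OF c] tangent_bundle_simps coord_vec_def)
       (simp add: transition_def)
qed

lemma open_image_Times: "c \<in> charts M \<Longrightarrow> open (coords M c ` chart_dom M c \<times> (UNIV :: 'e set))"
  by (intro open_Times open_image open_UNIV)

lemma open_overlap_Times:
  "c \<in> charts M \<Longrightarrow> d \<in> charts M \<Longrightarrow>
    open (coords M c ` (chart_dom M c \<inter> chart_dom M d) \<times> (UNIV :: 'e set))"
  by (intro open_Times open_overlap open_UNIV)

lemma tb_smooth_transition:
  assumes c: "c \<in> charts M" and d: "d \<in> charts M"
  shows "smooth_on (transition TB c d) (coords M c ` (chart_dom M c \<inter> chart_dom M d) \<times> UNIV)"
    (is "smooth_on _ (?S \<times> UNIV)")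
proof (rule smooth_on_cong[OF open_overlap_Times[OF c d]])
  note S = open_overlap[OF c d] open_overlap_Times[OF c d] smooth_transition[OF c d]
  have sub: "fst ` (?S \<times> (UNIV :: 'e set)) \<subseteq> ?S" by auto
  show "smooth_on (\<lambda>z. (transition M c d (fst z),
      \<Sum>i\<in>Basis. (snd z \<bullet> i) *\<^sub>R fderiv (transition M c d) (fst z) i)) (?S \<times> UNIV)"
    by (intro smooth_on_Pair smooth_on_sum smooth_on_scaleR smooth_on_inner smooth_on_const
        smooth_on_bounded_linear[OF bounded_linear_snd] S sub
        smooth_on_compose_linear[OF bounded_linear_fst S(1,2) sub] smooth_on_fderiv)
  show "(transition M c d (fst z), \<Sum>i\<in>Basis. (snd z \<bullet> i) *\<^sub>R fderiv (transition M c d) (fst z) i)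
      = transition TB c d z" if "z \<in> ?S \<times> UNIV" for z
  proof (cases z)
    case (Pair x u)
    then have x: "x \<in> ?S" using that by simp
    show ?thesis
      unfolding Pair tb_transition[OF c d x] fst_conv snd_conv
        fderiv_basis_expansion[OF smooth_on_differentiable[OF S(3,1) x], of u] ..
  qed
qed

lemma tangent_bundle_atlas: "smooth_atlas TB"
proof
  show "points TB = (\<Union>c\<in>charts TB. chart_dom TB c)"
    by (auto simp: tangent_bundle_simps points_eq)
qed (simp_all add: tangent_bundle_simps(1) tb_inj tb_overlap_image open_overlap_Times tb_smooth_transition)

lemma tb_transition_derivative:
  assumes c: "c \<in> charts_at M q" and d: "d \<in> charts_at M q"
  shows "fderiv (transition TB c d) (coords M c q, u) (a, b)
    = (fderiv (transition M c d) (coords M c q) a,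
       fderiv (\<lambda>y. fderiv (transition M c d) y u) (coords M c q) a + fderiv (transition M c d) (coords M c q) b)"
proof -
  note cd = charts_atD[OF c] charts_atD[OF d]
  note S = open_overlap[OF cd] and x = coords_in_overlap[OF c d] and sm = smooth_transition[OF cd]
  have 1: "((\<lambda>z. transition M c d (fst z)) has_derivative
    (\<lambda>a. fderiv (transition M c d) (coords M c q) (fst a))) (at (coords M c q, u))"
    by (rule has_derivative_compose[OF bounded_linear_imp_has_derivative[OF bounded_linear_fst]])
       (simp only: fst_conv has_fderiv[OF transition_differentiable[OF c d]])
  have "(transition TB c d has_derivative (\<lambda>a. (fderiv (transition M c d) (coords M c q) (fst a),
     fderiv (\<lambda>y. fderiv (transition M c d) y u) (coords M c q) (fst a)
      + fderiv (transition M c d) (coords M c q) (snd a)))) (at (coords M c q, u))"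
  proof (rule has_derivative_transform_within_open[OF _ open_overlap_Times[OF cd]])
    show "((\<lambda>z. (transition M c d (fst z), fderiv (transition M c d) (fst z) (snd z))) has_derivative
     (\<lambda>a. (fderiv (transition M c d) (coords M c q) (fst a),
      fderiv (\<lambda>y. fderiv (transition M c d) y u) (coords M c q) (fst a)
      + fderiv (transition M c d) (coords M c q) (snd a)))) (at (coords M c q, u))"
      by (rule has_derivative_Pair[OF 1 has_derivative_fderiv_pair[OF S sm x]])
  qed (use x tb_transition[OF cd] in auto)
  from fderiv_eqI[OF this] show ?thesis by simp
qed

text \<open>In induced coordinates the fibre component of a vector tangent to the bundle at \<open>(q, v)\<close> picks up the
  second derivative of the transition map, applied to \<open>v\<close> and the base component.\<close>

lemma tb_tspaceI:
  assumes v: "v \<in> tspace M q"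
    and out: "\<And>c. c \<notin> charts_at M q \<Longrightarrow> w c = 0"
    and change: "\<And>c d. c \<in> charts_at M q \<Longrightarrow> d \<in> charts_at M q \<Longrightarrow>
      w d = (fderiv (transition M c d) (coords M c q) (fst (w c)),
        fderiv (\<lambda>y. fderiv (transition M c d) y (v c)) (coords M c q) (fst (w c))
        + fderiv (transition M c d) (coords M c q) (snd (w c)))"
  shows "w \<in> tspace TB (q, v)"
proof -
  interpret T: smooth_atlas TB by (rule tangent_bundle_atlas)
  show ?thesis
  proof (rule T.tspaceI)
    fix c d assume "c \<in> charts_at TB (q, v)" "d \<in> charts_at TB (q, v)"
    then have c: "c \<in> charts_at M q" and d: "d \<in> charts_at M q" by (auto simp: tb_charts_at_iff)
    show "w d = fderiv (transition TB c d) (coords TB c (q, v)) (w c)"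
      using tb_transition_derivative[OF c d, of "v c" "fst (w c)" "snd (w c)"] change[OF c d]
      by (simp add: tangent_bundle_simps)
  qed (use out v in \<open>simp add: tb_charts_at\<close>)
qed

lemma vertical_lift_tspace:
  assumes X: "X q \<in> tspace M q" and v: "v \<in> tspace M q"
  shows "vertical_lift M X (q, v) \<in> tspace TB (q, v)"
proof (rule tb_tspaceI[OF v])
  fix c d assume c: "c \<in> charts_at M q" and d: "d \<in> charts_at M q"
  have "fderiv (\<lambda>y. fderiv (transition M c d) y (v c)) (coords M c q) 0 = 0"
    using c d transition_second_derivative_symmetric[OF c d, of "v c" 0]
    by (simp add: linear_0[OF linear_frechet_derivative[OF smooth_on_differentiable[OF
          smooth_on_fderiv[OF open_overlap smooth_transition] open_overlap coords_in_overlap[OF c d]]]] charts_at_iff)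
  then show "vertical_lift M X (q, v) d = (fderiv (transition M c d) (coords M c q) (fst (vertical_lift M X (q, v) c)),
     fderiv (\<lambda>y. fderiv (transition M c d) y (v c)) (coords M c q) (fst (vertical_lift M X (q, v) c))
     + fderiv (transition M c d) (coords M c q) (snd (vertical_lift M X (q, v) c)))"
    using c d by (simp add: vertical_lift_def tspace_change[OF X c d] linear_0[OF linear_transition[OF c d]])
qed (simp add: vertical_lift_def)

text \<open>The second derivative of the transition map is applied to \<open>X\<close> and \<open>v\<close> in one order when the derivative
  of \<open>X\<close> is transformed, and in the other order when tangent vectors of the bundle are.\<close>

lemma complete_lift_tspace:
  assumes X: "vector_field M X" and q: "q \<in> points M" and v: "v \<in> tspace M q"
  shows "complete_lift M X (q, v) \<in> tspace TB (q, v)"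
proof (rule tb_tspaceI[OF v])
  fix c d assume c: "c \<in> charts_at M q" and d: "d \<in> charts_at M q"
  show "complete_lift M X (q, v) d = (fderiv (transition M c d) (coords M c q) (fst (complete_lift M X (q, v) c)),
     fderiv (\<lambda>y. fderiv (transition M c d) y (v c)) (coords M c q) (fst (complete_lift M X (q, v) c))
     + fderiv (transition M c d) (coords M c q) (snd (complete_lift M X (q, v) c)))"
    using c d transition_second_derivative_symmetric[OF c d, of "v c" "X q c"]
    by (simp add: complete_lift_def tspace_change[OF vector_field_tspace[OF X q] c d]
        tspace_change[OF v c d] local_rep_derivative_change[OF X c d])
qed (simp add: complete_lift_def)

section \<open>Tensor fields and the Euler-Lagrange expression in charts\<close>

lemma tensor_lin:
  assumes h: "symmetric_tensor_field M h" and q: "q \<in> points M"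
    and "u \<in> tspace M q" "v \<in> tspace M q" "w \<in> tspace M q"
  shows "h q (\<lambda>c. r *\<^sub>R u c + s *\<^sub>R v c) w = r * h q u w + s * h q v w"
  using assms unfolding symmetric_tensor_field_def by blast

lemma tensor_sym:
  assumes "symmetric_tensor_field M h" "q \<in> points M" "u \<in> tspace M q" "v \<in> tspace M q"
  shows "h q u v = h q v u"
  using assms unfolding symmetric_tensor_field_def by blast

lemma tensor_add:
  assumes "symmetric_tensor_field M h" "q \<in> points M"
    "u \<in> tspace M q" "v \<in> tspace M q" "w \<in> tspace M q"
  shows "h q (\<lambda>c. u c + v c) w = h q u w + h q v w"
  using tensor_lin[OF assms, of 1 1] by simp

lemma tensor_scale:
  assumes "symmetric_tensor_field M h" "q \<in> points M" "u \<in> tspace M q" "w \<in> tspace M q"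
  shows "h q (\<lambda>c. r *\<^sub>R u c) w = r * h q u w"
  using tensor_lin[OF assms(1-3,3,4), of r 0] by simp

lemma tensor_lincomb:
  assumes h: "symmetric_tensor_field M h" "q \<in> points M" and w: "w \<in> tspace M q"
    and V: "\<And>i. i \<in> I \<Longrightarrow> V i \<in> tspace M q"
  shows "h q (lincomb I t V) w = (\<Sum>i\<in>I. t i * h q (V i) w)"
  using V
proof (induction I rule: infinite_finite_induct)
  case (insert i I)
  have "h q (lincomb (insert i I) t V) w = h q (\<lambda>c. t i *\<^sub>R V i c + lincomb I t V c) w"
    using insert by (simp add: lincomb_def)
  also have "\<dots> = t i * h q (V i) w + h q (lincomb I t V) w"
    using insert.prems tensor_add[OF h tspace_scale[of "V i"] lincomb_tspace[of I V] w]
      tensor_scale[OF h _ w, of "V i"] by simp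
  finally show ?case using insert by simp
qed (use tensor_scale[OF h tspace_zero w, of 0] in \<open>simp_all add: lincomb_def\<close>)

lemma tensor_local:
  assumes "c \<in> charts_at M q" "u \<in> tspace M q" "v \<in> tspace M q"
  shows "h q u v = local_tensor M c h (coords M c q) (u c) (v c)"
  using assms by (simp add: local_tensor_def inv_coords_at coord_vec_tvec)

lemma coord_vec_lin:
  assumes "c \<in> charts_at M q"
  shows "coord_vec M c q (a + b) = (\<lambda>d. coord_vec M c q a d + coord_vec M c q b d)"
    "coord_vec M c q (r *\<^sub>R a) = (\<lambda>d. r *\<^sub>R coord_vec M c q a d)"
  using linear_add[OF linear_transition[OF assms]] linear_cmul[OF linear_transition[OF assms]]
  by (auto simp: coord_vec_def fun_eq_iff)

lemma local_tensor_sym: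
  assumes "symmetric_tensor_field M h" "c \<in> charts M" "x \<in> coords M c ` chart_dom M c"
  shows "local_tensor M c h x a b = local_tensor M c h x b a"
  using tensor_sym[OF assms(1)] inv_coords_charts_at_self[OF assms(2,3)] coord_vec_tspace charts_at_points
  unfolding local_tensor_def by blast

lemma bilinear_local_tensor:
  assumes h: "symmetric_tensor_field M h" and c: "c \<in> charts M" and x: "x \<in> coords M c ` chart_dom M c"
  shows "bilinear (local_tensor M c h x)"
proof -
  note i = inv_coords_charts_at_self(1)[OF c x]
  note p = charts_at_points[OF i] and t = coord_vec_tspace[OF i]
  have l: "linear (\<lambda>a. local_tensor M c h x a b)" for b
    by (rule linearI)
       (simp_all add: local_tensor_def coord_vec_lin[OF i] tensor_add[OF h p t t t] tensor_scale[OF h p t t])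
  have "local_tensor M c h x = (\<lambda>a b. local_tensor M c h x b a)"
    using local_tensor_sym[OF assms] by blast
  then have "linear (local_tensor M c h x a)" for a using l by (metis (mono_tags))
  with l show ?thesis unfolding bilinear_def by blast
qed

lemma local_tensor_smooth_fields:
  fixes P :: "'a::euclidean_space \<Rightarrow> 'e"
  assumes h: "symmetric_tensor_field M h" and c: "c \<in> charts M" and T: "open T"
    and P: "bounded_linear P" "P ` T \<subseteq> coords M c ` chart_dom M c"
    and U: "smooth_on U T" and W: "smooth_on W T"
  shows "smooth_on (\<lambda>z. local_tensor M c h (P z) (U z) (W z)) T"
proof (rule smooth_on_cong[OF T])
  have "smooth_on (\<lambda>x. local_tensor M c h x i j) (coords M c ` chart_dom M c)"
    if "i \<in> Basis" "j \<in> Basis" for i j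
    using h that c unfolding symmetric_tensor_field_def by blast
  then have "smooth_on (\<lambda>z. local_tensor M c h (P z) i j) T" if "i \<in> Basis" "j \<in> Basis" for i j
    using smooth_on_compose_linear[OF P(1) open_image[OF c] T P(2)] that by blast
  then show "smooth_on (\<lambda>z. \<Sum>i\<in>Basis. \<Sum>j\<in>Basis. (U z \<bullet> i) * (W z \<bullet> j) * local_tensor M c h (P z) i j) T"
    by (intro smooth_on_sum smooth_on_mult smooth_on_inner smooth_on_const U W T)
  show "(\<Sum>i\<in>Basis. \<Sum>j\<in>Basis. (U z \<bullet> i) * (W z \<bullet> j) * local_tensor M c h (P z) i j)
     = local_tensor M c h (P z) (U z) (W z)" if "z \<in> T" for z
    by (rule bilinear_Basis_expansion[OF bilinear_local_tensor[OF h c], symmetric])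
       (use P(2) that in blast)
qed

lemma local_tensor_smooth:
  assumes h: "symmetric_tensor_field M h" and c: "c \<in> charts M"
  shows "smooth_on (\<lambda>x. local_tensor M c h x a b) (coords M c ` chart_dom M c)"
  using local_tensor_smooth_fields[OF h c open_image[OF c] bounded_linear_ident _
      smooth_on_const[OF open_image[OF c]] smooth_on_const[OF open_image[OF c]]] by simp

lemma local_tensor_has_derivative:
  assumes h: "symmetric_tensor_field M h" and c: "c \<in> charts_at M q"
    and P: "(P has_derivative P') (at z)" and Pz: "P z = coords M c q"
    and U: "(U has_derivative U') (at z)" and W: "(W has_derivative W') (at z)"
  shows "((\<lambda>z. local_tensor M c h (P z) (U z) (W z)) has_derivative
    (\<lambda>a. fderiv (\<lambda>y. local_tensor M c h y (U z) (W z)) (coords M c q) (P' a)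
      + local_tensor M c h (coords M c q) (U' a) (W z)
      + local_tensor M c h (coords M c q) (U z) (W' a))) (at z)"
proof -
  note cM = charts_atD[OF c]
  have "((\<lambda>p. local_tensor M c h (fst p) (fst (snd p)) (snd (snd p))) has_derivative
    (\<lambda>a. fderiv (\<lambda>y. local_tensor M c h y (U z) (W z)) (coords M c q) (fst a)
      + local_tensor M c h (coords M c q) (fst (snd a)) (W z)
      + local_tensor M c h (coords M c q) (U z) (snd (snd a)))) (at (P z, U z, W z))"
    unfolding Pz
    by (rule has_derivative_bilinear_family[OF open_image[OF cM] coords_in_image[OF c]])
       (use bilinear_local_tensor[OF h cM] smooth_on_differentiable[OF local_tensor_smooth[OF h cM]
          open_image[OF cM] coords_in_image[OF c]] in auto)
  from has_derivative_compose[OF has_derivative_Pair[OF P has_derivative_Pair[OF U W]] this]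
  show ?thesis by simp
qed

text \<open>A function \<open>F\<close> on the bundle reads \<open>z \<mapsto> F(s)\<close> in a chart; these facts evaluate \<open>F\<close> there.\<close>

lemma inv_coords_tb:
  assumes c: "c \<in> charts M" and z: "z \<in> coords M c ` chart_dom M c \<times> UNIV" and s: "s = inv_coords TB c z"
  shows "snd s \<in> tspace M (fst s)" "fst s = inv_coords M c (fst z)" "c \<in> charts_at M (fst s)"
    "coords M c (fst s) = fst z" "snd s c = snd z"
proof -
  obtain x u where zz: "z = (x, u)" and x: "x \<in> coords M c ` chart_dom M c" using z by auto
  note i = inv_coords_charts_at_self[OF c x]
  show "snd s \<in> tspace M (fst s)" "fst s = inv_coords M c (fst z)" "c \<in> charts_at M (fst s)"
    "coords M c (fst s) = fst z" "snd s c = snd z"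
    using i coord_vec_tspace[OF i(1)] coord_vec_self[OF i(1)] by (simp_all add: s zz tb_inv_coords[OF c x])
qed

lemma smooth_fun_base: 
  assumes f: "smooth_fun M f" shows "smooth_fun TB (\<lambda>s. f (fst s))"
  unfolding smooth_fun_def
proof
  fix c assume "c \<in> charts TB"
  then have c: "c \<in> charts M" by (simp add: tangent_bundle_simps)
  let ?S = "coords M c ` chart_dom M c"
  note S = open_image_Times[OF c]
  show "smooth_on (\<lambda>z. f (fst (inv_coords TB c z))) (coords TB c ` chart_dom TB c)"
    unfolding tb_image[OF c]
  proof (rule smooth_on_cong[OF S])
    show "smooth_on (\<lambda>z. f (inv_coords M c (fst z))) (?S \<times> (UNIV :: 'e set))"
      using f c unfolding smooth_fun_def
      by (intro smooth_on_compose_linear[OF bounded_linear_fst open_image[OF c] S]) auto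
  qed (simp add: inv_coords_tb(2)[OF c _ refl])
qed

lemma smooth_fun_tensor_fields:
  assumes h: "symmetric_tensor_field M h" and X: "vector_field M X" and Y: "vector_field M Y"
  shows "smooth_fun M (\<lambda>q. h q (X q) (Y q))"
  unfolding smooth_fun_def
proof
  fix c assume c: "c \<in> charts M"
  let ?S = "coords M c ` chart_dom M c"
  show "smooth_on (\<lambda>x. h (inv_coords M c x) (X (inv_coords M c x)) (Y (inv_coords M c x))) ?S"
  proof (rule smooth_on_cong[OF open_image[OF c]])
    show "smooth_on (\<lambda>x. local_tensor M c h x (local_rep M c X x) (local_rep M c Y x)) ?S"
      by (rule local_tensor_smooth_fields[OF h c open_image[OF c] bounded_linear_ident])
         (auto intro: local_rep_smooth[OF X c] local_rep_smooth[OF Y c])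
    show "local_tensor M c h x (local_rep M c X x) (local_rep M c Y x) =
      h (inv_coords M c x) (X (inv_coords M c x)) (Y (inv_coords M c x))" if "x \<in> ?S" for x
    proof -
      note i = inv_coords_charts_at_self[OF c that]
      note t = vector_field_tspace[OF X charts_at_points[OF i(1)]] vector_field_tspace[OF Y charts_at_points[OF i(1)]]
      show ?thesis using tensor_local[OF i(1) t, of h] by (simp add: i(2) local_rep_def)
    qed
  qed
qed

lemma momentum_in_chart:
  assumes X: "vector_field M X" and c: "c \<in> charts M" and z: "z \<in> coords M c ` chart_dom M c \<times> UNIV"
    and s: "s = inv_coords TB c z"
  shows "h (fst s) (snd s) (X (fst s)) = local_tensor M c h (fst z) (snd z) (local_rep M c X (fst z))"
proof -
  note i = inv_coords_tb[OF c z s]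
  show ?thesis
    using tensor_local[OF i(3) i(1) vector_field_tspace[OF X charts_at_points[OF i(3)]], of h]
    unfolding i(4,5) by (simp add: i(2) local_rep_def)
qed

lemma kinetic_in_chart:
  assumes c: "c \<in> charts M" and z: "z \<in> coords M c ` chart_dom M c \<times> UNIV"
    and s: "s = inv_coords TB c z"
  shows "kinetic_lagrangian h s = local_tensor M c h (fst z) (snd z) (snd z) / 2"
proof -
  note i = inv_coords_tb[OF c z s]
  show ?thesis
    using tensor_local[OF i(3) i(1) i(1), of h]
    unfolding i(4,5) by (simp add: kinetic_lagrangian_def case_prod_unfold)
qed

text \<open>The function is the momentum in the direction \<open>X\<close>, that is \<open>X\<^sup>V(L)\<close> for the kinetic energy \<open>L\<close> of \<open>h\<close>.\<close>

lemma smooth_fun_momentum: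
  assumes h: "symmetric_tensor_field M h" and X: "vector_field M X"
  shows "smooth_fun TB (\<lambda>s. h (fst s) (snd s) (X (fst s)))"
  unfolding smooth_fun_def
proof
  fix c assume "c \<in> charts TB"
  then have c: "c \<in> charts M" by (simp add: tangent_bundle_simps)
  let ?S = "coords M c ` chart_dom M c"
  note S = open_image_Times[OF c]
  show "smooth_on (\<lambda>z. h (fst (inv_coords TB c z)) (snd (inv_coords TB c z)) (X (fst (inv_coords TB c z))))
     (coords TB c ` chart_dom TB c)"
    unfolding tb_image[OF c]
  proof (rule smooth_on_cong[OF S])
    show "smooth_on (\<lambda>z. local_tensor M c h (fst z) (snd z) (local_rep M c X (fst z))) (?S \<times> (UNIV :: 'e set))"
      by (intro local_tensor_smooth_fields[OF h c S] bounded_linear_fst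
          smooth_on_bounded_linear[OF bounded_linear_snd S]
          smooth_on_compose_linear[OF bounded_linear_fst open_image[OF c] S _ local_rep_smooth[OF X c]]) auto
  qed (simp add: momentum_in_chart[OF X c _ refl])
qed

lemma smooth_fun_kinetic:
  assumes h: "symmetric_tensor_field M h"
  shows "smooth_fun TB (kinetic_lagrangian h)"
  unfolding smooth_fun_def
proof
  fix c assume "c \<in> charts TB"
  then have c: "c \<in> charts M" by (simp add: tangent_bundle_simps)
  let ?S = "coords M c ` chart_dom M c"
  note S = open_image_Times[OF c]
  show "smooth_on (\<lambda>z. kinetic_lagrangian h (inv_coords TB c z)) (coords TB c ` chart_dom TB c)"
    unfolding tb_image[OF c]
  proof (rule smooth_on_cong[OF S])
    have "smooth_on (\<lambda>z. local_tensor M c h (fst z) (snd z) (snd z)) (?S \<times> (UNIV :: 'e set))"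
      by (intro local_tensor_smooth_fields[OF h c S] bounded_linear_fst
          smooth_on_bounded_linear[OF bounded_linear_snd S]) auto
    from smooth_on_mult[OF S this smooth_on_const[OF S]]
    show "smooth_on (\<lambda>z. local_tensor M c h (fst z) (snd z) (snd z) * (1/2)) (?S \<times> (UNIV :: 'e set))" .
  qed (simp add: kinetic_in_chart[OF c _ refl])
qed

lemma tderiv_cong:
  assumes p: "p \<in> points M" and e: "\<And>s. s \<in> points M \<Longrightarrow> f s = f' s"
  shows "tderiv M p w f = tderiv M p w f'"
proof -
  define c where "c = (SOME c. c \<in> charts_at M p)"
  have c: "c \<in> charts_at M p" unfolding c_def by (rule someI_ex[OF charts_at_ex[OF p]])
  then have cM: "c \<in> charts M" by (simp add: charts_at_iff)
  have "fderiv (\<lambda>x. f (inv_coords M c x)) (coords M c p) = fderiv (\<lambda>x. f' (inv_coords M c x)) (coords M c p)"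
    by (rule fderiv_cong[OF open_image[OF cM] coords_in_image[OF c]])
       (use e inv_coords_charts_at_self(1)[OF cM] charts_at_points in blast)
  then show ?thesis by (simp add: tderiv_def c_def[symmetric])
qed

lemma tderiv_momentum:
  assumes h: "symmetric_tensor_field M h" and X: "vector_field M X"
    and c: "c \<in> charts_at M q" and v: "v \<in> tspace M q" and w: "w \<in> tspace TB (q, v)"
  shows "tderiv TB (q, v) w (\<lambda>s. h (fst s) (snd s) (X (fst s))) =
    fderiv (\<lambda>y. local_tensor M c h y (v c) (X q c)) (coords M c q) (fst (w c))
    + local_tensor M c h (coords M c q) (snd (w c)) (X q c)
    + local_tensor M c h (coords M c q) (v c) (fderiv (local_rep M c X) (coords M c q) (fst (w c)))"
proof -
  interpret T: smooth_atlas TB by (rule tangent_bundle_atlas)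
  note cM = charts_atD[OF c]
  have ct: "c \<in> charts_at TB (q, v)" using c v by (simp add: tb_charts_at_iff)
  let ?z = "(coords M c q, v c)"
  note S = open_image_Times[OF cM]
  have R: "((\<lambda>z. local_rep M c X (fst z)) has_derivative
     (\<lambda>a. fderiv (local_rep M c X) (coords M c q) (fst a))) (at ?z)"
    by (rule has_derivative_compose[OF bounded_linear_imp_has_derivative[OF bounded_linear_fst]])
       (simp only: fst_conv local_rep_has_derivative[OF X c])
  have "tderiv TB (q, v) w (\<lambda>s. h (fst s) (snd s) (X (fst s))) =
    fderiv (\<lambda>z. h (fst (inv_coords TB c z)) (snd (inv_coords TB c z)) (X (fst (inv_coords TB c z)))) ?z (w c)"
    using T.tderiv_chart[OF smooth_fun_momentum[OF h X] w ct] by (simp add: tangent_bundle_simps)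
  also have "fderiv (\<lambda>z. h (fst (inv_coords TB c z)) (snd (inv_coords TB c z)) (X (fst (inv_coords TB c z)))) ?z
    = fderiv (\<lambda>z. local_tensor M c h (fst z) (snd z) (local_rep M c X (fst z))) ?z"
    by (rule fderiv_cong[OF S]) (use coords_in_image[OF c] momentum_in_chart[OF X cM _ refl] in auto)
  also have "\<dots> = (\<lambda>a. fderiv (\<lambda>y. local_tensor M c h y (snd ?z) (local_rep M c X (fst ?z))) (coords M c q) (fst a)
      + local_tensor M c h (coords M c q) (snd a) (local_rep M c X (fst ?z))
      + local_tensor M c h (coords M c q) (snd ?z) (fderiv (local_rep M c X) (coords M c q) (fst a)))"
    by (rule fderiv_eqI[OF local_tensor_has_derivative[OF h c
          bounded_linear_imp_has_derivative[OF bounded_linear_fst] _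
          bounded_linear_imp_has_derivative[OF bounded_linear_snd] R]]) simp
  finally show ?thesis by (simp add: local_rep_at[OF c])
qed

lemma tderiv_kinetic:
  assumes h: "symmetric_tensor_field M h"
    and c: "c \<in> charts_at M q" and v: "v \<in> tspace M q" and w: "w \<in> tspace TB (q, v)"
  shows "tderiv TB (q, v) w (kinetic_lagrangian h) =
    fderiv (\<lambda>y. local_tensor M c h y (v c) (v c)) (coords M c q) (fst (w c)) / 2
    + local_tensor M c h (coords M c q) (v c) (snd (w c))"
proof -
  interpret T: smooth_atlas TB by (rule tangent_bundle_atlas)
  note cM = charts_atD[OF c]
  have ct: "c \<in> charts_at TB (q, v)" using c v by (simp add: tb_charts_at_iff)
  let ?z = "(coords M c q, v c)"
  note S = open_image_Times[OF cM]
  have "tderiv TB (q, v) w (kinetic_lagrangian h) =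
    fderiv (\<lambda>z. kinetic_lagrangian h (inv_coords TB c z)) ?z (w c)"
    using T.tderiv_chart[OF smooth_fun_kinetic[OF h] w ct] by (simp add: tangent_bundle_simps)
  also have "fderiv (\<lambda>z. kinetic_lagrangian h (inv_coords TB c z)) ?z
    = fderiv (\<lambda>z. local_tensor M c h (fst z) (snd z) (snd z) / 2) ?z"
    by (rule fderiv_cong[OF S]) (use coords_in_image[OF c] kinetic_in_chart[OF cM _ refl] in auto)
  also have "\<dots> = (\<lambda>a. (fderiv (\<lambda>y. local_tensor M c h y (snd ?z) (snd ?z)) (coords M c q) (fst a)
      + local_tensor M c h (coords M c q) (snd a) (snd ?z)
      + local_tensor M c h (coords M c q) (snd ?z) (snd a)) / 2)"
    by (rule fderiv_eqI[OF bounded_linear.has_derivative[OF bounded_linear_divide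
          local_tensor_has_derivative[OF h c
          bounded_linear_imp_has_derivative[OF bounded_linear_fst] _
          bounded_linear_imp_has_derivative[OF bounded_linear_snd]
          bounded_linear_imp_has_derivative[OF bounded_linear_snd]]]]) simp
  finally show ?thesis
    by (simp add: local_tensor_sym[OF h cM coords_in_image[OF c], of "snd (w c)"] add_divide_distrib)
qed

text \<open>The fibre derivative of the quadratic function \<open>h(v, v)/2\<close> along \<open>X\<close> is \<open>h(v, X)\<close>.\<close>

lemma lagrange_defect_momentum:
  assumes h: "symmetric_tensor_field M h" and X: "vector_field M X" and p: "p \<in> points TB"
  shows "lagrange_defect M (kinetic_lagrangian h) Z X p =
    tderiv TB p (Z p) (\<lambda>s. h (fst s) (snd s) (X (fst s)))
    - tderiv TB p (complete_lift M X p) (kinetic_lagrangian h)"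
proof -
  interpret T: smooth_atlas TB by (rule tangent_bundle_atlas)
  have "tderiv TB s (vertical_lift M X s) (kinetic_lagrangian h) = h (fst s) (snd s) (X (fst s))"
    if s: "s \<in> points TB" for s
  proof -
    obtain p u where su: "s = (p, u)" by fastforce
    have p: "p \<in> points M" and u: "u \<in> tspace M p" using s by (auto simp: su tb_points_iff)
    obtain d where d: "d \<in> charts_at M p" using charts_at_ex[OF p] by blast
    note dM = charts_atD[OF d]
    note Xp = vector_field_tspace[OF X p]
    have "linear (fderiv (\<lambda>y. local_tensor M d h y (u d) (u d)) (coords M d p))"
      by (rule linear_frechet_derivative[OF smooth_on_differentiable[OF local_tensor_smooth[OF h dM]
            open_image[OF dM] coords_in_image[OF d]]])
    then show ?thesis
      using tderiv_kinetic[OF h d u vertical_lift_tspace[of X, OF Xp u]] d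
      by (simp add: su vertical_lift_def linear_0 tensor_local[OF d u Xp, of h])
  qed
  then show ?thesis unfolding lagrange_defect_def by (subst T.tderiv_cong[OF p]) auto
qed

text \<open>The Euler-Lagrange expression of the kinetic energy of \<open>h\<close> at position \<open>x\<close>, velocity \<open>u\<close> and
  acceleration \<open>b\<close>, paired with \<open>w\<close>.\<close>

definition euler_form :: "'c \<Rightarrow> ('p, 'c, 'e) tensor2 \<Rightarrow> 'e \<Rightarrow> 'e \<Rightarrow> 'e \<Rightarrow> 'e \<Rightarrow> real" where
  "euler_form c h x u b w = fderiv (\<lambda>y. local_tensor M c h y u w) x u + local_tensor M c h x b w
    - fderiv (\<lambda>y. local_tensor M c h y u u) x w / 2"

text \<open>The derivative of \<open>X\<close> occurs in \<open>Z(X\<^sup>V(L))\<close> along the base component of \<open>Z\<close> and in \<open>X\<^sup>C(L)\<close> along the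
  velocity. These agree for a second-order field, and the two terms cancel.\<close>

lemma lagrange_defect_chart:
  assumes h: "symmetric_tensor_field M h" and X: "vector_field M X"
    and c: "c \<in> charts_at M q" and v: "v \<in> tspace M q" and Z: "Z (q, v) \<in> tspace TB (q, v)"
    and sode: "fst (Z (q, v) c) = v c"
  shows "lagrange_defect M (kinetic_lagrangian h) Z X (q, v) =
    euler_form c h (coords M c q) (v c) (snd (Z (q, v) c)) (X q c)"
proof -
  have q: "q \<in> points M" by (rule charts_at_points[OF c])
  have qv: "(q, v) \<in> points TB" using q v by (simp add: tb_points_iff)
  show ?thesis
    using c tderiv_momentum[OF h X c v Z] tderiv_kinetic[OF h c v complete_lift_tspace[OF X q v]]
    by (simp add: lagrange_defect_momentum[OF h X qv] sode complete_lift_def euler_form_def)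
qed

end

section \<open>Linear systems with smooth coefficients\<close>

lemma positive_system_unique:
  fixes a :: "'i \<Rightarrow> 'i \<Rightarrow> real"
  assumes pd: "\<And>t. \<exists>\<alpha>\<in>I. t \<alpha> \<noteq> 0 \<Longrightarrow> 0 < (\<Sum>\<alpha>\<in>I. \<Sum>\<beta>\<in>I. t \<alpha> * t \<beta> * a \<alpha> \<beta>)"
    and eq: "\<And>\<alpha>. \<alpha> \<in> I \<Longrightarrow> (\<Sum>\<beta>\<in>I. a \<alpha> \<beta> * x \<beta>) = (\<Sum>\<beta>\<in>I. a \<alpha> \<beta> * y \<beta>)"
    and "\<alpha> \<in> I"
  shows "x \<alpha> = y \<alpha>"
proof (rule ccontr)
  assume "x \<alpha> \<noteq> y \<alpha>"
  then have "\<exists>\<alpha>\<in>I. x \<alpha> - y \<alpha> \<noteq> 0" using assms(3) by auto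
  from pd[OF this] have "0 < (\<Sum>\<alpha>\<in>I. \<Sum>\<beta>\<in>I. (x \<alpha> - y \<alpha>) * (x \<beta> - y \<beta>) * a \<alpha> \<beta>)" .
  also have "\<dots> = (\<Sum>\<alpha>\<in>I. (x \<alpha> - y \<alpha>) * ((\<Sum>\<beta>\<in>I. a \<alpha> \<beta> * x \<beta>) - (\<Sum>\<beta>\<in>I. a \<alpha> \<beta> * y \<beta>)))"
    by (simp add: sum_distrib_left sum_subtractf[symmetric] algebra_simps)
  also have "\<dots> = 0" using eq by simp
  finally show False by simp
qed

context smooth_atlas
begin

text \<open>Gaussian elimination. The pivot is positive, hence invertible among the smooth functions, and the
  Schur complement of the pivot is again positive definite. Solving in the ring of smooth functions
  makes smoothness of the solution automatic.\<close>

lemma smooth_positive_system_solution: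
  assumes "finite I"
    and "\<And>\<alpha> \<beta>. \<alpha> \<in> I \<Longrightarrow> \<beta> \<in> I \<Longrightarrow> smooth_fun M (A \<alpha> \<beta>)"
    and "\<And>\<alpha>. \<alpha> \<in> I \<Longrightarrow> smooth_fun M (b \<alpha>)"
    and "\<And>p \<alpha> \<beta>. p \<in> points M \<Longrightarrow> \<alpha> \<in> I \<Longrightarrow> \<beta> \<in> I \<Longrightarrow> A \<alpha> \<beta> p = A \<beta> \<alpha> p"
    and "\<And>p t. p \<in> points M \<Longrightarrow> \<exists>\<alpha>\<in>I. t \<alpha> \<noteq> 0 \<Longrightarrow> 0 < (\<Sum>\<alpha>\<in>I. \<Sum>\<beta>\<in>I. t \<alpha> * t \<beta> * A \<alpha> \<beta> p)"
  shows "\<exists>x. (\<forall>\<alpha>\<in>I. smooth_fun M (x \<alpha>)) \<and>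
    (\<forall>p\<in>points M. \<forall>\<alpha>\<in>I. (\<Sum>\<beta>\<in>I. A \<alpha> \<beta> p * x \<beta> p) = b \<alpha> p)"
  using assms
proof (induction I arbitrary: A b rule: finite_induct)
  case empty
  show ?case by simp
next
  case (insert j I)
  note sA = insert.prems(1) and sb = insert.prems(2) and sym = insert.prems(3) and pd = insert.prems(4)
  have pos: "A j j p > 0" if p: "p \<in> points M" for p
  proof -
    let ?t = "\<lambda>\<alpha>. if \<alpha> = j then 1 else 0 :: real"
    have z: "?t \<alpha> = 0" if "\<alpha> \<in> I" for \<alpha> using that insert.hyps by auto
    have "0 < (\<Sum>\<alpha>\<in>insert j I. \<Sum>\<beta>\<in>insert j I. ?t \<alpha> * ?t \<beta> * A \<alpha> \<beta> p)" by (rule pd[OF p]) auto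
    also have "\<dots> = A j j p" using insert.hyps z by simp
    finally show ?thesis .
  qed
  define k where "k p = inverse (A j j p)" for p
  have kP: "k p * A j j p = 1" if "p \<in> points M" for p using pos[OF that] by (simp add: k_def)
  have sk: "smooth_fun M k"
    unfolding k_def using pos sA by (intro smooth_fun_inverse) (auto simp: less_imp_neq[symmetric])
  \<comment> \<open>the Schur complement of the pivot, and the right-hand side after eliminating the unknown \<open>j\<close>\<close>
  define A' where "A' \<alpha> \<beta> p = A \<alpha> \<beta> p - A \<alpha> j p * k p * A j \<beta> p" for \<alpha> \<beta> p
  define b' where "b' \<alpha> p = b \<alpha> p - A \<alpha> j p * k p * b j p" for \<alpha> p
  have "\<exists>x. (\<forall>\<alpha>\<in>I. smooth_fun M (x \<alpha>)) \<and>
    (\<forall>p\<in>points M. \<forall>\<alpha>\<in>I. (\<Sum>\<beta>\<in>I. A' \<alpha> \<beta> p * x \<beta> p) = b' \<alpha> p)"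
  proof (rule insert.IH)
    show "smooth_fun M (A' \<alpha> \<beta>)" if "\<alpha> \<in> I" "\<beta> \<in> I" for \<alpha> \<beta>
      unfolding A'_def using that by (intro smooth_fun_diff smooth_fun_mult sk sA) auto
    show "smooth_fun M (b' \<alpha>)" if "\<alpha> \<in> I" for \<alpha>
      unfolding b'_def using that by (intro smooth_fun_diff smooth_fun_mult sk sA sb) auto
    show "A' \<alpha> \<beta> p = A' \<beta> \<alpha> p" if "p \<in> points M" "\<alpha> \<in> I" "\<beta> \<in> I" for p \<alpha> \<beta>
      unfolding A'_def using sym[OF that(1), of \<alpha> \<beta>] sym[OF that(1), of \<alpha> j] sym[OF that(1), of \<beta> j] that by simp
    show "0 < (\<Sum>\<alpha>\<in>I. \<Sum>\<beta>\<in>I. t \<alpha> * t \<beta> * A' \<alpha> \<beta> p)"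
      if p: "p \<in> points M" and nz: "\<exists>\<alpha>\<in>I. t \<alpha> \<noteq> 0" for p t
    proof -
      define s where "s = (\<Sum>\<beta>\<in>I. t \<beta> * A j \<beta> p)"
      define S where "S = (\<Sum>\<alpha>\<in>I. \<Sum>\<beta>\<in>I. t \<alpha> * t \<beta> * A \<alpha> \<beta> p)"
      \<comment> \<open>this value at \<open>j\<close> minimises the full quadratic form, and the minimum is the reduced form\<close>
      define t' where "t' \<alpha> = (if \<alpha> = j then - (k p * s) else t \<alpha>)" for \<alpha>
      have t': "t' \<alpha> = t \<alpha>" if "\<alpha> \<in> I" for \<alpha> using that insert.hyps by (auto simp: t'_def)
      have tj: "t' j = - (k p * s)" by (simp add: t'_def)
      have s': "(\<Sum>\<alpha>\<in>I. t \<alpha> * A \<alpha> j p) = s"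
        unfolding s_def using sym[OF p] by (intro sum.cong) auto
      have "\<exists>\<alpha>\<in>insert j I. t' \<alpha> \<noteq> 0" using nz t' by auto
      from pd[OF p this] have "0 < (\<Sum>\<alpha>\<in>insert j I. \<Sum>\<beta>\<in>insert j I. t' \<alpha> * t' \<beta> * A \<alpha> \<beta> p)" .
      also have "\<dots> = t' j * t' j * A j j p + (\<Sum>\<beta>\<in>I. t' j * t \<beta> * A j \<beta> p)
          + (\<Sum>\<alpha>\<in>I. t \<alpha> * t' j * A \<alpha> j p) + S"
        using insert.hyps by (simp add: t' sum.distrib S_def)
      also have "(\<Sum>\<beta>\<in>I. t' j * t \<beta> * A j \<beta> p) = t' j * s"
        by (simp add: s_def sum_distrib_left mult.assoc)
      also have "(\<Sum>\<alpha>\<in>I. t \<alpha> * t' j * A \<alpha> j p) = t' j * s"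
        unfolding s'[symmetric] by (simp add: sum_distrib_left mult_ac)
      also have "t' j * t' j * A j j p = k p * s * s"
        using kP[OF p] by (simp add: tj)
      also have "k p * s * s + t' j * s + t' j * s + S = S - s * k p * s" by (simp add: tj mult_ac)
      also have "\<dots> = (\<Sum>\<alpha>\<in>I. \<Sum>\<beta>\<in>I. t \<alpha> * t \<beta> * A' \<alpha> \<beta> p)"
      proof -
        have "s * k p * s = (\<Sum>\<alpha>\<in>I. t \<alpha> * A \<alpha> j p) * k p * (\<Sum>\<beta>\<in>I. t \<beta> * A j \<beta> p)"
          by (simp only: s' s_def)
        also have "\<dots> = (\<Sum>\<alpha>\<in>I. \<Sum>\<beta>\<in>I. t \<alpha> * t \<beta> * (A \<alpha> j p * k p * A j \<beta> p))"
          by (simp add: sum_distrib_left sum_distrib_right mult_ac)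
        finally show ?thesis
          by (simp add: S_def A'_def right_diff_distrib sum_subtractf)
      qed
      finally show ?thesis .
    qed
  qed
  then obtain x where sx: "\<And>\<alpha>. \<alpha> \<in> I \<Longrightarrow> smooth_fun M (x \<alpha>)"
    and x: "\<And>p \<alpha>. p \<in> points M \<Longrightarrow> \<alpha> \<in> I \<Longrightarrow> (\<Sum>\<beta>\<in>I. A' \<alpha> \<beta> p * x \<beta> p) = b' \<alpha> p"
    by blast
  define xj where "xj p = k p * (b j p - (\<Sum>\<beta>\<in>I. A j \<beta> p * x \<beta> p))" for p
  define x' where "x' \<alpha> = (if \<alpha> = j then xj else x \<alpha>)" for \<alpha>
  have x'I: "x' \<alpha> = x \<alpha>" if "\<alpha> \<in> I" for \<alpha> using that insert.hyps by (auto simp: x'_def)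
  have sxj: "smooth_fun M xj"
    unfolding xj_def using sx sA sb by (intro smooth_fun_mult smooth_fun_diff smooth_fun_sum sk) auto
  have "smooth_fun M (x' \<alpha>)" if "\<alpha> \<in> insert j I" for \<alpha> using that sx sxj by (auto simp: x'_def)
  moreover have "(\<Sum>\<beta>\<in>insert j I. A \<alpha> \<beta> p * x' \<beta> p) = b \<alpha> p"
    if p: "p \<in> points M" and \<alpha>: "\<alpha> \<in> insert j I" for p \<alpha>
  proof -
    have e: "(\<Sum>\<beta>\<in>insert j I. A \<alpha> \<beta> p * x' \<beta> p) = A \<alpha> j p * xj p + (\<Sum>\<beta>\<in>I. A \<alpha> \<beta> p * x \<beta> p)"
      using insert.hyps by (simp add: x'I) (simp add: x'_def)
    show ?thesis
    proof (cases "\<alpha> = j")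
      case True
      then show ?thesis unfolding e xj_def using kP[OF p] by (simp add: mult.assoc[symmetric] mult.commute)
    next
      case False
      then have \<alpha>: "\<alpha> \<in> I" using \<alpha> by simp
      have "(\<Sum>\<beta>\<in>I. A' \<alpha> \<beta> p * x \<beta> p)
          = (\<Sum>\<beta>\<in>I. A \<alpha> \<beta> p * x \<beta> p) - A \<alpha> j p * k p * (\<Sum>\<beta>\<in>I. A j \<beta> p * x \<beta> p)"
        by (simp add: A'_def algebra_simps sum_subtractf sum_distrib_left)
      then show ?thesis unfolding e xj_def using x[OF p \<alpha>] by (simp add: b'_def algebra_simps)
    qed
  qed
  ultimately show ?case by blast
qed

section \<open>Derivations, lifts and the geodesic equation\<close>

lemma tderiv_sum:
  assumes F: "smooth_fun M F" and p: "p \<in> points M" and V: "\<And>i. i \<in> I \<Longrightarrow> V i \<in> tspace M p"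
  shows "tderiv M p (\<lambda>c. \<Sum>i\<in>I. V i c) F = (\<Sum>i\<in>I. tderiv M p (V i) F)"
proof -
  obtain c where c: "c \<in> charts_at M p" using charts_at_ex[OF p] by blast
  note l = linear_chart_derivative[OF F c]
  show ?thesis
    using V by (simp add: tderiv_chart[OF F _ c] tspace_sum linear_sum[OF l])
qed

lemma smooth_fun_tderiv:
  assumes W: "vector_field M W" and F: "smooth_fun M F"
  shows "smooth_fun M (\<lambda>p. tderiv M p (W p) F)"
  unfolding smooth_fun_def
proof
  fix c assume c: "c \<in> charts M"
  let ?S = "coords M c ` chart_dom M c"
  show "smooth_on (\<lambda>x. tderiv M (inv_coords M c x) (W (inv_coords M c x)) F) ?S"
  proof (rule smooth_on_cong[OF open_image[OF c]])
    show "smooth_on (\<lambda>x. fderiv (\<lambda>x. F (inv_coords M c x)) x (local_rep M c W x)) ?S"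
      using F c unfolding smooth_fun_def
      by (intro smooth_on_fderiv_field open_image local_rep_smooth W) auto
    show "fderiv (\<lambda>x. F (inv_coords M c x)) x (local_rep M c W x)
      = tderiv M (inv_coords M c x) (W (inv_coords M c x)) F" if "x \<in> ?S" for x
    proof -
      note i = inv_coords_charts_at_self[OF c that]
      show ?thesis
        using tderiv_chart[OF F vector_field_tspace[OF W charts_at_points[OF i(1)]] i(1)]
        by (simp add: i(2) local_rep_def)
    qed
  qed
qed

lemma tb_vector_fieldI:
  assumes W: "\<And>q v. q \<in> points M \<Longrightarrow> v \<in> tspace M q \<Longrightarrow> W (q, v) \<in> tspace TB (q, v)"
    and smooth: "\<And>c. c \<in> charts M \<Longrightarrow> smooth_on (w c) (coords M c ` chart_dom M c \<times> UNIV)"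
    and rep: "\<And>c q v. c \<in> charts_at M q \<Longrightarrow> v \<in> tspace M q \<Longrightarrow> W (q, v) c = w c (coords M c q, v c)"
  shows "vector_field TB W"
  unfolding vector_field_on_def
proof (intro conjI ballI)
  show "W p \<in> tspace TB p" if "p \<in> points TB" for p
    using that W by (cases p) (auto simp: tb_points_iff)
  fix c assume "c \<in> charts TB"
  then have c: "c \<in> charts M" by (simp add: tangent_bundle_simps)
  have "points TB \<inter> chart_dom TB c = chart_dom TB c"
    using c by (auto simp: tangent_bundle_simps points_eq)
  then have im: "coords TB c ` (points TB \<inter> chart_dom TB c) = coords M c ` chart_dom M c \<times> UNIV"
    using tb_image[OF c] by simp
  show "smooth_on (local_rep TB c W) (coords TB c ` (points TB \<inter> chart_dom TB c))"
    unfolding im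
  proof (rule smooth_on_cong[OF _ _ smooth[OF c]])
    show "open (coords M c ` chart_dom M c \<times> (UNIV :: 'e set))" by (rule open_image_Times[OF c])
    show "w c z = local_rep TB c W z" if "z \<in> coords M c ` chart_dom M c \<times> UNIV" for z
      using inv_coords_tb[OF c that refl] rep
      unfolding local_rep_def by (metis prod.collapse)
  qed
qed

lemma vector_field_complete_lift:
  assumes X: "vector_field M X" shows "vector_field TB (complete_lift M X)"
proof (rule tb_vector_fieldI)
  show "complete_lift M X (q, v) c = (\<lambda>z. (local_rep M c X (fst z), fderiv (local_rep M c X) (fst z) (snd z))) (coords M c q, v c)"
    if "c \<in> charts_at M q" for c q v
    using that by (simp add: complete_lift_def local_rep_at)
  fix c assume c: "c \<in> charts M"
  let ?S = "coords M c ` chart_dom M c"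
  note S = open_image_Times[OF c]
  have sub: "fst ` (?S \<times> (UNIV :: 'e set)) \<subseteq> ?S" by auto
  note sm = local_rep_smooth[OF X c]
  show "smooth_on (\<lambda>z. (local_rep M c X (fst z), fderiv (local_rep M c X) (fst z) (snd z))) (?S \<times> UNIV)"
  proof (rule smooth_on_cong[OF S])
    show "smooth_on (\<lambda>z. (local_rep M c X (fst z),
        \<Sum>i\<in>Basis. (snd z \<bullet> i) *\<^sub>R fderiv (local_rep M c X) (fst z) i)) (?S \<times> (UNIV :: 'e set))"
      by (intro smooth_on_Pair smooth_on_sum smooth_on_scaleR smooth_on_inner smooth_on_const
        smooth_on_bounded_linear[OF bounded_linear_snd] S
        smooth_on_compose_linear[OF bounded_linear_fst open_image[OF c] S sub] smooth_on_fderiv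
        open_image[OF c] sm)
    show "(local_rep M c X (fst z), \<Sum>i\<in>Basis. (snd z \<bullet> i) *\<^sub>R fderiv (local_rep M c X) (fst z) i)
      = (local_rep M c X (fst z), fderiv (local_rep M c X) (fst z) (snd z))" if "z \<in> ?S \<times> UNIV" for z
      using fderiv_basis_expansion[OF smooth_on_differentiable[OF sm open_image[OF c]], of "fst z" "snd z"] that
      by auto
  qed
qed (rule complete_lift_tspace[OF X])

lemma vector_field_vertical_lift:
  assumes X: "vector_field M X" shows "vector_field TB (vertical_lift M X)"
proof (rule tb_vector_fieldI)
  show "vertical_lift M X (q, v) c = (\<lambda>z. (0, local_rep M c X (fst z))) (coords M c q, v c)"
    if "c \<in> charts_at M q" for c q v
    using that by (simp add: vertical_lift_def local_rep_at)
  fix c assume c: "c \<in> charts M"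
  let ?S = "coords M c ` chart_dom M c"
  note S = open_image_Times[OF c]
  show "smooth_on (\<lambda>z. (0 :: 'e, local_rep M c X (fst z))) (?S \<times> (UNIV :: 'e set))"
    by (intro smooth_on_Pair smooth_on_const S
        smooth_on_compose_linear[OF bounded_linear_fst open_image[OF c] S _ local_rep_smooth[OF X c]]) auto
qed (rule vertical_lift_tspace[OF vector_field_tspace[OF X]])

lemma linear_euler_form:
  assumes h: "symmetric_tensor_field M h" and c: "c \<in> charts M" and x: "x \<in> coords M c ` chart_dom M c"
  shows "linear (euler_form c h x u b)"
proof -
  note S = open_image[OF c] and bl = bilinear_local_tensor[OF h c]
  have d: "((\<lambda>y. local_tensor M c h y u w) has_derivative fderiv (\<lambda>y. local_tensor M c h y u w) x) (at x)" for u w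
    by (rule has_fderiv[OF smooth_on_differentiable[OF local_tensor_smooth[OF h c] S x]])
  have l1: "linear (\<lambda>w. fderiv (\<lambda>y. local_tensor M c h y u w) x u)"
  proof (rule linearI)
    fix w w' r
    have "((\<lambda>y. local_tensor M c h y u (w + w')) has_derivative (\<lambda>a. fderiv (\<lambda>y. local_tensor M c h y u w) x a
       + fderiv (\<lambda>y. local_tensor M c h y u w') x a)) (at x)"
      by (rule has_derivative_transform_within_open[OF has_derivative_add[OF d d] S x])
         (simp add: bilinear_radd[OF bl])
    then show "fderiv (\<lambda>y. local_tensor M c h y u (w + w')) x u = fderiv (\<lambda>y. local_tensor M c h y u w) x u
       + fderiv (\<lambda>y. local_tensor M c h y u w') x u" by (simp add: fderiv_eqI)
    have "((\<lambda>y. local_tensor M c h y u (r *\<^sub>R w)) has_derivative (\<lambda>a. r * fderiv (\<lambda>y. local_tensor M c h y u w) x a)) (at x)"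
      by (rule has_derivative_transform_within_open[OF has_derivative_mult_right[OF d] S x])
         (simp add: bilinear_rmul[OF bl])
    then show "fderiv (\<lambda>y. local_tensor M c h y u (r *\<^sub>R w)) x u = r *\<^sub>R fderiv (\<lambda>y. local_tensor M c h y u w) x u"
      by (simp add: fderiv_eqI)
  qed
  have l2: "linear (local_tensor M c h x b)" using bl[OF x] unfolding bilinear_def by blast
  have l3: "linear (fderiv (\<lambda>y. local_tensor M c h y u u) x)"
    by (rule has_derivative_linear[OF d])
  show ?thesis
    by (rule linearI)
       (simp_all add: euler_form_def linear_add[OF l1] linear_add[OF l2] linear_add[OF l3]
          linear_cmul[OF l1] linear_cmul[OF l2] linear_cmul[OF l3] field_simps)
qed

lemma local_tensor_positive:
  assumes h: "riemannian_metric M h" and c: "c \<in> charts M" and x: "x \<in> coords M c ` chart_dom M c"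
    and "a \<noteq> 0"
  shows "local_tensor M c h x a a > 0"
proof -
  note i = inv_coords_charts_at_self(1)[OF c x]
  have "coord_vec M c (inv_coords M c x) a \<noteq> (\<lambda>_. 0)"
    using coord_vec_self[OF i, of a] \<open>a \<noteq> 0\<close> by metis
  then show ?thesis
    using h charts_at_points[OF i] coord_vec_tspace[OF i]
    unfolding local_tensor_def riemannian_metric_def by blast
qed

text \<open>By definition of the Christoffel symbols \<open>euler_form\<close> is \<open>w \<mapsto> h(b + \<Gamma>(u, u), w)\<close>. The vector
  \<open>\<Gamma>(u, u)\<close> exists since a positive definite form represents every linear functional.\<close>

lemma christoffel_iff:
  assumes h: "riemannian_metric M h" and c: "c \<in> charts M" and x: "x \<in> coords M c ` chart_dom M c"
  shows "b = - christoffel M c h x u u \<longleftrightarrow> (\<forall>w. euler_form c h x u b w = 0)"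
proof -
  have sh: "symmetric_tensor_field M h" using h unfolding riemannian_metric_def by blast
  note bl = bilinear_local_tensor[OF sh c x]
  let ?G = "local_tensor M c h x"
  let ?\<phi> = "\<lambda>w. (fderiv (\<lambda>y. local_tensor M c h y u w) x u + fderiv (\<lambda>y. local_tensor M c h y u w) x u
    - fderiv (\<lambda>y. local_tensor M c h y u u) x w) / 2"
  have ef: "euler_form c h x u b w = ?\<phi> w + ?G b w" for b w by (simp add: euler_form_def field_simps)
  have "?\<phi> = euler_form c h x u 0" by (rule ext) (simp only: ef bilinear_lzero[OF bl] add_0_right)
  then have l\<phi>: "linear ?\<phi>" using linear_euler_form[OF sh c x, of u 0] by metis
  have uniq: "z = z'" if "\<And>w. ?G z w = ?G z' w" for z z'
    using local_tensor_positive[OF h c x, of "z - z'"] that[of "z - z'"] by (auto simp: bilinear_lsub[OF bl])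
  \<comment> \<open>lowering an index with the form: injective by definiteness, hence onto\<close>
  let ?T = "\<lambda>z. \<Sum>i\<in>Basis. ?G z i *\<^sub>R i"
  have lT: "linear ?T"
    by (rule linearI) (simp_all add: bilinear_ladd[OF bl] bilinear_lmul[OF bl] scaleR_add_left sum.distrib scaleR_sum_right)
  have co: "?T z \<bullet> i = ?G z i" if "i \<in> Basis" for z i
    using that by (simp add: inner_sum_left inner_Basis if_distrib[of "\<lambda>r. _ * r"] cong: if_cong)
  have ext: "(\<forall>w. f w = f' w)" if "linear f" "linear f'" "\<And>i. i \<in> Basis \<Longrightarrow> f i = f' i" for f f' :: "'e \<Rightarrow> real"
    using linear_eq_stdbasis[OF that(1,2)] that(3) by metis
  have lG: "linear (?G z)" for z using bl unfolding bilinear_def by blast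
  have "inj ?T"
  proof (rule injI)
    fix z z' assume "?T z = ?T z'"
    then have "?G z i = ?G z' i" if "i \<in> Basis" for i using co[OF that] by metis
    then show "z = z'" using ext[OF lG lG] uniq by blast
  qed
  then have "surj ?T" by (rule linear_injective_imp_surjective[OF lT _ refl])
  then have "\<exists>z. (\<Sum>i\<in>Basis. ?\<phi> i *\<^sub>R i) = ?T z" by (rule surjD)
  then obtain z where z: "(\<Sum>i\<in>Basis. ?\<phi> i *\<^sub>R i) = ?T z" ..
  have Gzi: "?G z i = ?\<phi> i" if i: "i \<in> Basis" for i
  proof -
    have "?G z i = ?T z \<bullet> i" by (rule co[OF i, symmetric])
    also have "\<dots> = (\<Sum>i\<in>Basis. ?\<phi> i *\<^sub>R i) \<bullet> i" by (simp only: z)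
    also have "\<dots> = ?\<phi> i"
      using i by (simp add: inner_sum_left inner_Basis if_distrib[of "\<lambda>r. _ * r"] cong: if_cong)
    finally show ?thesis .
  qed
  have Gz: "\<forall>w. ?G z w = ?\<phi> w" by (rule ext[OF lG l\<phi> Gzi])
  have "christoffel M c h x u u = z"
    unfolding christoffel_def
  proof (rule the_equality)
    show "\<forall>w. ?G z w = ?\<phi> w" by (rule Gz)
    show "z' = z" if "\<forall>w. ?G z' w = ?\<phi> w" for z'
      by (rule uniq) (simp only: spec[OF that] spec[OF Gz])
  qed
  moreover have "(\<forall>w. euler_form c h x u b w = 0) \<longleftrightarrow> b = - z"
  proof
    assume "\<forall>w. euler_form c h x u b w = 0"
    then have 1: "?\<phi> w + ?G b w = 0" for w unfolding ef by blast
    have "?G b w = ?G (- z) w" for w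
      using 1[of w] spec[OF Gz, of w] unfolding bilinear_lneg[OF bl] by linarith
    then show "b = - z" by (rule uniq)
  next
    assume b: "b = - z"
    show "\<forall>w. euler_form c h x u b w = 0"
    proof
      show "euler_form c h x u b w = 0" for w
        using spec[OF Gz, of w] unfolding ef b bilinear_lneg[OF bl] by linarith
    qed
  qed
  ultimately show ?thesis by metis
qed

text \<open>Two extensions of the same function differ by a function vanishing on \<open>S\<close>, which \<open>w\<close> annihilates.\<close>

lemma tderiv_sub_eq:
  assumes w: "w \<in> tspace_sub M S p" and p: "p \<in> points M"
    and F: "smooth_fun M F" and e: "\<And>s. s \<in> S \<Longrightarrow> F s = f s"
  shows "tderiv_sub M S p w f = tderiv M p w F"
  unfolding tderiv_sub_def
proof (rule the_equality)
  show "\<exists>F'. smooth_fun M F' \<and> (\<forall>s\<in>S. F' s = f s) \<and> tderiv M p w F = tderiv M p w F'"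
    using F e by blast
  fix r assume "\<exists>F'. smooth_fun M F' \<and> (\<forall>s\<in>S. F' s = f s) \<and> r = tderiv M p w F'"
  then obtain F' where F': "smooth_fun M F'" "\<forall>s\<in>S. F' s = f s" "r = tderiv M p w F'" by blast
  have wt: "w \<in> tspace M p" using w unfolding tspace_sub_def by blast
  have "tderiv M p w (\<lambda>s. F' s - F s) = 0"
    using w smooth_fun_diff[OF F'(1) F] F'(2) e unfolding tspace_sub_def by auto
  then show "r = tderiv M p w F" using tderiv_diff[OF F'(1) F wt p] F'(3) by simp
qed

lemma symmetric_tensor_field_diff:
  assumes h: "symmetric_tensor_field M h" and k: "symmetric_tensor_field M k"
  shows "symmetric_tensor_field M (\<lambda>q u w. h q u w - k q u w)"
  unfolding symmetric_tensor_field_def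
proof (intro conjI ballI allI)
  fix q u v w r s assume q: "q \<in> points M" "u \<in> tspace M q" "v \<in> tspace M q" "w \<in> tspace M q"
  show "h q (\<lambda>c. r *\<^sub>R u c + s *\<^sub>R v c) w - k q (\<lambda>c. r *\<^sub>R u c + s *\<^sub>R v c) w
      = r * (h q u w - k q u w) + s * (h q v w - k q v w)"
    by (simp add: tensor_lin[OF h q] tensor_lin[OF k q] algebra_simps)
  show "h q u v - k q u v = h q v u - k q v u"
    by (simp only: tensor_sym[OF h q(1,2,3)] tensor_sym[OF k q(1,2,3)])
next
  fix c a b assume c: "c \<in> charts M"
  note S = open_image[OF c]
  have "smooth_on (\<lambda>x. local_tensor M c h x a b + - local_tensor M c k x a b) (coords M c ` chart_dom M c)"
    by (rule smooth_on_add[OF S local_tensor_smooth[OF h c]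
          smooth_on_linear_comp[OF bounded_linear_minus[OF bounded_linear_ident] S local_tensor_smooth[OF k c]]])
  then show "smooth_on (\<lambda>x. local_tensor M c (\<lambda>q u w. h q u w - k q u w) x a b) (coords M c ` chart_dom M c)"
    by (simp add: local_tensor_def)
qed

lemma tensor_lincomb2:
  assumes h: "symmetric_tensor_field M h" and q: "q \<in> points M"
    and V: "\<And>i. i \<in> I \<Longrightarrow> V i \<in> tspace M q" and W: "\<And>j. j \<in> J \<Longrightarrow> W j \<in> tspace M q"
  shows "h q (lincomb I t V) (lincomb J s W) = (\<Sum>i\<in>I. \<Sum>j\<in>J. t i * s j * h q (V i) (W j))"
proof -
  have inner: "h q (V i) (lincomb J s W) = (\<Sum>j\<in>J. s j * h q (V i) (W j))" if i: "i \<in> I" for i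
  proof -
    have "h q (V i) (lincomb J s W) = h q (lincomb J s W) (V i)"
      by (rule tensor_sym[OF h q V[OF i]]) (rule lincomb_tspace, erule W)
    also have "\<dots> = (\<Sum>j\<in>J. s j * h q (W j) (V i))"
      by (rule tensor_lincomb[OF h q V[OF i]]) (erule W)
    also have "\<dots> = (\<Sum>j\<in>J. s j * h q (V i) (W j))"
      by (rule sum.cong[OF refl]) (simp add: tensor_sym[OF h q W V[OF i]])
    finally show ?thesis .
  qed
  have "h q (lincomb I t V) (lincomb J s W) = (\<Sum>i\<in>I. t i * h q (V i) (lincomb J s W))"
    by (rule tensor_lincomb[OF h q]) (rule lincomb_tspace, erule W, erule V)
  also have "\<dots> = (\<Sum>i\<in>I. \<Sum>j\<in>J. t i * s j * h q (V i) (W j))"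
    by (rule sum.cong[OF refl]) (simp add: inner sum_distrib_left mult.assoc)
  finally show ?thesis .
qed

end

section \<open>Adapted frames and the constraint manifold\<close>

lemma lincomb_indicator:
  "finite I \<Longrightarrow> i \<in> I \<Longrightarrow> lincomb I (\<lambda>j. if j = i then 1 else 0) V = V i"
  by (rule ext) (simp add: lincomb_def if_distrib[of "\<lambda>r. r *\<^sub>R _"] cong: if_cong)

lemma lincomb_cong: "(\<And>i. i \<in> I \<Longrightarrow> t i = s i) \<Longrightarrow> lincomb I t V = lincomb I s V"
  by (rule ext) (simp add: lincomb_def)

lemma lincomb_lin:
  "lincomb I (\<lambda>i. r * t i + s * u i) V = (\<lambda>c. r *\<^sub>R lincomb I t V c + s *\<^sub>R lincomb I u V c)"
  by (rule ext) (simp add: lincomb_def scaleR_add_left sum.distrib scaleR_sum_right)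

lemma lincomb_extend:
  "finite J \<Longrightarrow> I \<subseteq> J \<Longrightarrow> lincomb I t V = lincomb J (\<lambda>i. if i \<in> I then t i else 0) V"
  by (rule ext) (auto simp: lincomb_def if_distrib[of "\<lambda>r. r *\<^sub>R _"] sum.If_cases Int_absorb1 cong: if_cong)

lemma tensor_positive:
  "riemannian_metric Q h \<Longrightarrow> q \<in> points Q \<Longrightarrow> v \<in> tspace Q q \<Longrightarrow> v \<noteq> (\<lambda>_. 0) \<Longrightarrow> 0 < h q v v"
  unfolding riemannian_metric_def by blast

lemma lagrange_defect_cong: "Z p = Z' p \<Longrightarrow> lagrange_defect Q L Z Y p = lagrange_defect Q L Z' Y p"
  by (simp add: lagrange_defect_def)

lemma frame_ofD:
  assumes "frame_of M W I X E" "p \<in> W"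
  shows "E p = range (\<lambda>t. lincomb I t (\<lambda>\<alpha>. X \<alpha> p))"
    and "lincomb I t (\<lambda>\<alpha>. X \<alpha> p) = (\<lambda>_. 0) \<Longrightarrow> \<alpha> \<in> I \<Longrightarrow> t \<alpha> = 0"
proof -
  have *: "(\<forall>t. lincomb I t (\<lambda>\<alpha>. X \<alpha> p) = (\<lambda>_. 0) \<longrightarrow> (\<forall>\<alpha>\<in>I. t \<alpha> = 0)) \<and>
      E p = range (\<lambda>t. lincomb I t (\<lambda>\<alpha>. X \<alpha> p))"
    using assms(1) unfolding frame_of_def by (elim conjE) (erule bspec[OF _ assms(2)])
  show "E p = range (\<lambda>t. lincomb I t (\<lambda>\<alpha>. X \<alpha> p))" by (rule conjunct2[OF *])
  show "t \<alpha> = 0" if z: "lincomb I t (\<lambda>\<alpha>. X \<alpha> p) = (\<lambda>_. 0)" and \<alpha>: "\<alpha> \<in> I"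
    by (rule bspec[OF mp[OF spec[OF conjunct1[OF *]] z] \<alpha>])
qed

locale nonholonomic_frame = smooth_atlas Q for Q :: "('q, 'c, 'e::euclidean_space) mfd" +
  fixes g :: "('q, 'c, 'e) tensor2" and D :: "'q \<Rightarrow> ('c \<Rightarrow> 'e) set"
    and X :: "nat \<Rightarrow> 'q \<Rightarrow> 'c \<Rightarrow> 'e" and m :: nat
  assumes riem: "riemannian_metric Q g" and adapted: "adapted_frame Q g m D X"
begin

sublocale T: smooth_atlas "tangent_bundle Q" by (rule tangent_bundle_atlas)

abbreviation "C \<equiv> constraint_mfd Q m X"
abbreviation "L \<equiv> kinetic_lagrangian g"

lemma metric_tensor: "symmetric_tensor_field Q g"
  using riem unfolding riemannian_metric_def by blast

lemma m_le: "m \<le> DIM('e)" using adapted unfolding adapted_frame_def by blast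

lemma D_index: "a \<in> {1..m} \<Longrightarrow> a \<in> {1..DIM('e)}" using m_le by auto

lemma perp_index: "i \<in> {m+1..DIM('e)} \<Longrightarrow> i \<in> {1..DIM('e)}" by auto

lemma frame_field: "\<alpha> \<in> {1..DIM('e)} \<Longrightarrow> vector_field Q (X \<alpha>)"
  using adapted unfolding adapted_frame_def frame_of_def by blast

lemma frame_tspace: "\<alpha> \<in> {1..DIM('e)} \<Longrightarrow> q \<in> points Q \<Longrightarrow> X \<alpha> q \<in> tspace Q q"
  by (rule vector_field_tspace[OF frame_field])

lemma frame_independent:
  "q \<in> points Q \<Longrightarrow> lincomb {1..DIM('e)} t (\<lambda>\<alpha>. X \<alpha> q) = (\<lambda>_. 0) \<Longrightarrow> \<alpha> \<in> {1..DIM('e)} \<Longrightarrow> t \<alpha> = 0"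
  using adapted unfolding adapted_frame_def by (elim conjE) (rule frame_ofD(2))

lemma tspace_span: "q \<in> points Q \<Longrightarrow> tspace Q q = range (\<lambda>t. lincomb {1..DIM('e)} t (\<lambda>\<alpha>. X \<alpha> q))"
  using adapted unfolding adapted_frame_def by (elim conjE) (rule frame_ofD(1))

lemma D_span: "q \<in> points Q \<Longrightarrow> D q = range (\<lambda>t. lincomb {1..m} t (\<lambda>\<alpha>. X \<alpha> q))"
  using adapted unfolding adapted_frame_def by (elim conjE) (rule frame_ofD(1))

lemma perp_span: "q \<in> points Q \<Longrightarrow>
    orthogonal_distribution Q g D q = range (\<lambda>t. lincomb {m+1..DIM('e)} t (\<lambda>\<alpha>. X \<alpha> q))"
  using adapted unfolding adapted_frame_def by (elim conjE) (rule frame_ofD(1))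

lemma frame_D: "q \<in> points Q \<Longrightarrow> a \<in> {1..m} \<Longrightarrow> X a q \<in> D q"
  unfolding D_span using lincomb_indicator[of "{1..m}" a "\<lambda>\<alpha>. X \<alpha> q"] by (metis finite_atLeastAtMost rangeI)

lemma frame_orthogonal:
  assumes q: "q \<in> points Q" and v: "v \<in> D q" and i: "i \<in> {m+1..DIM('e)}"
  shows "g q v (X i q) = 0"
proof -
  have "X i q \<in> orthogonal_distribution Q g D q"
    unfolding perp_span[OF q] using lincomb_indicator[of "{m+1..DIM('e)}" i "\<lambda>\<alpha>. X \<alpha> q"] i
    by (metis finite_atLeastAtMost rangeI)
  then show ?thesis using v unfolding orthogonal_distribution_def by blast
qed

lemma frame_coeff_unique:
  assumes q: "q \<in> points Q" and v: "v = lincomb {1..DIM('e)} t (\<lambda>\<alpha>. X \<alpha> q)"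
  shows "frame_coeff X q v = (\<lambda>\<alpha>. if \<alpha> \<in> {1..DIM('e)} then t \<alpha> else 0)"
  unfolding frame_coeff_def
proof (rule the_equality)
  have "lincomb {1..DIM('e)} (\<lambda>\<alpha>. if \<alpha> \<in> {1..DIM('e)} then t \<alpha> else 0) (\<lambda>\<alpha>. X \<alpha> q) = v"
    unfolding v by (rule lincomb_cong) simp
  then show "(\<forall>\<alpha>. \<alpha> \<notin> {1..DIM('e)} \<longrightarrow> (if \<alpha> \<in> {1..DIM('e)} then t \<alpha> else 0) = 0) \<and>
      v = lincomb {1..DIM('e)} (\<lambda>\<alpha>. if \<alpha> \<in> {1..DIM('e)} then t \<alpha> else 0) (\<lambda>\<alpha>. X \<alpha> q)" by simp
  fix s assume s: "(\<forall>\<alpha>. \<alpha> \<notin> {1..DIM('e)} \<longrightarrow> s \<alpha> = 0) \<and> v = lincomb {1..DIM('e)} s (\<lambda>\<alpha>. X \<alpha> q)"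
  have "lincomb {1..DIM('e)} (\<lambda>\<alpha>. 1 * s \<alpha> + (-1) * t \<alpha>) (\<lambda>\<alpha>. X \<alpha> q) = (\<lambda>_. 0)"
    unfolding lincomb_lin using s v by simp
  from frame_independent[OF q this] have "s \<alpha> = t \<alpha>" if "\<alpha> \<in> {1..DIM('e)}" for \<alpha> using that by simp
  then show "s = (\<lambda>\<alpha>. if \<alpha> \<in> {1..DIM('e)} then t \<alpha> else 0)" using s by (intro ext) simp
qed

lemma frame_expansion:
  assumes q: "q \<in> points Q" and v: "v \<in> tspace Q q"
  shows "v = lincomb {1..DIM('e)} (frame_coeff X q v) (\<lambda>\<alpha>. X \<alpha> q)"
proof -
  obtain t where t: "v = lincomb {1..DIM('e)} t (\<lambda>\<alpha>. X \<alpha> q)" using v unfolding tspace_span[OF q] by blast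
  show ?thesis unfolding frame_coeff_unique[OF q t] by (subst t, rule lincomb_cong) simp
qed

lemma frame_coeff_lin:
  assumes q: "q \<in> points Q" and u: "u \<in> tspace Q q" and v: "v \<in> tspace Q q" and \<alpha>: "\<alpha> \<in> {1..DIM('e)}"
  shows "frame_coeff X q (\<lambda>c. r *\<^sub>R u c + s *\<^sub>R v c) \<alpha> = r * frame_coeff X q u \<alpha> + s * frame_coeff X q v \<alpha>"
proof -
  have "(\<lambda>c. r *\<^sub>R u c + s *\<^sub>R v c)
    = lincomb {1..DIM('e)} (\<lambda>\<alpha>. r * frame_coeff X q u \<alpha> + s * frame_coeff X q v \<alpha>) (\<lambda>\<alpha>. X \<alpha> q)"
    unfolding lincomb_lin using frame_expansion[OF q u] frame_expansion[OF q v] by metis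
  from frame_coeff_unique[OF q this] show ?thesis using \<alpha> by simp
qed

lemma frame_coeff_lincomb:
  assumes q: "q \<in> points Q" and I: "I \<subseteq> {1..DIM('e)}"
  shows "frame_coeff X q (lincomb I t (\<lambda>\<alpha>. X \<alpha> q)) = (\<lambda>\<alpha>. if \<alpha> \<in> I then t \<alpha> else 0)"
proof -
  have "(\<lambda>\<alpha>. if \<alpha> \<in> {1..DIM('e)} then if \<alpha> \<in> I then t \<alpha> else 0 else 0) = (\<lambda>\<alpha>. if \<alpha> \<in> I then t \<alpha> else 0)"
    by (rule ext) (use I in auto)
  then show ?thesis
    using frame_coeff_unique[OF q lincomb_extend[OF finite_atLeastAtMost I]] by simp
qed

lemma D_subset: "{1..m} \<subseteq> {1..DIM('e)}" using D_index by blast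

lemma gram_positive:
  assumes q: "q \<in> points Q" and I: "I \<subseteq> {1..DIM('e)}" and t: "\<exists>\<alpha>\<in>I. t \<alpha> \<noteq> 0"
  shows "0 < (\<Sum>\<alpha>\<in>I. \<Sum>\<beta>\<in>I. t \<alpha> * t \<beta> * g q (X \<alpha> q) (X \<beta> q))"
proof -
  let ?v = "lincomb I t (\<lambda>\<alpha>. X \<alpha> q)"
  have V: "X \<alpha> q \<in> tspace Q q" if "\<alpha> \<in> I" for \<alpha> using that I frame_tspace[OF _ q] by blast
  have "?v \<noteq> (\<lambda>_. 0)"
  proof
    assume z: "?v = (\<lambda>_. 0)"
    then have "lincomb {1..DIM('e)} (\<lambda>i. if i \<in> I then t i else 0) (\<lambda>\<alpha>. X \<alpha> q) = (\<lambda>_. 0)"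
      using lincomb_extend[OF finite_atLeastAtMost I] by metis
    from frame_independent[OF q this] show False using t I by (metis subsetD)
  qed
  then have "0 < g q ?v ?v"
    by (rule tensor_positive[OF riem q, rotated]) (rule lincomb_tspace, erule V)
  also have "g q ?v ?v = (\<Sum>\<alpha>\<in>I. \<Sum>\<beta>\<in>I. t \<alpha> * t \<beta> * g q (X \<alpha> q) (X \<beta> q))"
    by (rule tensor_lincomb2[OF metric_tensor q]) (erule V)+
  finally show ?thesis .
qed

lemma smooth_gram:
  "symmetric_tensor_field Q h \<Longrightarrow> \<alpha> \<in> {1..DIM('e)} \<Longrightarrow> \<beta> \<in> {1..DIM('e)} \<Longrightarrow> smooth_fun Q (\<lambda>q. h q (X \<alpha> q) (X \<beta> q))"
  by (intro smooth_fun_tensor_fields frame_field)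

lemma gram_sym:
  "q \<in> points Q \<Longrightarrow> \<alpha> \<in> {1..DIM('e)} \<Longrightarrow> \<beta> \<in> {1..DIM('e)} \<Longrightarrow> g q (X \<alpha> q) (X \<beta> q) = g q (X \<beta> q) (X \<alpha> q)"
  by (rule tensor_sym[OF metric_tensor]) (auto intro: frame_tspace)

text \<open>At \<open>v\<close> the quasi-velocities solve the linear system whose matrix is the Gram matrix of the frame and
  whose right-hand side consists of the momenta \<open>g(v, X\<^sub>\<alpha>)\<close>.\<close>

lemma smooth_quasi_velocity:
  assumes \<alpha>: "\<alpha> \<in> {1..DIM('e)}" shows "smooth_fun TB (quasi_velocity X \<alpha>)"
proof -
  let ?A = "\<lambda>\<alpha> \<beta> s. g (fst s) (X \<alpha> (fst s)) (X \<beta> (fst s))"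
  have "\<exists>x. (\<forall>\<alpha>\<in>{1..DIM('e)}. smooth_fun TB (x \<alpha>)) \<and>
    (\<forall>p\<in>points TB. \<forall>\<alpha>\<in>{1..DIM('e)}. (\<Sum>\<beta>\<in>{1..DIM('e)}. ?A \<alpha> \<beta> p * x \<beta> p) = g (fst p) (snd p) (X \<alpha> (fst p)))"
  proof (rule T.smooth_positive_system_solution)
    show "smooth_fun TB (?A \<alpha> \<beta>)" if "\<alpha> \<in> {1..DIM('e)}" "\<beta> \<in> {1..DIM('e)}" for \<alpha> \<beta>
      by (rule smooth_fun_base[OF smooth_gram[OF metric_tensor that]])
    show "smooth_fun TB (\<lambda>p. g (fst p) (snd p) (X \<alpha> (fst p)))" if "\<alpha> \<in> {1..DIM('e)}" for \<alpha>
      by (rule smooth_fun_momentum[OF metric_tensor frame_field[OF that]])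
    show "?A \<alpha> \<beta> p = ?A \<beta> \<alpha> p" if "p \<in> points TB" "\<alpha> \<in> {1..DIM('e)}" "\<beta> \<in> {1..DIM('e)}" for p \<alpha> \<beta>
      using gram_sym[OF _ that(2,3)] tb_pointsD[OF that(1)] by blast
    show "0 < (\<Sum>\<alpha>\<in>{1..DIM('e)}. \<Sum>\<beta>\<in>{1..DIM('e)}. t \<alpha> * t \<beta> * ?A \<alpha> \<beta> p)"
      if "p \<in> points TB" "\<exists>\<alpha>\<in>{1..DIM('e)}. t \<alpha> \<noteq> 0" for p and t :: "nat \<Rightarrow> real"
      by (rule gram_positive[OF _ order_refl that(2)]) (use tb_pointsD[OF that(1)] in blast)
  qed simp
  then obtain x where x: "\<And>\<alpha>. \<alpha> \<in> {1..DIM('e)} \<Longrightarrow> smooth_fun TB (x \<alpha>)"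
    and e: "\<And>p \<alpha>. p \<in> points TB \<Longrightarrow> \<alpha> \<in> {1..DIM('e)} \<Longrightarrow>
      (\<Sum>\<beta>\<in>{1..DIM('e)}. ?A \<alpha> \<beta> p * x \<beta> p) = g (fst p) (snd p) (X \<alpha> (fst p))" by blast
  show ?thesis
  proof (rule T.smooth_fun_cong[OF _ x[OF \<alpha>]])
    fix p assume p: "p \<in> points TB"
    obtain q v where qv: "p = (q, v)" by fastforce
    have q: "q \<in> points Q" and v: "v \<in> tspace Q q" using p by (auto simp: qv tb_points_iff)
    show "x \<alpha> p = quasi_velocity X \<alpha> p"
    proof (rule positive_system_unique[where I = "{1..DIM('e)}" and a = "\<lambda>\<alpha> \<beta>. ?A \<alpha> \<beta> p" and x = "\<lambda>\<alpha>. x \<alpha> p"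
          and y = "\<lambda>\<alpha>. quasi_velocity X \<alpha> p", OF _ _ \<alpha>])
      show "0 < (\<Sum>\<alpha>\<in>{1..DIM('e)}. \<Sum>\<beta>\<in>{1..DIM('e)}. t \<alpha> * t \<beta> * ?A \<alpha> \<beta> p)" if "\<exists>\<alpha>\<in>{1..DIM('e)}. t \<alpha> \<noteq> 0" for t :: "nat \<Rightarrow> real"
        using gram_positive[OF q order_refl that] by (simp add: qv)
      fix \<beta> assume \<beta>: "\<beta> \<in> {1..DIM('e)}"
      have "(\<Sum>\<gamma>\<in>{1..DIM('e)}. ?A \<beta> \<gamma> p * quasi_velocity X \<gamma> p)
          = (\<Sum>\<gamma>\<in>{1..DIM('e)}. frame_coeff X q v \<gamma> * g q (X \<gamma> q) (X \<beta> q))"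
        using gram_sym[OF q \<beta>] by (intro sum.cong) (simp_all add: qv quasi_velocity_def)
      also have "\<dots> = g q (lincomb {1..DIM('e)} (frame_coeff X q v) (\<lambda>\<gamma>. X \<gamma> q)) (X \<beta> q)"
        using frame_tspace q \<beta> by (intro tensor_lincomb[OF metric_tensor q, symmetric]) auto
      also have "\<dots> = g q v (X \<beta> q)" by (simp only: frame_expansion[OF q v, symmetric])
      finally show "(\<Sum>\<gamma>\<in>{1..DIM('e)}. ?A \<beta> \<gamma> p * x \<gamma> p) = (\<Sum>\<gamma>\<in>{1..DIM('e)}. ?A \<beta> \<gamma> p * quasi_velocity X \<gamma> p)"
        using e[OF p \<beta>] by (simp add: qv)
    qed
  qed
qed

lemma C_iff: "(q, v) \<in> C \<longleftrightarrow> q \<in> points Q \<and> v \<in> tspace Q q \<and> (\<forall>i\<in>{m+1..DIM('e)}. frame_coeff X q v i = 0)"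
  by (simp add: constraint_mfd_def tb_points_iff quasi_velocity_def)

lemma C_points: "p \<in> C \<Longrightarrow> p \<in> points TB"
  by (simp add: constraint_mfd_def)

lemma C_expansion:
  assumes p: "(q, v) \<in> C"
  shows "v = lincomb {1..m} (frame_coeff X q v) (\<lambda>\<alpha>. X \<alpha> q)"
proof -
  have q: "q \<in> points Q" and v: "v \<in> tspace Q q" and z: "\<And>i. i \<in> {m+1..DIM('e)} \<Longrightarrow> frame_coeff X q v i = 0"
    using p by (auto simp: C_iff)
  have "lincomb {1..DIM('e)} (frame_coeff X q v) (\<lambda>\<alpha>. X \<alpha> q)
    = lincomb {1..DIM('e)} (\<lambda>i. if i \<in> {1..m} then frame_coeff X q v i else 0) (\<lambda>\<alpha>. X \<alpha> q)"
    using z by (intro lincomb_cong) auto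
  also have "\<dots> = lincomb {1..m} (frame_coeff X q v) (\<lambda>\<alpha>. X \<alpha> q)"
    using lincomb_extend[OF finite_atLeastAtMost D_subset] by metis
  finally show ?thesis using frame_expansion[OF q v] by metis
qed

lemma C_lincomb:
  assumes q: "q \<in> points Q"
  shows "(q, lincomb {1..m} t (\<lambda>\<alpha>. X \<alpha> q)) \<in> C"
  unfolding C_iff frame_coeff_lincomb[OF q D_subset]
  using q frame_tspace[OF D_index q] by (auto intro: lincomb_tspace)

lemma C_iff_D: "(q, v) \<in> C \<longleftrightarrow> q \<in> points Q \<and> v \<in> D q"
  using C_expansion[of q v] C_lincomb[of q] D_span[of q] by (auto simp: C_iff)

lemma tensor_on_C:
  assumes h: "symmetric_tensor_field Q h" and p: "(q, v) \<in> C" and i: "i \<in> {1..DIM('e)}"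
  shows "h q v (X i q) = theta m X h i (q, v)"
proof -
  have q: "q \<in> points Q" using p by (simp add: C_iff)
  have "h q v (X i q) = h q (lincomb {1..m} (frame_coeff X q v) (\<lambda>\<alpha>. X \<alpha> q)) (X i q)"
    using C_expansion[OF p] by metis
  also have "\<dots> = (\<Sum>a=1..m. frame_coeff X q v a * h q (X a q) (X i q))"
    using frame_tspace[OF D_index q] frame_tspace[OF i q] by (intro tensor_lincomb[OF h q]) auto
  finally show ?thesis by (simp add: theta_def quasi_velocity_def mult.commute)
qed

section \<open>The nonholonomic vector field\<close>

text \<open>The fields \<open>v\<^sup>a X\<^sub>a\<^sup>C + f\<^sup>a X\<^sub>a\<^sup>V\<close>, written as formulas on the whole tangent bundle so that functions
  obtained from them on \<open>C\<close> come with a smooth extension.\<close>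

definition lift_field :: "(nat \<Rightarrow> 'q \<times> ('c \<Rightarrow> 'e) \<Rightarrow> real) \<Rightarrow> 'q \<times> ('c \<Rightarrow> 'e) \<Rightarrow> 'c \<Rightarrow> 'e \<times> 'e" where
  "lift_field f p = (\<lambda>c. \<Sum>a=1..m. quasi_velocity X a p *\<^sub>R complete_lift Q (X a) p c
    + f a p *\<^sub>R vertical_lift Q (X a) p c)"

lemma lift_tspace:
  assumes "p \<in> points TB" "\<alpha> \<in> {1..DIM('e)}"
  shows "complete_lift Q (X \<alpha>) p \<in> tspace TB p" "vertical_lift Q (X \<alpha>) p \<in> tspace TB p"
  using T.vector_field_tspace vector_field_complete_lift[OF frame_field] vector_field_vertical_lift[OF frame_field]
    assms by blast+

lemma lift_field_tspace: "p \<in> points TB \<Longrightarrow> lift_field f p \<in> tspace TB p"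
  unfolding lift_field_def by (intro T.tspace_sum T.tspace_add T.tspace_scale lift_tspace D_index)

lemma tderiv_lift_field:
  assumes F: "smooth_fun TB F" and p: "p \<in> points TB"
  shows "tderiv TB p (lift_field f p) F = (\<Sum>a=1..m. quasi_velocity X a p * tderiv TB p (complete_lift Q (X a) p) F
    + f a p * tderiv TB p (vertical_lift Q (X a) p) F)"
proof -
  note lt = lift_tspace[OF p D_index]
  have "tderiv TB p (lift_field f p) F = (\<Sum>a=1..m. tderiv TB p (\<lambda>c. quasi_velocity X a p *\<^sub>R complete_lift Q (X a) p c
    + f a p *\<^sub>R vertical_lift Q (X a) p c) F)"
    unfolding lift_field_def by (intro T.tderiv_sum F p T.tspace_add T.tspace_scale lt)
  also have "\<dots> = (\<Sum>a=1..m. quasi_velocity X a p * tderiv TB p (complete_lift Q (X a) p) F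
    + f a p * tderiv TB p (vertical_lift Q (X a) p) F)"
    by (rule sum.cong[OF refl])
       (simp add: T.tderiv_add[OF F p T.tspace_scale T.tspace_scale] T.tderiv_scale[OF F p] lt)
  finally show ?thesis .
qed

lemma smooth_tderiv_lift_field:
  assumes F: "smooth_fun TB F" and f: "\<And>a. a \<in> {1..m} \<Longrightarrow> smooth_fun TB (f a)"
  shows "smooth_fun TB (\<lambda>p. tderiv TB p (lift_field f p) F)"
proof (rule T.smooth_fun_cong)
  show "smooth_fun TB (\<lambda>p. \<Sum>a=1..m. quasi_velocity X a p * tderiv TB p (complete_lift Q (X a) p) F
    + f a p * tderiv TB p (vertical_lift Q (X a) p) F)"
    using D_index f by (intro T.smooth_fun_sum T.smooth_fun_add T.smooth_fun_mult smooth_quasi_velocity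
        T.smooth_fun_tderiv vector_field_complete_lift vector_field_vertical_lift frame_field F)
qed (simp add: tderiv_lift_field[OF F])

lemma lift_field_chart:
  assumes p: "(q, v) \<in> C" and c: "c \<in> charts_at Q q"
  shows "lift_field f (q, v) c = (v c, (\<Sum>a=1..m. frame_coeff X q v a *\<^sub>R fderiv (local_rep Q c (X a)) (coords Q c q) (v c))
    + (\<Sum>a=1..m. f a (q, v) *\<^sub>R X a q c))"
proof -
  have "v c = lincomb {1..m} (frame_coeff X q v) (\<lambda>\<alpha>. X \<alpha> q) c" using C_expansion[OF p] by metis
  then have "(\<Sum>a=1..m. frame_coeff X q v a *\<^sub>R X a q c) = v c" by (simp add: lincomb_def)
  then show ?thesis
    using c by (simp add: lift_field_def complete_lift_def vertical_lift_def quasi_velocity_def sum_prod[symmetric] prod_eq_iff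
        fst_sum snd_sum sum.distrib)
qed

lemma coord_vec_frame:
  assumes c: "c \<in> charts Q" and x: "x \<in> coords Q c ` chart_dom Q c"
  shows "coord_vec Q c (inv_coords Q c x) (\<Sum>a=1..m. t a *\<^sub>R local_rep Q c (X a) x)
    = lincomb {1..m} t (\<lambda>\<alpha>. X \<alpha> (inv_coords Q c x))"
proof -
  note i = inv_coords_charts_at_self[OF c x]
  have iq: "inv_coords Q c x \<in> points Q" by (rule charts_at_points[OF i(1)])
  let ?w = "lincomb {1..m} t (\<lambda>\<alpha>. X \<alpha> (inv_coords Q c x))"
  have w: "?w \<in> tspace Q (inv_coords Q c x)" using C_lincomb[OF iq] by (simp add: C_iff)
  have "(\<Sum>a=1..m. t a *\<^sub>R local_rep Q c (X a) x) = ?w c"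
    by (simp add: lincomb_def local_rep_def)
  then show ?thesis using coord_vec_tvec[OF w i(1)] by (simp only:)
qed

text \<open>At \<open>v = t\<^sup>a X\<^sub>a\<close> the vector splits into the velocity of the section \<open>t\<^sup>a X\<^sub>a\<close> with constant coefficients
  \<open>t\<^sup>a\<close>, taken in the direction \<open>v\<close>, and the vertical vector \<open>f\<^sup>a X\<^sub>a\<close>. The section and the vertical line
  both stay in \<open>C\<close>, where the function is zero.\<close>

lemma lift_field_tangent:
  assumes p: "p \<in> C" shows "lift_field f p \<in> tspace_sub TB C p"
  unfolding tspace_sub_def
proof (intro CollectI conjI allI impI)
  show "lift_field f p \<in> tspace TB p" by (rule lift_field_tspace[OF C_points[OF p]])
  fix F assume "smooth_fun TB F \<and> (\<forall>s\<in>C. F s = 0)"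
  then have F: "smooth_fun TB F" and F0: "\<And>s. s \<in> C \<Longrightarrow> F s = 0" by auto
  obtain q v where qv: "p = (q, v)" by fastforce
  have pC: "(q, v) \<in> C" using p by (simp add: qv)
  have q: "q \<in> points Q" and v: "v \<in> tspace Q q" using pC by (auto simp: C_iff)
  obtain c where c: "c \<in> charts_at Q q" using charts_at_ex[OF q] by blast
  note cQ = charts_atD[OF c]
  have ct: "c \<in> charts_at TB (q, v)" using c v by (simp add: tb_charts_at_iff)
  let ?x = "coords Q c q" and ?S = "coords Q c ` chart_dom Q c"
  let ?F = "\<lambda>z. F (inv_coords TB c z)"
  note S = open_image[OF cQ] coords_in_image[OF c]
  have zero: "?F (x, \<Sum>a=1..m. t a *\<^sub>R local_rep Q c (X a) x) = 0" if x: "x \<in> ?S" for x t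
  proof -
    have "(inv_coords Q c x, lincomb {1..m} t (\<lambda>\<alpha>. X \<alpha> (inv_coords Q c x))) \<in> C"
      by (rule C_lincomb[OF charts_at_points[OF inv_coords_charts_at_self(1)[OF cQ x]]])
    then show ?thesis using F0 by (simp only: tb_inv_coords[OF cQ x] coord_vec_frame[OF cQ x])
  qed
  have dF: "(?F has_derivative fderiv ?F (?x, v c)) (at (?x, v c))"
    using has_fderiv[OF T.smooth_fun_chart_differentiable[OF F ct]] by (simp add: tangent_bundle_simps)
  have lF: "linear (fderiv ?F (?x, v c))" by (rule has_derivative_linear[OF dF])
  let ?t = "frame_coeff X q v"
  have vc: "(\<Sum>a=1..m. ?t a *\<^sub>R X a q c) = v c"
    using C_expansion[OF pC] unfolding lincomb_def by metis
  let ?U = "\<lambda>x. \<Sum>a=1..m. ?t a *\<^sub>R local_rep Q c (X a) x"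
  have Ux: "?U ?x = v c" by (simp only: local_rep_at[OF c] vc)
  have dU: "(?U has_derivative (\<lambda>a. \<Sum>b=1..m. ?t b *\<^sub>R fderiv (local_rep Q c (X b)) ?x a)) (at ?x)"
    by (intro has_derivative_sum has_derivative_scaleR_right local_rep_has_derivative frame_field D_index c)
  have "((\<lambda>x. ?F (x, ?U x)) has_derivative (\<lambda>a. fderiv ?F (?x, v c)
      (a, \<Sum>b=1..m. ?t b *\<^sub>R fderiv (local_rep Q c (X b)) ?x a))) (at ?x)"
    using has_derivative_compose[OF has_derivative_Pair[OF has_derivative_ident dU], where g = ?F] dF
    unfolding Ux by blast
  note dFU = fderiv_eqI[OF this]
  have "fderiv (\<lambda>x. ?F (x, ?U x)) ?x = fderiv (\<lambda>x. 0) ?x"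
    by (rule fderiv_cong[OF S]) (rule zero)
  then have A: "fderiv ?F (?x, v c) (a, \<Sum>b=1..m. ?t b *\<^sub>R fderiv (local_rep Q c (X b)) ?x a) = 0" for a
    unfolding dFU frechet_derivative_const by (rule fun_cong)
  let ?B = "\<Sum>b=1..m. f b (q, v) *\<^sub>R X b q c"
  have dl: "((\<lambda>s::real. (?x, v c + s *\<^sub>R ?B)) has_derivative (\<lambda>s. (0, s *\<^sub>R ?B))) (at 0)"
    by (auto intro!: derivative_eq_intros)
  have "((\<lambda>s::real. ?F (?x, v c + s *\<^sub>R ?B)) has_derivative (\<lambda>s. fderiv ?F (?x, v c) (0, s *\<^sub>R ?B))) (at 0)"
    using has_derivative_compose[OF dl, where g = ?F] dF by simp
  note dFB = fderiv_eqI[OF this]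
  have "(\<lambda>s::real. ?F (?x, v c + s *\<^sub>R ?B)) = (\<lambda>s. 0)"
  proof
    fix s :: real
    have "v c + s *\<^sub>R ?B = (\<Sum>a=1..m. (?t a + s * f a (q, v)) *\<^sub>R local_rep Q c (X a) ?x)"
      by (simp add: local_rep_at[OF c] scaleR_add_left sum.distrib vc[simplified] scaleR_sum_right)
    then show "?F (?x, v c + s *\<^sub>R ?B) = 0" using zero[OF S(2)] by (simp only:)
  qed
  then have "fderiv (\<lambda>s::real. ?F (?x, v c + s *\<^sub>R ?B)) 0 = (\<lambda>s. 0)"
    by (simp only: frechet_derivative_const)
  from fun_cong[OF this, of 1] have B: "fderiv ?F (?x, v c) (0, ?B) = 0"
    unfolding dFB by simp
  have "tderiv TB (q, v) (lift_field f (q, v)) F = fderiv ?F (?x, v c) (lift_field f (q, v) c)"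
    using T.tderiv_chart[OF F lift_field_tspace[OF C_points[OF pC]] ct] by (simp add: tangent_bundle_simps)
  also have "lift_field f (q, v) c = (v c, \<Sum>b=1..m. ?t b *\<^sub>R fderiv (local_rep Q c (X b)) ?x (v c)) + (0, ?B)"
    by (simp add: lift_field_chart[OF pC c])
  also have "fderiv ?F (?x, v c) \<dots> = 0" unfolding linear_add[OF lF] by (simp only: A B add_0)
  finally show "tderiv TB p (lift_field f p) F = 0" by (simp add: qv)
qed

lemma lift_field_vector_field_sub:
  assumes f: "\<And>a. a \<in> {1..m} \<Longrightarrow> smooth_fun TB (f a)" and Z: "\<And>p. p \<in> C \<Longrightarrow> Z p = lift_field f p"
  shows "vector_field_sub TB C Z"
  unfolding vector_field_sub_def smooth_fun_sub_def
proof (intro conjI ballI allI impI)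
  show "Z p \<in> tspace_sub TB C p" if "p \<in> C" for p using lift_field_tangent[OF that] Z[OF that] by simp
  show "\<exists>F'. smooth_fun TB F' \<and> (\<forall>p\<in>C. F' p = tderiv TB p (Z p) F)" if "smooth_fun TB F" for F
    using smooth_tderiv_lift_field[OF that f] Z by (intro exI[of _ "\<lambda>p. tderiv TB p (lift_field f p) F"]) auto
qed

lemma defect_lift_field_chart:
  assumes h: "symmetric_tensor_field Q h" and Y: "vector_field Q Y" and p: "(q, v) \<in> C" and c: "c \<in> charts_at Q q"
    and Z: "Z (q, v) = lift_field f (q, v)"
  shows "lagrange_defect Q (kinetic_lagrangian h) Z Y (q, v)
    = euler_form c h (coords Q c q) (v c) (snd (lift_field f (q, v) c)) (Y q c)"
  unfolding lagrange_defect_cong[of Z "(q, v)" "lift_field f", OF Z]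
  by (rule lagrange_defect_chart[OF h Y c])
     (use p lift_field_tspace[OF C_points[OF p]] in \<open>simp_all add: C_iff lift_field_chart[OF p c]\<close>)

text \<open>The coefficients \<open>f\<^sup>b\<close> are accelerations; they enter the Euler-Lagrange expression through the Gram
  matrix. This is the linear system that determines them.\<close>

lemma defect_lift_field:
  assumes p: "(q, v) \<in> C" and a: "\<alpha> \<in> {1..DIM('e)}"
  shows "lagrange_defect Q L (lift_field f) (X \<alpha>) (q, v) = lagrange_defect Q L (lift_field (\<lambda>_ _. 0)) (X \<alpha>) (q, v)
    + (\<Sum>b=1..m. g q (X \<alpha> q) (X b q) * f b (q, v))"
proof -
  have q: "q \<in> points Q" using p by (simp add: C_iff)
  obtain c where c: "c \<in> charts_at Q q" using charts_at_ex[OF q] by blast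
  note cQ = charts_atD[OF c]
  note bl = bilinear_local_tensor[OF metric_tensor cQ coords_in_image[OF c]]
  have l: "linear (\<lambda>b. local_tensor Q c g (coords Q c q) b (X \<alpha> q c))"
    using bl unfolding bilinear_def by blast
  have "local_tensor Q c g (coords Q c q) (X b q c) (X \<alpha> q c) = g q (X \<alpha> q) (X b q)" if "b \<in> {1..m}" for b
    using tensor_local[OF c frame_tspace[OF D_index[OF that] q] frame_tspace[OF a q], of g]
      gram_sym[OF q D_index[OF that] a] by simp
  then show ?thesis
    unfolding defect_lift_field_chart[where Z = "lift_field f" and f = f, OF metric_tensor frame_field[OF a] p c refl]
      defect_lift_field_chart[where Z = "lift_field (\<lambda>_ _. 0)" and f = "\<lambda>_ _. 0", OF metric_tensor frame_field[OF a] p c refl]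
      lift_field_chart[OF p c]
    by (simp add: euler_form_def bilinear_ladd[OF bl] linear_sum[OF l] linear_cmul[OF l] mult.commute)
qed

lemma smooth_defect:
  assumes f: "\<And>a. a \<in> {1..m} \<Longrightarrow> smooth_fun TB (f a)" and Y: "vector_field Q Y"
  shows "smooth_fun TB (\<lambda>p. lagrange_defect Q L (lift_field f) Y p)"
proof (rule T.smooth_fun_cong)
  show "smooth_fun TB (\<lambda>p. tderiv TB p (lift_field f p) (\<lambda>s. g (fst s) (snd s) (Y (fst s)))
    - tderiv TB p (complete_lift Q Y p) L)"
    by (intro T.smooth_fun_diff smooth_tderiv_lift_field f T.smooth_fun_tderiv vector_field_complete_lift Y
        smooth_fun_kinetic smooth_fun_momentum metric_tensor)
qed (simp add: lagrange_defect_momentum[OF metric_tensor Y])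

text \<open>The Euler-Lagrange expression depends linearly on the value of the field at the point.\<close>

lemma defect_section:
  assumes h: "symmetric_tensor_field Q h" and Y: "vector_field Q Y" and p: "(q, v) \<in> C"
    and Z: "Z (q, v) = lift_field f (q, v)" and I: "I \<subseteq> {1..DIM('e)}" and Yq: "Y q = lincomb I t (\<lambda>\<alpha>. X \<alpha> q)"
    and zero: "\<And>\<alpha>. \<alpha> \<in> I \<Longrightarrow> lagrange_defect Q (kinetic_lagrangian h) Z (X \<alpha>) (q, v) = 0"
  shows "lagrange_defect Q (kinetic_lagrangian h) Z Y (q, v) = 0"
proof -
  have q: "q \<in> points Q" using p by (simp add: C_iff)
  obtain c where c: "c \<in> charts_at Q q" using charts_at_ex[OF q] by blast
  note cQ = charts_atD[OF c]
  note l = linear_euler_form[OF h cQ coords_in_image[OF c]]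
  have z: "euler_form c h (coords Q c q) (v c) (snd (lift_field f (q, v) c)) (X \<alpha> q c) = 0" if "\<alpha> \<in> I" for \<alpha>
    using zero[OF that] defect_lift_field_chart[where Z = Z and f = f, OF h frame_field p c Z] that I by auto
  show ?thesis
    unfolding defect_lift_field_chart[where Z = Z and f = f, OF h Y p c Z] Yq lincomb_def
    by (simp add: linear_sum[OF l] linear_cmul[OF l] z)
qed

lemma nonholonomic_field_exists:
  obtains f where "\<And>a. a \<in> {1..m} \<Longrightarrow> smooth_fun TB (f a)"
    "\<And>p a. p \<in> C \<Longrightarrow> a \<in> {1..m} \<Longrightarrow> lagrange_defect Q L (lift_field f) (X a) p = 0"
proof -
  let ?A = "\<lambda>\<alpha> \<beta> s. g (fst s) (X \<alpha> (fst s)) (X \<beta> (fst s))"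
  have "\<exists>f. (\<forall>\<alpha>\<in>{1..m}. smooth_fun TB (f \<alpha>)) \<and>
    (\<forall>p\<in>points TB. \<forall>\<alpha>\<in>{1..m}. (\<Sum>\<beta>\<in>{1..m}. ?A \<alpha> \<beta> p * f \<beta> p)
      = - lagrange_defect Q L (lift_field (\<lambda>_ _. 0)) (X \<alpha>) p)"
  proof (rule T.smooth_positive_system_solution)
    show "smooth_fun TB (?A \<alpha> \<beta>)" if "\<alpha> \<in> {1..m}" "\<beta> \<in> {1..m}" for \<alpha> \<beta>
      by (rule smooth_fun_base[OF smooth_gram[OF metric_tensor that[THEN D_index]]])
    show "smooth_fun TB (\<lambda>p. - lagrange_defect Q L (lift_field (\<lambda>_ _. 0)) (X \<alpha>) p)" if "\<alpha> \<in> {1..m}" for \<alpha>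
      by (intro T.smooth_fun_uminus smooth_defect T.smooth_fun_const frame_field D_index that)
    show "?A \<alpha> \<beta> p = ?A \<beta> \<alpha> p" if "p \<in> points TB" "\<alpha> \<in> {1..m}" "\<beta> \<in> {1..m}" for p \<alpha> \<beta>
      using gram_sym[OF _ that(2,3)[THEN D_index]] tb_pointsD[OF that(1)] by blast
    show "0 < (\<Sum>\<alpha>\<in>{1..m}. \<Sum>\<beta>\<in>{1..m}. t \<alpha> * t \<beta> * ?A \<alpha> \<beta> p)"
      if "p \<in> points TB" "\<exists>\<alpha>\<in>{1..m}. t \<alpha> \<noteq> 0" for p and t :: "nat \<Rightarrow> real"
      by (rule gram_positive[OF _ D_subset that(2)]) (use tb_pointsD[OF that(1)] in blast)
  qed simp
  then obtain f where f: "\<And>\<alpha>. \<alpha> \<in> {1..m} \<Longrightarrow> smooth_fun TB (f \<alpha>)"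
    and e: "\<And>p \<alpha>. p \<in> points TB \<Longrightarrow> \<alpha> \<in> {1..m} \<Longrightarrow>
      (\<Sum>\<beta>\<in>{1..m}. ?A \<alpha> \<beta> p * f \<beta> p) = - lagrange_defect Q L (lift_field (\<lambda>_ _. 0)) (X \<alpha>) p" by blast
  have "lagrange_defect Q L (lift_field f) (X a) p = 0" if "p \<in> C" "a \<in> {1..m}" for p a
    using that e[OF C_points[OF that(1)] that(2)] defect_lift_field[of "fst p" "snd p" a f] D_index by simp
  with f show ?thesis using that by blast
qed

text \<open>The definite description is met: a solution exists, and any two have coefficients that solve the
  same nonsingular system.\<close>

lemma nonholonomic_field_eq:
  obtains f where "\<And>p. p \<in> C \<Longrightarrow> nonholonomic_field Q L m D X p = lift_field f p"
    "\<And>p a. p \<in> C \<Longrightarrow> a \<in> {1..m} \<Longrightarrow> lagrange_defect Q L (nonholonomic_field Q L m D X) (X a) p = 0"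
proof -
  obtain f where f: "\<And>a. a \<in> {1..m} \<Longrightarrow> smooth_fun TB (f a)"
    and f0: "\<And>p a. p \<in> C \<Longrightarrow> a \<in> {1..m} \<Longrightarrow> lagrange_defect Q L (lift_field f) (X a) p = 0"
    by (rule nonholonomic_field_exists) blast
  define Z0 where "Z0 p = (if p \<in> C then lift_field f p else (\<lambda>_. 0))" for p
  have Z0: "Z0 p = lift_field f p" if "p \<in> C" for p using that by (simp add: Z0_def)
  have Z00: "lagrange_defect Q L Z0 (X a) p = 0" if "p \<in> C" "a \<in> {1..m}" for p a
    using f0[OF that] lagrange_defect_cong[of Z0 p "lift_field f", OF Z0[OF that(1)]] by simp
  have "nonholonomic_field Q L m D X = Z0"
    unfolding nonholonomic_field_def
  proof (rule the_equality, intro conjI)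
    show "\<forall>p. p \<notin> C \<longrightarrow> Z0 p = (\<lambda>_. 0)" by (simp add: Z0_def)
    show "vector_field_sub TB C Z0" by (rule lift_field_vector_field_sub[OF f Z0])
    have "\<forall>a\<in>{1..m}. smooth_fun_sub TB C (f a)" using f unfolding smooth_fun_sub_def by blast
    then show "\<exists>f. (\<forall>a\<in>{1..m}. smooth_fun_sub TB C (f a)) \<and>
        (\<forall>p\<in>C. Z0 p = (\<lambda>c. (\<Sum>a=1..m. quasi_velocity X a p *\<^sub>R complete_lift Q (X a) p c
                    + f a p *\<^sub>R vertical_lift Q (X a) p c)))"
      using Z0 unfolding lift_field_def by blast
    show "\<forall>Y\<in>sections Q D. \<forall>p\<in>C. lagrange_defect Q L Z0 Y p = 0"
    proof (intro ballI)
      fix Y p assume Y: "Y \<in> sections Q D" and p: "p \<in> C"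
      obtain q v where qv: "p = (q, v)" by fastforce
      have pC: "(q, v) \<in> C" using p by (simp add: qv)
      then have q: "q \<in> points Q" by (simp add: C_iff)
      have "Y q \<in> D q" and Yv: "vector_field Q Y" using Y q by (auto simp: sections_def)
      then obtain t where t: "Y q = lincomb {1..m} t (\<lambda>\<alpha>. X \<alpha> q)" unfolding D_span[OF q] by blast
      show "lagrange_defect Q L Z0 Y p = 0" unfolding qv
        by (rule defect_section[OF metric_tensor Yv pC Z0[OF pC] D_subset t Z00[OF pC]])
    qed
  next
    fix Z' assume Z': "(\<forall>p. p \<notin> C \<longrightarrow> Z' p = (\<lambda>_. 0)) \<and> vector_field_sub TB C Z' \<and>
     (\<exists>f. (\<forall>a\<in>{1..m}. smooth_fun_sub TB C (f a)) \<and>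
        (\<forall>p\<in>C. Z' p = (\<lambda>c. (\<Sum>a=1..m. quasi_velocity X a p *\<^sub>R complete_lift Q (X a) p c
                    + f a p *\<^sub>R vertical_lift Q (X a) p c)))) \<and>
     (\<forall>Y\<in>sections Q D. \<forall>p\<in>C. lagrange_defect Q L Z' Y p = 0)"
    then obtain f' where f': "\<And>p. p \<in> C \<Longrightarrow> Z' p = lift_field f' p" unfolding lift_field_def by blast
    show "Z' = Z0"
    proof
      fix p
      show "Z' p = Z0 p"
      proof (cases "p \<in> C")
        case False
        then have "Z' p = (\<lambda>_. 0)" using Z' by blast
        then show ?thesis using False by (simp add: Z0_def)
      next
        case True
        obtain q v where qv: "p = (q, v)" by fastforce
        have pC: "(q, v) \<in> C" using True by (simp add: qv)
        then have q: "q \<in> points Q" by (simp add: C_iff)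
        have "f' a p = f a p" if a: "a \<in> {1..m}" for a
        proof (rule positive_system_unique[where I = "{1..m}" and a = "\<lambda>\<alpha> \<beta>. g q (X \<alpha> q) (X \<beta> q)"
              and x = "\<lambda>a. f' a p" and y = "\<lambda>a. f a p", OF _ _ a])
          show "0 < (\<Sum>\<alpha>\<in>{1..m}. \<Sum>\<beta>\<in>{1..m}. t \<alpha> * t \<beta> * g q (X \<alpha> q) (X \<beta> q))"
            if "\<exists>\<alpha>\<in>{1..m}. t \<alpha> \<noteq> 0" for t :: "nat \<Rightarrow> real"
            by (rule gram_positive[OF q D_subset that])
          fix \<alpha> assume \<alpha>: "\<alpha> \<in> {1..m}"
          have "X \<alpha> \<in> sections Q D"
            using frame_field[OF D_index[OF \<alpha>]] frame_D[OF _ \<alpha>] by (simp add: sections_def)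
          then have "lagrange_defect Q L Z' (X \<alpha>) p = 0" using Z' True by blast
          then have "lagrange_defect Q L (lift_field f') (X \<alpha>) (q, v) = 0"
            using lagrange_defect_cong[of Z' p "lift_field f'", OF f'[OF True]] by (simp add: qv)
          moreover have "lagrange_defect Q L (lift_field f) (X \<alpha>) (q, v) = 0" by (rule f0[OF pC \<alpha>])
          ultimately show "(\<Sum>\<beta>\<in>{1..m}. g q (X \<alpha> q) (X \<beta> q) * f' \<beta> p)
              = (\<Sum>\<beta>\<in>{1..m}. g q (X \<alpha> q) (X \<beta> q) * f \<beta> p)"
            using defect_lift_field[OF pC D_index[OF \<alpha>], of f'] defect_lift_field[OF pC D_index[OF \<alpha>], of f]
            by (simp add: qv)
        qed
        then have "lift_field f' p = lift_field f p" by (simp add: lift_field_def)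
        then show ?thesis using f'[OF True] Z0[OF True] by simp
      qed
    qed
  qed
  then show ?thesis by (intro that[of f]) (simp_all only: Z0 Z00)
qed

end

context nonholonomic_frame
begin

abbreviation "\<Gamma> \<equiv> nonholonomic_field Q L m D X"

lemma euler_form_zero_iff:
  assumes h: "symmetric_tensor_field Q h" and c: "c \<in> charts_at Q q"
  shows "(\<forall>w. euler_form c h (coords Q c q) u b w = 0) \<longleftrightarrow>
    (\<forall>\<alpha>\<in>{1..DIM('e)}. euler_form c h (coords Q c q) u b (X \<alpha> q c) = 0)"
proof (intro iffI ballI allI)
  fix w assume z: "\<forall>\<alpha>\<in>{1..DIM('e)}. euler_form c h (coords Q c q) u b (X \<alpha> q c) = 0"
  note cQ = charts_atD[OF c]
  have q: "q \<in> points Q" by (rule charts_at_points[OF c])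
  note l = linear_euler_form[OF h cQ coords_in_image[OF c]]
  obtain t where t: "coord_vec Q c q w = lincomb {1..DIM('e)} t (\<lambda>\<alpha>. X \<alpha> q)"
    using coord_vec_tspace[OF c, of w] unfolding tspace_span[OF q] by blast
  have "w = (\<Sum>\<alpha>\<in>{1..DIM('e)}. t \<alpha> *\<^sub>R X \<alpha> q c)"
    using fun_cong[OF t, of c] unfolding coord_vec_self[OF c] lincomb_def .
  then show "euler_form c h (coords Q c q) u b w = 0"
    using z by (simp add: linear_sum[OF l] linear_cmul[OF l])
qed simp

text \<open>In each chart the spray is characterised by the vanishing of \<open>euler_form\<close> on all vectors, which is
  tested on the frame.\<close>

lemma geodesic_extension_iff:
  assumes h: "riemannian_metric Q h"
  shows "geodesic_extension Q L m D X h \<longleftrightarrow>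
    (\<forall>p\<in>C. \<forall>\<alpha>\<in>{1..DIM('e)}. lagrange_defect Q (kinetic_lagrangian h) \<Gamma> (X \<alpha>) p = 0)"
proof -
  have sh: "symmetric_tensor_field Q h" using h unfolding riemannian_metric_def by blast
  obtain f where f: "\<And>p. p \<in> C \<Longrightarrow> \<Gamma> p = lift_field f p" by (rule nonholonomic_field_eq) blast
  have "geodesic_spray Q h p = \<Gamma> p \<longleftrightarrow>
    (\<forall>\<alpha>\<in>{1..DIM('e)}. lagrange_defect Q (kinetic_lagrangian h) \<Gamma> (X \<alpha>) p = 0)" if "p \<in> C" for p
  proof -
    obtain q v where qv: "p = (q, v)" by fastforce
    have p: "(q, v) \<in> C" using that by (simp add: qv)
    have q: "q \<in> points Q" and v: "v \<in> tspace Q q" using p by (auto simp: C_iff)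
    have chart: "geodesic_spray Q h (q, v) c = lift_field f (q, v) c \<longleftrightarrow>
      (\<forall>\<alpha>\<in>{1..DIM('e)}. lagrange_defect Q (kinetic_lagrangian h) \<Gamma> (X \<alpha>) (q, v) = 0)"
      if c: "c \<in> charts_at Q q" for c
    proof -
      note cQ = charts_atD[OF c]
      have "geodesic_spray Q h (q, v) c = lift_field f (q, v) c \<longleftrightarrow>
        snd (lift_field f (q, v) c) = - christoffel Q c h (coords Q c q) (v c) (v c)"
        using c by (auto simp: geodesic_spray_def lift_field_chart[OF p c])
      also have "\<dots> \<longleftrightarrow> (\<forall>\<alpha>\<in>{1..DIM('e)}. euler_form c h (coords Q c q) (v c) (snd (lift_field f (q, v) c)) (X \<alpha> q c) = 0)"
        unfolding christoffel_iff[OF h cQ coords_in_image[OF c]] by (rule euler_form_zero_iff[OF sh c])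
      also have "\<dots> \<longleftrightarrow> (\<forall>\<alpha>\<in>{1..DIM('e)}. lagrange_defect Q (kinetic_lagrangian h) \<Gamma> (X \<alpha>) (q, v) = 0)"
        by (rule ball_cong[OF refl]) (simp add: defect_lift_field_chart[where Z = \<Gamma> and f = f, OF sh frame_field p c f[OF p]])
      finally show ?thesis .
    qed
    obtain c0 where c0: "c0 \<in> charts_at Q q" using charts_at_ex[OF q] by blast
    have out: "geodesic_spray Q h (q, v) c = lift_field f (q, v) c" if "c \<notin> charts_at Q q" for c
      using that T.tspace_outside[OF lift_field_tspace[OF C_points[OF p]], of c f]
      by (simp add: geodesic_spray_def tb_charts_at_iff)
    show ?thesis unfolding qv f[OF p]
    proof
      assume "geodesic_spray Q h (q, v) = lift_field f (q, v)"
      then have "geodesic_spray Q h (q, v) c0 = lift_field f (q, v) c0" by (rule fun_cong)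
      then show "\<forall>\<alpha>\<in>{1..DIM('e)}. lagrange_defect Q (kinetic_lagrangian h) \<Gamma> (X \<alpha>) (q, v) = 0"
        unfolding chart[OF c0] .
    next
      assume z: "\<forall>\<alpha>\<in>{1..DIM('e)}. lagrange_defect Q (kinetic_lagrangian h) \<Gamma> (X \<alpha>) (q, v) = 0"
      show "geodesic_spray Q h (q, v) = lift_field f (q, v)"
      proof
        show "geodesic_spray Q h (q, v) c = lift_field f (q, v) c" for c
          using z out chart by (cases "c \<in> charts_at Q q") simp_all
      qed
    qed
  qed
  then show ?thesis using h unfolding geodesic_extension_def by (simp cong: ball_cong)
qed

section \<open>Comparing two tensors that agree on the distribution\<close>

text \<open>Let \<open>U\<close> be the combination of the \<open>X\<^sub>a\<close> with constant coefficients that equals \<open>v\<close> at \<open>q\<close>. As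
  \<open>t(U, U) = 0\<close> near \<open>q\<close>, its derivative along \<open>X\<^sub>\<alpha>\<close> is zero. This trades the derivative of \<open>t\<close> for
  \<open>- t(v, DU(X\<^sub>\<alpha>))\<close>, and together with the term \<open>t(v, DX\<^sub>\<alpha>(v))\<close> of the complete lift it forms the
  brackets.\<close>

lemma complete_lift_kinetic_vanishing:
  assumes t: "symmetric_tensor_field Q t"
    and z: "\<And>q u w. q \<in> points Q \<Longrightarrow> u \<in> D q \<Longrightarrow> w \<in> D q \<Longrightarrow> t q u w = 0"
    and p: "(q, v) \<in> C" and \<alpha>: "\<alpha> \<in> {1..DIM('e)}"
  shows "tderiv TB (q, v) (complete_lift Q (X \<alpha>) (q, v)) (kinetic_lagrangian t)
    = - (\<Sum>a=1..m. frame_coeff X q v a * t q v (lie_bracket Q (X \<alpha>) (X a) q))"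
proof -
  have q: "q \<in> points Q" and v: "v \<in> tspace Q q" using p by (auto simp: C_iff)
  obtain c where c: "c \<in> charts_at Q q" using charts_at_ex[OF q] by blast
  note cQ = charts_atD[OF c]
  let ?x = "coords Q c q" and ?r = "frame_coeff X q v"
  let ?G = "local_tensor Q c t ?x"
  let ?DX = "\<lambda>\<alpha>. fderiv (local_rep Q c (X \<alpha>)) ?x"
  note S = open_image[OF cQ] coords_in_image[OF c]
  have lG: "linear (?G u)" for u
    using bilinear_local_tensor[OF t cQ S(2)] unfolding bilinear_def by blast
  have lD: "linear (?DX \<alpha>)" by (rule has_derivative_linear[OF local_rep_has_derivative[OF frame_field[OF \<alpha>] c]])
  have vc: "(\<Sum>a=1..m. ?r a *\<^sub>R X a q c) = v c"
    using C_expansion[OF p] unfolding lincomb_def by metis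
  let ?U = "\<lambda>x. \<Sum>a=1..m. ?r a *\<^sub>R local_rep Q c (X a) x"
  let ?DU = "\<lambda>w. \<Sum>a=1..m. ?r a *\<^sub>R ?DX a w"
  have Ux: "?U ?x = v c" by (simp only: local_rep_at[OF c] vc)
  have dU: "(?U has_derivative ?DU) (at ?x)"
    by (intro has_derivative_sum has_derivative_scaleR_right local_rep_has_derivative frame_field D_index c)
  have zero: "local_tensor Q c t x (?U x) (?U x) = 0" if x: "x \<in> coords Q c ` chart_dom Q c" for x
  proof -
    have ip: "inv_coords Q c x \<in> points Q" by (rule charts_at_points[OF inv_coords_charts_at_self(1)[OF cQ x]])
    have "lincomb {1..m} ?r (\<lambda>\<alpha>. X \<alpha> (inv_coords Q c x)) \<in> D (inv_coords Q c x)"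
      unfolding D_span[OF ip] by (rule rangeI)
    then show ?thesis unfolding local_tensor_def coord_vec_frame[OF cQ x] by (intro z ip)
  qed
  have "fderiv (\<lambda>x. local_tensor Q c t x (?U x) (?U x)) ?x = (\<lambda>_. 0)"
    using fderiv_cong[OF S zero] by simp
  then have "fderiv (\<lambda>y. local_tensor Q c t y (v c) (v c)) ?x (X \<alpha> q c)
      + ?G (?DU (X \<alpha> q c)) (v c) + ?G (v c) (?DU (X \<alpha> q c)) = 0"
    using fderiv_eqI[OF local_tensor_has_derivative[OF t c has_derivative_ident refl dU dU]]
    unfolding Ux by metis
  then have "fderiv (\<lambda>y. local_tensor Q c t y (v c) (v c)) ?x (X \<alpha> q c) / 2 = - ?G (v c) (?DU (X \<alpha> q c))"
    using local_tensor_sym[OF t cQ S(2), of "?DU (X \<alpha> q c)" "v c"] by linarith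
  moreover have "tderiv TB (q, v) (complete_lift Q (X \<alpha>) (q, v)) (kinetic_lagrangian t)
    = fderiv (\<lambda>y. local_tensor Q c t y (v c) (v c)) ?x (X \<alpha> q c) / 2 + ?G (v c) (?DX \<alpha> (v c))"
    using tderiv_kinetic[OF t c v lift_tspace(1)[OF C_points[OF p] \<alpha>]] c
    by (simp add: complete_lift_def)
  ultimately have 1: "tderiv TB (q, v) (complete_lift Q (X \<alpha>) (q, v)) (kinetic_lagrangian t)
    = ?G (v c) (?DX \<alpha> (v c)) - ?G (v c) (?DU (X \<alpha> q c))" by linarith
  have "t q v (lie_bracket Q (X \<alpha>) (X a) q) = ?G (v c) (?DX a (X \<alpha> q c)) - ?G (v c) (?DX \<alpha> (X a q c))"
    if a: "a \<in> {1..m}" for a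
    using tensor_local[OF c v lie_bracket_tspace[OF frame_field[OF \<alpha>] frame_field[OF D_index[OF a]] q], of t] c
    by (simp add: lie_bracket_def linear_diff[OF lG])
  then have "(\<Sum>a=1..m. ?r a * t q v (lie_bracket Q (X \<alpha>) (X a) q))
    = (\<Sum>a=1..m. ?r a * ?G (v c) (?DX a (X \<alpha> q c))) - (\<Sum>a=1..m. ?r a * ?G (v c) (?DX \<alpha> (X a q c)))"
    by (simp add: right_diff_distrib sum_subtractf)
  also have "(\<Sum>a=1..m. ?r a * ?G (v c) (?DX a (X \<alpha> q c))) = ?G (v c) (?DU (X \<alpha> q c))"
    by (simp add: linear_sum[OF lG] linear_cmul[OF lG])
  also have "(\<Sum>a=1..m. ?r a * ?G (v c) (?DX \<alpha> (X a q c))) = ?G (v c) (?DX \<alpha> (v c))"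
    unfolding vc[symmetric] by (simp add: linear_sum[OF lG] linear_cmul[OF lG] linear_sum[OF lD] linear_cmul[OF lD])
  finally show ?thesis unfolding 1 by simp
qed

text \<open>The components of the bracket in \<open>D\<close> do not contribute since \<open>t\<close> vanishes on \<open>D\<close>.\<close>

lemma tensor_bracket:
  assumes t: "symmetric_tensor_field Q t"
    and z: "\<And>q u w. q \<in> points Q \<Longrightarrow> u \<in> D q \<Longrightarrow> w \<in> D q \<Longrightarrow> t q u w = 0"
    and p: "(q, v) \<in> C" and \<alpha>: "\<alpha> \<in> {1..DIM('e)}" and \<beta>: "\<beta> \<in> {1..DIM('e)}"
  shows "t q v (lie_bracket Q (X \<alpha>) (X \<beta>) q)
    = (\<Sum>k=m+1..DIM('e). structure_fun Q X \<alpha> \<beta> k q * theta m X t k (q, v))"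
proof -
  have q: "q \<in> points Q" and v: "v \<in> tspace Q q" using p by (auto simp: C_iff)
  have vD: "v \<in> D q" using p C_iff_D by blast
  note lb = lie_bracket_tspace[OF frame_field[OF \<alpha>] frame_field[OF \<beta>] q]
  have "t q v (lie_bracket Q (X \<alpha>) (X \<beta>) q) = t q (lie_bracket Q (X \<alpha>) (X \<beta>) q) v"
    by (rule tensor_sym[OF t q v lb])
  also have "\<dots> = t q (lincomb {1..DIM('e)} (\<lambda>\<gamma>. structure_fun Q X \<alpha> \<beta> \<gamma> q) (\<lambda>\<gamma>. X \<gamma> q)) v"
    using frame_expansion[OF q lb] unfolding structure_fun_def by (rule arg_cong[of _ _ "\<lambda>u. t q u v"])
  also have "\<dots> = (\<Sum>\<gamma>\<in>{1..DIM('e)}. structure_fun Q X \<alpha> \<beta> \<gamma> q * t q (X \<gamma> q) v)"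
    by (rule tensor_lincomb[OF t q v]) (erule frame_tspace, rule q)
  also have "\<dots> = (\<Sum>\<gamma>=m+1..DIM('e). structure_fun Q X \<alpha> \<beta> \<gamma> q * t q (X \<gamma> q) v)"
    using z[OF q frame_D[OF q] vD] by (intro sum.mono_neutral_right) auto
  also have "\<dots> = (\<Sum>k=m+1..DIM('e). structure_fun Q X \<alpha> \<beta> k q * theta m X t k (q, v))"
  proof (rule sum.cong[OF refl])
    fix k assume "k \<in> {m+1..DIM('e)}"
    then have k: "k \<in> {1..DIM('e)}" by (rule perp_index)
    show "structure_fun Q X \<alpha> \<beta> k q * t q (X k q) v = structure_fun Q X \<alpha> \<beta> k q * theta m X t k (q, v)"
      by (simp only: tensor_sym[OF t q frame_tspace[OF k q] v] tensor_on_C[OF t p k])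
  qed
  finally show ?thesis .
qed

text \<open>The difference of the two Lagrangians is the kinetic function of \<open>t = h - g\<close>, whose derivative along
  \<open>X\<^sub>\<alpha>\<^sup>C\<close> has just been computed. Because \<open>g(X\<^sub>a, X\<^sub>k) = 0\<close>, the functions \<open>\<theta>\<^sub>k\<close> of \<open>t\<close> and of \<open>h\<close>
  coincide.\<close>

lemma defect_difference:
  assumes h: "preserving_modification Q D g h" and p: "(q, v) \<in> C" and \<alpha>: "\<alpha> \<in> {1..DIM('e)}"
    and Z: "Z (q, v) \<in> tspace TB (q, v)"
  shows "lagrange_defect Q (kinetic_lagrangian h) Z (X \<alpha>) (q, v)
    = lagrange_defect Q L Z (X \<alpha>) (q, v)
      + tderiv TB (q, v) (Z (q, v)) (\<lambda>s. h (fst s) (snd s) (X \<alpha> (fst s)) - g (fst s) (snd s) (X \<alpha> (fst s)))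
      + (\<Sum>k=m+1..DIM('e). \<Sum>a=1..m. theta m X h k (q, v) * structure_fun Q X \<alpha> a k q * quasi_velocity X a (q, v))"
proof -
  have sh: "symmetric_tensor_field Q h" and hD: "\<And>q u w. q \<in> points Q \<Longrightarrow> u \<in> D q \<Longrightarrow> w \<in> D q \<Longrightarrow> h q u w = g q u w"
    using h unfolding preserving_modification_def by blast+
  have q: "q \<in> points Q" using p by (simp add: C_iff)
  note pt = C_points[OF p]
  define t where "t = (\<lambda>q u w. h q u w - g q u w)"
  have t: "symmetric_tensor_field Q t" unfolding t_def by (rule symmetric_tensor_field_diff[OF sh metric_tensor])
  have z: "t q u w = 0" if "q \<in> points Q" "u \<in> D q" "w \<in> D q" for q u w using hD[OF that] by (simp add: t_def)
  have th: "theta m X t k (q, v) = theta m X h k (q, v)" if "k \<in> {m+1..DIM('e)}" for k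
    using frame_orthogonal[OF q frame_D[OF q] that] by (simp add: theta_def t_def)
  note dX = lift_tspace(1)[OF pt \<alpha>]
  have "tderiv TB (q, v) (complete_lift Q (X \<alpha>) (q, v)) (kinetic_lagrangian h)
      - tderiv TB (q, v) (complete_lift Q (X \<alpha>) (q, v)) L
    = tderiv TB (q, v) (complete_lift Q (X \<alpha>) (q, v)) (\<lambda>s. kinetic_lagrangian h s - L s)"
    by (rule T.tderiv_diff[OF smooth_fun_kinetic[OF sh] smooth_fun_kinetic[OF metric_tensor] dX pt, symmetric])
  also have "(\<lambda>s. kinetic_lagrangian h s - L s) = kinetic_lagrangian t"
    by (rule ext) (simp add: kinetic_lagrangian_def t_def case_prod_unfold diff_divide_distrib)
  also have "tderiv TB (q, v) (complete_lift Q (X \<alpha>) (q, v)) (kinetic_lagrangian t)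
    = - (\<Sum>a=1..m. frame_coeff X q v a * t q v (lie_bracket Q (X \<alpha>) (X a) q))"
    by (rule complete_lift_kinetic_vanishing[OF t z p \<alpha>])
  also have "(\<Sum>a=1..m. frame_coeff X q v a * t q v (lie_bracket Q (X \<alpha>) (X a) q))
    = (\<Sum>a=1..m. \<Sum>k=m+1..DIM('e). theta m X h k (q, v) * structure_fun Q X \<alpha> a k q * quasi_velocity X a (q, v))"
  proof (rule sum.cong[OF refl])
    fix a assume a: "a \<in> {1..m}"
    show "frame_coeff X q v a * t q v (lie_bracket Q (X \<alpha>) (X a) q)
      = (\<Sum>k=m+1..DIM('e). theta m X h k (q, v) * structure_fun Q X \<alpha> a k q * quasi_velocity X a (q, v))"
    proof -
      have "t q v (lie_bracket Q (X \<alpha>) (X a) q)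
        = (\<Sum>k=m+1..DIM('e). structure_fun Q X \<alpha> a k q * theta m X t k (q, v))"
        by (rule tensor_bracket[OF t z p \<alpha> D_index[OF a]])
      also have "\<dots> = (\<Sum>k=m+1..DIM('e). structure_fun Q X \<alpha> a k q * theta m X h k (q, v))"
        by (rule sum.cong[OF refl]) (simp only: th)
      finally show ?thesis
        by (simp add: quasi_velocity_def sum_distrib_left mult_ac)
    qed
  qed
  also have "\<dots> = (\<Sum>k=m+1..DIM('e). \<Sum>a=1..m. theta m X h k (q, v) * structure_fun Q X \<alpha> a k q * quasi_velocity X a (q, v))"
    by (rule sum.swap)
  finally have K: "tderiv TB (q, v) (complete_lift Q (X \<alpha>) (q, v)) (kinetic_lagrangian h)
      - tderiv TB (q, v) (complete_lift Q (X \<alpha>) (q, v)) L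
    = - (\<Sum>k=m+1..DIM('e). \<Sum>a=1..m. theta m X h k (q, v) * structure_fun Q X \<alpha> a k q * quasi_velocity X a (q, v))" .
  note M = T.tderiv_diff[OF smooth_fun_momentum[OF sh frame_field[OF \<alpha>]]
      smooth_fun_momentum[OF metric_tensor frame_field[OF \<alpha>]] Z pt]
  show ?thesis
    unfolding lagrange_defect_momentum[OF sh frame_field[OF \<alpha>] pt]
      lagrange_defect_momentum[OF metric_tensor frame_field[OF \<alpha>] pt] M
    using K by linarith
qed

lemma structure_fun_antisym:
  assumes q: "q \<in> points Q" and \<alpha>: "\<alpha> \<in> {1..DIM('e)}" and \<beta>: "\<beta> \<in> {1..DIM('e)}" and \<gamma>: "\<gamma> \<in> {1..DIM('e)}"
  shows "structure_fun Q X \<alpha> \<beta> \<gamma> q = - structure_fun Q X \<beta> \<alpha> \<gamma> q"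
proof -
  note lb = lie_bracket_tspace[OF frame_field[OF \<beta>] frame_field[OF \<alpha>] q]
  have "lie_bracket Q (X \<alpha>) (X \<beta>) q = (\<lambda>c. (-1) *\<^sub>R lie_bracket Q (X \<beta>) (X \<alpha>) q c + 0 *\<^sub>R lie_bracket Q (X \<beta>) (X \<alpha>) q c)"
    by (rule ext) (simp add: lie_bracket_def)
  then show ?thesis
    unfolding structure_fun_def using frame_coeff_lin[OF q lb lb \<gamma>, of "-1" 0] by simp
qed

text \<open>Since \<open>\<Gamma>\<close> is tangent to \<open>C\<close>, the derivative of the momentum of \<open>h - g\<close> is determined by its restriction
  to \<open>C\<close>, which is zero along \<open>D\<close> and \<open>\<theta>\<^sub>i\<close> in the transverse directions. The expression for \<open>g\<close> itself is
  zero along \<open>D\<close> and the multiplier transversally.\<close>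

lemma conditions_iff:
  assumes h: "preserving_modification Q D g h"
  shows "algebraic_conditions Q m X h \<and> pde_conditions Q L m D X h \<longleftrightarrow>
    (\<forall>p\<in>C. \<forall>\<alpha>\<in>{1..DIM('e)}. lagrange_defect Q (kinetic_lagrangian h) \<Gamma> (X \<alpha>) p = 0)"
proof -
  have sh: "symmetric_tensor_field Q h" and hD: "\<And>q u w. q \<in> points Q \<Longrightarrow> u \<in> D q \<Longrightarrow> w \<in> D q \<Longrightarrow> h q u w = g q u w"
    using h unfolding preserving_modification_def by blast+
  obtain f where f: "\<And>p. p \<in> C \<Longrightarrow> \<Gamma> p = lift_field f p"
    and f0: "\<And>p a. p \<in> C \<Longrightarrow> a \<in> {1..m} \<Longrightarrow> lagrange_defect Q L \<Gamma> (X a) p = 0"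
    by (rule nonholonomic_field_eq) blast
  let ?T = "\<lambda>\<alpha> s. h (fst s) (snd s) (X \<alpha> (fst s)) - g (fst s) (snd s) (X \<alpha> (fst s))"
  have tan: "\<Gamma> p \<in> tspace_sub TB C p" if "p \<in> C" for p using lift_field_tangent[OF that, of f] f[OF that] by simp
  have tsp: "\<Gamma> p \<in> tspace TB p" if "p \<in> C" for p using tan[OF that] unfolding tspace_sub_def by blast
  have sT: "smooth_fun TB (?T \<alpha>)" if "\<alpha> \<in> {1..DIM('e)}" for \<alpha>
    by (intro T.smooth_fun_diff smooth_fun_momentum sh metric_tensor frame_field that)
  have D_eq: "lagrange_defect Q (kinetic_lagrangian h) \<Gamma> (X c) p =
      - (\<Sum>k=m+1..DIM('e). \<Sum>a=1..m. theta m X h k p * structure_fun Q X a c k (fst p) * quasi_velocity X a p)"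
    if p: "p \<in> C" and c: "c \<in> {1..m}" for p c
  proof -
    have pC: "(fst p, snd p) \<in> C" using p by simp
    have q: "fst p \<in> points Q" using C_iff pC by blast
    have "?T c s = 0" if "s \<in> C" for s
    proof -
      have "fst s \<in> points Q" "snd s \<in> D (fst s)" using that C_iff_D[of "fst s" "snd s"] by auto
      then show ?thesis using hD frame_D[OF _ c] by simp
    qed
    then have "tderiv TB p (\<Gamma> p) (?T c) = 0"
      using tan[OF p] sT[OF D_index[OF c]] unfolding tspace_sub_def by blast
    then have "lagrange_defect Q (kinetic_lagrangian h) \<Gamma> (X c) p =
      (\<Sum>k=m+1..DIM('e). \<Sum>a=1..m. theta m X h k p * structure_fun Q X c a k (fst p) * quasi_velocity X a p)"
      using defect_difference[where Z = \<Gamma>, OF h pC D_index[OF c]] tsp[OF p] f0[OF p c] by simp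
    also have "\<dots> = (\<Sum>k=m+1..DIM('e). \<Sum>a=1..m. - (theta m X h k p * structure_fun Q X a c k (fst p) * quasi_velocity X a p))"
      using structure_fun_antisym[OF q D_index[OF c] D_index perp_index]
      by (intro sum.cong refl) simp
    finally show ?thesis by (simp add: sum_negf)
  qed
  have P_eq: "lagrange_defect Q (kinetic_lagrangian h) \<Gamma> (X i) p =
      tderiv_sub TB C p (\<Gamma> p) (theta m X h i)
        + (\<Sum>k=m+1..DIM('e). \<Sum>a=1..m. theta m X h k p * structure_fun Q X i a k (fst p) * quasi_velocity X a p)
        + multiplier Q L m D X i p"
    if p: "p \<in> C" and i: "i \<in> {m+1..DIM('e)}" for p i
  proof -
    have pC: "(fst p, snd p) \<in> C" using p by simp
    have "?T i s = theta m X h i s" if "s \<in> C" for s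
    proof -
      have sC: "(fst s, snd s) \<in> C" using that by simp
      then have "fst s \<in> points Q" "snd s \<in> D (fst s)" using C_iff_D by blast+
      then show ?thesis using frame_orthogonal[OF _ _ i] tensor_on_C[OF sh sC perp_index[OF i]] by simp
    qed
    then have "tderiv_sub TB C p (\<Gamma> p) (theta m X h i) = tderiv TB p (\<Gamma> p) (?T i)"
      by (rule T.tderiv_sub_eq[OF tan[OF p] C_points[OF p] sT[OF perp_index[OF i]]])
    then show ?thesis
      using defect_difference[where Z = \<Gamma>, OF h pC perp_index[OF i]] tsp[OF p]
      by (simp add: multiplier_def)
  qed
  have split: "(\<forall>\<alpha>\<in>{1..DIM('e)}. P \<alpha>) \<longleftrightarrow> (\<forall>c\<in>{1..m}. P c) \<and> (\<forall>i\<in>{m+1..DIM('e)}. P i)" for P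
    using m_le by (auto simp: not_less_eq_eq)
  have "algebraic_conditions Q m X h \<longleftrightarrow>
    (\<forall>p\<in>C. \<forall>c\<in>{1..m}. lagrange_defect Q (kinetic_lagrangian h) \<Gamma> (X c) p = 0)"
    unfolding algebraic_conditions_def by (intro ball_cong refl) (simp only: D_eq neg_equal_0_iff_equal)
  moreover have "pde_conditions Q L m D X h \<longleftrightarrow>
    (\<forall>p\<in>C. \<forall>i\<in>{m+1..DIM('e)}. lagrange_defect Q (kinetic_lagrangian h) \<Gamma> (X i) p = 0)"
    unfolding pde_conditions_def by (intro ball_cong refl) (simp only: P_eq)
  ultimately show ?thesis unfolding split by blast
qed

section \<open>A Riemannian metric with prescribed mixed components\<close>

lemma frame_coeff_frame:
  assumes q: "q \<in> points Q" and \<alpha>: "\<alpha> \<in> {1..DIM('e)}"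
  shows "frame_coeff X q (X \<alpha> q) = (\<lambda>\<beta>. if \<beta> = \<alpha> then 1 else 0)"
proof -
  have "frame_coeff X q (X \<alpha> q) = (\<lambda>\<beta>. if \<beta> \<in> {1..DIM('e)} then if \<beta> = \<alpha> then 1 else 0 else 0)"
    using frame_coeff_lincomb[OF q order_refl, of "\<lambda>j. if j = \<alpha> then 1 else 0"]
    unfolding lincomb_indicator[OF finite_atLeastAtMost \<alpha>] .
  also have "\<dots> = (\<lambda>\<beta>. if \<beta> = \<alpha> then 1 else 0)" by (rule ext) (use \<alpha> in auto)
  finally show ?thesis .
qed

lemma smooth_frame_coeff:
  assumes c: "c \<in> charts Q" and \<alpha>: "\<alpha> \<in> {1..DIM('e)}"
  shows "smooth_on (\<lambda>x. frame_coeff X (inv_coords Q c x) (coord_vec Q c (inv_coords Q c x) a) \<alpha>)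
    (coords Q c ` chart_dom Q c)"
proof (rule smooth_on_cong[OF open_image[OF c]])
  let ?S = "coords Q c ` chart_dom Q c"
  have "smooth_on (\<lambda>z. quasi_velocity X \<alpha> (inv_coords TB c z)) (coords TB c ` chart_dom TB c)"
    using smooth_quasi_velocity[OF \<alpha>] c unfolding smooth_fun_def tangent_bundle_simps(1) by blast
  then have "smooth_on (\<lambda>z. quasi_velocity X \<alpha> (inv_coords TB c z)) (?S \<times> UNIV)"
    unfolding tb_image[OF c] .
  then show "smooth_on (\<lambda>x. quasi_velocity X \<alpha> (inv_coords TB c (x, a))) ?S"
    by (rule smooth_on_compose_affine[where A = "\<lambda>x. (x, a)" and A' = "\<lambda>y. (y, 0)",
          OF _ open_Times[OF open_image[OF c] open_UNIV] open_image[OF c], rotated -1])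
       (auto intro!: derivative_eq_intros)
qed (simp add: tb_inv_coords[OF c] quasi_velocity_def)

text \<open>Let \<open>y\<^sub>i = y\<^sub>i\<^sup>b X\<^sub>b\<close> be the section of \<open>D\<close> with \<open>g(X\<^sub>a, y\<^sub>i) = h(X\<^sub>a, X\<^sub>i)\<close>, and let \<open>u\<^sup>\<alpha>\<close>, \<open>w\<^sup>\<alpha>\<close> be the frame
  coefficients of \<open>u\<close>, \<open>w\<close>. The metric is
  \<open>g(u\<^sup>a X\<^sub>a + u\<^sup>i y\<^sub>i, w\<^sup>a X\<^sub>a + w\<^sup>i y\<^sub>i) + u\<^sup>i w\<^sup>i\<close>: the first term restricts to \<open>g\<close> on \<open>D\<close> and has the mixed
  components of \<open>h\<close>, and the sum \<open>u\<^sup>i w\<^sup>i\<close> makes the form definite in the transverse directions.\<close>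

lemma riemannian_modification_exists:
  assumes h: "symmetric_tensor_field Q h"
  obtains k where "riemannian_metric Q k" "preserving_modification Q D g k"
    "\<And>q a i. q \<in> points Q \<Longrightarrow> a \<in> {1..m} \<Longrightarrow> i \<in> {m+1..DIM('e)} \<Longrightarrow> k q (X a q) (X i q) = h q (X a q) (X i q)"
proof -
  let ?I = "{m+1..DIM('e)}"
  let ?g = "\<lambda>a b q. g q (X a q) (X b q)"
  have "\<exists>x. (\<forall>b\<in>{1..m}. smooth_fun Q (x b)) \<and>
      (\<forall>q\<in>points Q. \<forall>a\<in>{1..m}. (\<Sum>b\<in>{1..m}. ?g a b q * x b q) = h q (X a q) (X i q))"
    if i: "i \<in> ?I" for i
  proof (rule smooth_positive_system_solution)
    show "smooth_fun Q (?g a b)" if "a \<in> {1..m}" "b \<in> {1..m}" for a b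
      by (rule smooth_gram[OF metric_tensor that[THEN D_index]])
    show "smooth_fun Q (\<lambda>q. h q (X a q) (X i q))" if "a \<in> {1..m}" for a
      by (rule smooth_gram[OF h D_index[OF that] perp_index[OF i]])
    show "?g a b q = ?g b a q" if "q \<in> points Q" "a \<in> {1..m}" "b \<in> {1..m}" for q a b
      by (rule gram_sym[OF that(1) that(2,3)[THEN D_index]])
    show "0 < (\<Sum>a\<in>{1..m}. \<Sum>b\<in>{1..m}. t a * t b * ?g a b q)"
      if "q \<in> points Q" "\<exists>a\<in>{1..m}. t a \<noteq> 0" for q and t :: "nat \<Rightarrow> real"
      by (rule gram_positive[OF that(1) D_subset that(2)])
  qed simp
  then have "\<forall>i\<in>?I. \<exists>x. (\<forall>b\<in>{1..m}. smooth_fun Q (x b)) \<and>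
      (\<forall>q\<in>points Q. \<forall>a\<in>{1..m}. (\<Sum>b\<in>{1..m}. ?g a b q * x b q) = h q (X a q) (X i q))" by blast
  from bchoice[OF this] obtain y where
    "\<forall>i\<in>?I. (\<forall>b\<in>{1..m}. smooth_fun Q (y i b)) \<and>
      (\<forall>q\<in>points Q. \<forall>a\<in>{1..m}. (\<Sum>b\<in>{1..m}. ?g a b q * y i b q) = h q (X a q) (X i q))" ..
  then have ys: "\<And>i b. i \<in> ?I \<Longrightarrow> b \<in> {1..m} \<Longrightarrow> smooth_fun Q (y i b)"
    and ye: "\<And>i q a. i \<in> ?I \<Longrightarrow> q \<in> points Q \<Longrightarrow> a \<in> {1..m} \<Longrightarrow>
      (\<Sum>b\<in>{1..m}. ?g a b q * y i b q) = h q (X a q) (X i q)" by blast+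
  \<comment> \<open>\<open>\<beta> b q u\<close> is the coefficient of \<open>X\<^sub>b\<close> in \<open>u\<^sup>a X\<^sub>a + u\<^sup>i y\<^sub>i\<close>\<close>
  define \<beta> where "\<beta> b q u = frame_coeff X q u b + (\<Sum>i\<in>?I. y i b q * frame_coeff X q u i)" for b q u
  define k where "k q u w = (\<Sum>a=1..m. \<Sum>b=1..m. ?g a b q * (\<beta> a q u * \<beta> b q w))
    + (\<Sum>i\<in>?I. frame_coeff X q u i * frame_coeff X q w i)" for q u w
  have ksym: "k q u w = k q w u" if q: "q \<in> points Q" for q u w
  proof -
    have "(\<Sum>a=1..m. \<Sum>b=1..m. ?g a b q * (\<beta> a q u * \<beta> b q w)) = (\<Sum>b=1..m. \<Sum>a=1..m. ?g a b q * (\<beta> a q u * \<beta> b q w))"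
      by (rule sum.swap)
    also have "\<dots> = (\<Sum>b=1..m. \<Sum>a=1..m. ?g b a q * (\<beta> b q w * \<beta> a q u))"
      using gram_sym[OF q D_index D_index] by (intro sum.cong refl) (simp add: mult.commute)
    finally show ?thesis by (simp add: k_def mult.commute[of "frame_coeff X q u _"])
  qed
  have klin: "k q (\<lambda>c. r *\<^sub>R u c + s *\<^sub>R v c) w = r * k q u w + s * k q v w"
    if q: "q \<in> points Q" and u: "u \<in> tspace Q q" and v: "v \<in> tspace Q q" for q u v w r s
  proof -
    note fl = frame_coeff_lin[OF q u v]
    have \<beta>l: "\<beta> b q (\<lambda>c. r *\<^sub>R u c + s *\<^sub>R v c) = r * \<beta> b q u + s * \<beta> b q v" if "b \<in> {1..m}" for b
    proof -
      have "(\<Sum>i\<in>?I. y i b q * frame_coeff X q (\<lambda>c. r *\<^sub>R u c + s *\<^sub>R v c) i)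
        = (\<Sum>i\<in>?I. r * (y i b q * frame_coeff X q u i) + s * (y i b q * frame_coeff X q v i))"
        using fl[OF perp_index] by (intro sum.cong refl) (simp add: algebra_simps)
      then show ?thesis using fl[OF D_index[OF that]]
        by (simp add: \<beta>_def sum.distrib sum_distrib_left algebra_simps)
    qed
    have "(\<Sum>a=1..m. \<Sum>b=1..m. ?g a b q * (\<beta> a q (\<lambda>c. r *\<^sub>R u c + s *\<^sub>R v c) * \<beta> b q w))
      = (\<Sum>a=1..m. \<Sum>b=1..m. r * (?g a b q * (\<beta> a q u * \<beta> b q w)) + s * (?g a b q * (\<beta> a q v * \<beta> b q w)))"
      using \<beta>l by (intro sum.cong refl) (simp add: algebra_simps)
    moreover have "(\<Sum>i\<in>?I. frame_coeff X q (\<lambda>c. r *\<^sub>R u c + s *\<^sub>R v c) i * frame_coeff X q w i)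
      = (\<Sum>i\<in>?I. r * (frame_coeff X q u i * frame_coeff X q w i) + s * (frame_coeff X q v i * frame_coeff X q w i))"
      using fl[OF perp_index] by (intro sum.cong refl) (simp add: algebra_simps)
    ultimately show ?thesis
      by (simp add: k_def sum.distrib sum_distrib_left[symmetric] distrib_left)
  qed
  have ksmooth: "smooth_on (\<lambda>x. local_tensor Q c k x a b) (coords Q c ` chart_dom Q c)" if c: "c \<in> charts Q" for c a b
  proof -
    note S = open_image[OF c]
    have sf: "smooth_on (\<lambda>x. f (inv_coords Q c x)) (coords Q c ` chart_dom Q c)" if "smooth_fun Q f" for f
      using that c unfolding smooth_fun_def by blast
    note fc = smooth_frame_coeff[OF c]
    have s\<beta>: "smooth_on (\<lambda>x. \<beta> b (inv_coords Q c x) (coord_vec Q c (inv_coords Q c x) u)) (coords Q c ` chart_dom Q c)"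
      if "b \<in> {1..m}" for b u
      unfolding \<beta>_def by (intro smooth_on_add smooth_on_sum smooth_on_mult S fc D_index that perp_index sf[OF ys])
    show ?thesis
      unfolding local_tensor_def k_def
      by (intro smooth_on_add smooth_on_sum smooth_on_mult S fc s\<beta> perp_index sf[OF smooth_gram[OF metric_tensor]] D_index)
  qed
  have kt: "symmetric_tensor_field Q k"
    unfolding symmetric_tensor_field_def using ksym klin ksmooth by blast
  have kpos: "0 < k q v v" if q: "q \<in> points Q" and v: "v \<in> tspace Q q" and nz: "v \<noteq> (\<lambda>_. 0)" for q v
  proof -
    have e: "(\<Sum>a=1..m. \<Sum>b=1..m. ?g a b q * (\<beta> a q v * \<beta> b q v)) = (\<Sum>a=1..m. \<Sum>b=1..m. \<beta> a q v * \<beta> b q v * ?g a b q)"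
      by (simp add: mult.commute)
    show ?thesis
    proof (cases "\<exists>a\<in>{1..m}. \<beta> a q v \<noteq> 0")
      case True
      from gram_positive[OF q D_subset True] show ?thesis
        unfolding k_def e by (intro add_pos_nonneg sum_nonneg) auto
    next
      case False
      have "\<exists>i\<in>?I. frame_coeff X q v i \<noteq> 0"
      proof (rule ccontr)
        assume z: "\<not> (\<exists>i\<in>?I. frame_coeff X q v i \<noteq> 0)"
        then have "(q, v) \<in> C" using q v by (simp add: C_iff)
        moreover have "frame_coeff X q v a = 0" if "a \<in> {1..m}" for a
          using False that z by (auto simp: \<beta>_def)
        ultimately have "v = lincomb {1..m} (\<lambda>_. 0) (\<lambda>\<alpha>. X \<alpha> q)"
          using C_expansion lincomb_cong[of "{1..m}" "frame_coeff X q v" "\<lambda>_. 0"] by metis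
        then show False using nz by (simp add: lincomb_def)
      qed
      then obtain i where i: "i \<in> ?I" "frame_coeff X q v i \<noteq> 0" by blast
      have "0 < (\<Sum>i\<in>?I. frame_coeff X q v i * frame_coeff X q v i)"
        by (rule sum_pos2[OF _ i(1)]) (use i(2) in \<open>auto simp: zero_less_mult_iff\<close>)
      moreover have "(\<Sum>a=1..m. \<Sum>b=1..m. ?g a b q * (\<beta> a q v * \<beta> b q v)) = 0" using False by simp
      ultimately show ?thesis by (simp add: k_def)
    qed
  qed
  have kR: "riemannian_metric Q k" unfolding riemannian_metric_def using kt kpos by blast
  have kD: "k q u w = g q u w" if q: "q \<in> points Q" and u: "u \<in> D q" and w: "w \<in> D q" for q u w
  proof -
    obtain r s where r: "u = lincomb {1..m} r (\<lambda>\<alpha>. X \<alpha> q)" and s: "w = lincomb {1..m} s (\<lambda>\<alpha>. X \<alpha> q)"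
      using u w unfolding D_span[OF q] by blast
    have fu: "frame_coeff X q u = (\<lambda>\<alpha>. if \<alpha> \<in> {1..m} then r \<alpha> else 0)"
      and fw: "frame_coeff X q w = (\<lambda>\<alpha>. if \<alpha> \<in> {1..m} then s \<alpha> else 0)"
      unfolding r s by (rule frame_coeff_lincomb[OF q D_subset])+
    have \<beta>u: "\<beta> a q u = r a" "\<beta> a q w = s a" if "a \<in> {1..m}" for a
      using that by (simp_all add: \<beta>_def fu fw)
    have "k q u w = (\<Sum>a=1..m. \<Sum>b=1..m. r a * s b * ?g a b q)"
      unfolding k_def by (simp add: \<beta>u fu fw mult_ac)
    also have "\<dots> = g q u w"
      unfolding r s by (rule tensor_lincomb2[OF metric_tensor q, symmetric]) (erule frame_tspace[OF D_index], rule q)+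
    finally show ?thesis .
  qed
  have kP: "preserving_modification Q D g k" unfolding preserving_modification_def using kt kD by blast
  have "k q (X a q) (X i q) = h q (X a q) (X i q)" if q: "q \<in> points Q" and a: "a \<in> {1..m}" and i: "i \<in> ?I" for q a i
  proof -
    note fa = frame_coeff_frame[OF q D_index[OF a]] and fi = frame_coeff_frame[OF q perp_index[OF i]]
    have ne: "i \<noteq> a" "j \<in> ?I \<Longrightarrow> j \<noteq> a" "b \<in> {1..m} \<Longrightarrow> b \<noteq> i" for j b using a i by auto
    have \<beta>a: "\<beta> b q (X a q) = (if b = a then 1 else 0)" if "b \<in> {1..m}" for b
      unfolding \<beta>_def fa using ne(2) by (simp add: sum.neutral)
    have \<beta>i: "\<beta> b q (X i q) = y i b q" if "b \<in> {1..m}" for b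
      unfolding \<beta>_def fi using ne(3)[OF that] i by (simp add: if_distrib[of "\<lambda>r. _ * r"] cong: if_cong)
    have "k q (X a q) (X i q) = (\<Sum>a'=1..m. \<Sum>b=1..m. ?g a' b q * ((if a' = a then 1 else 0) * y i b q))
      + (\<Sum>j\<in>?I. (if j = a then 1 else 0) * (if j = i then 1 else 0))"
      unfolding k_def fa fi by (simp add: \<beta>a \<beta>i)
    also have "(\<Sum>j\<in>?I. (if j = a then 1 else 0) * (if j = i then 1 else 0 :: real)) = 0"
      using ne(2) by (intro sum.neutral) auto
    also have "(\<Sum>a'=1..m. \<Sum>b=1..m. ?g a' b q * ((if a' = a then 1 else 0) * y i b q)) = (\<Sum>a'=1..m. if a' = a then \<Sum>b=1..m. ?g a' b q * y i b q else 0)"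
      by (intro sum.cong refl) simp
    also have "\<dots> = h q (X a q) (X i q)" using a ye[OF i q a] by simp
    finally show ?thesis by simp
  qed
  with kR kP show ?thesis by (rule that)
qed

text \<open>Both groups of conditions depend on the tensor only through the functions \<open>\<theta>\<^sub>i\<close>.\<close>

lemma geodesic_extension_exists:
  assumes h: "preserving_modification Q D g h"
    and A: "algebraic_conditions Q m X h" and B: "pde_conditions Q L m D X h"
  shows "\<exists>k. geodesic_extension Q L m D X k"
proof -
  have sh: "symmetric_tensor_field Q h" using h unfolding preserving_modification_def by blast
  obtain k where kR: "riemannian_metric Q k" and kP: "preserving_modification Q D g k"
    and kX: "\<And>q a i. q \<in> points Q \<Longrightarrow> a \<in> {1..m} \<Longrightarrow> i \<in> {m+1..DIM('e)} \<Longrightarrow> k q (X a q) (X i q) = h q (X a q) (X i q)"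
    by (rule riemannian_modification_exists[OF sh]) blast
  have th: "theta m X k i p = theta m X h i p" if "p \<in> C" "i \<in> {m+1..DIM('e)}" for p i
    using kX[OF conjunct1[OF tb_pointsD[OF C_points[OF that(1)]]] _ that(2)]
    by (simp add: theta_def)
  have sub: "tderiv_sub TB C p w (theta m X k i) = tderiv_sub TB C p w (theta m X h i)" if "i \<in> {m+1..DIM('e)}" for i p w
    unfolding tderiv_sub_def using th[OF _ that] by (simp cong: ball_cong)
  have E: "(\<Sum>j=m+1..DIM('e). \<Sum>a=1..m. theta m X k j p * r a j * w a)
      = (\<Sum>j=m+1..DIM('e). \<Sum>a=1..m. theta m X h j p * r a j * w a)"
    if "p \<in> C" for p and r :: "nat \<Rightarrow> nat \<Rightarrow> real" and w :: "nat \<Rightarrow> real"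
    by (intro sum.cong refl) (simp only: th[OF that])
  have "algebraic_conditions Q m X k"
    using A unfolding algebraic_conditions_def by (simp only: E cong: ball_cong) simp
  moreover have "pde_conditions Q L m D X k"
    using B unfolding pde_conditions_def by (simp only: E sub cong: ball_cong) simp
  ultimately have "geodesic_extension Q L m D X k"
    unfolding geodesic_extension_iff[OF kR] conditions_iff[OF kP, symmetric] by blast
  then show ?thesis by blast
qed

end

theorem proposition4:
  fixes Q :: "('q, 'c, 'e::euclidean_space) mfd"
    and g :: "('q, 'c, 'e) tensor2"
    and D :: "'q \<Rightarrow> ('c \<Rightarrow> 'e) set"
    and X :: "nat \<Rightarrow> 'q \<Rightarrow> 'c \<Rightarrow> 'e"
    and L :: "'q \<times> ('c \<Rightarrow> 'e) \<Rightarrow> real"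
    and m :: nat
  assumes "smooth_manifold Q"
    and "riemannian_metric Q g"
    and "L = kinetic_lagrangian g"
    and "distribution Q m D"
    and "adapted_frame Q g m D X"
  shows "(\<forall>gh. riemannian_metric Q gh \<and> preserving_modification Q D g gh \<and>
               geodesic_extension Q L m D X gh \<longrightarrow>
               algebraic_conditions Q m X gh \<and> pde_conditions Q L m D X gh) \<and>
         (\<forall>gh. preserving_modification Q D g gh \<and>
               algebraic_conditions Q m X gh \<and> pde_conditions Q L m D X gh \<longrightarrow>
               (\<exists>gh'. geodesic_extension Q L m D X gh'))"
proof -
  interpret smooth_atlas Q by (rule smooth_manifold_imp_atlas[OF assms(1)])
  interpret nonholonomic_frame Q g D X m by standard (rule assms(2), rule assms(5))
  show ?thesis unfolding assms(3)
    using geodesic_extension_iff conditions_iff geodesic_extension_exists by blast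
qed

end
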